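(* Let $a\ge0$ and $b\ge1$ be integers and $\alpha=(1^a,b)$ the composition consisting of $a$ ones followed by $b$. Then $$\chi(\mathbf{H}_\alpha^{qt})=H_{(b,1^a)}^{qt},$$ where $\mathbf{H}_\alpha^{qt}=\sum_{\beta\models|\alpha|}t^{c(\alpha,\beta^c)}q^{c(\alpha',\overleftarrow{\beta})}\,\mathbf{s}_\beta$ and $H_\lambda^{qt}=\sum_{\mu\vdash|\lambda|}K_{\mu\lambda}(q,t)\,s_\mu$ is the Macdonald symmetric function.
   Context: A composition $\alpha$ of a positive integer $n$ ($\alpha\models n$) is a sequence $(\alpha_1,\dots,\alpha_\ell)$ of positive integers with sum $n$; $|\alpha|=n$, $\ell(\alpha)=\ell$. The descent set is $D(\alpha)=\{\alpha_1,\alpha_1+\alpha_2,\dots,\alpha_1+\cdots+\alpha_{\ell-1}\}\subseteq\{1,\dots,n-1\}$; $\alpha\mapsto D(\alpha)$ is a bijection onto subsets of $\{1,\dots,n-1\}$. For compositions of the same $n$, $\alpha\le\beta$ (equivalently $\beta\ge\alpha$) means $D(\beta)\subseteq D(\alpha)$. Involutions: $\overleftarrow{\alpha}=(\alpha_\ell,\dots,\alpha_1)$; $\alpha^c$ is the composition of $n$ with $D(\alpha^c)=\{1,\dots,n-1\}\setminus D(\alpha)$; $\alpha'=\overleftarrow{\alpha^c}$. For $\alpha,\beta\models n$, $c(\alpha,\beta)=\sum_{i\in D(\alpha)\cap D(\beta)} i$. $NC\Lambda$ is the free associative algebra on $\mathbf{h}_1,\mathbf{h}_2,\dots$ over $\mathbb{Q}$,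 with coefficients extended to $\mathbb{Q}(q,t)$. Put $\mathbf{h}_\alpha=\mathbf{h}_{\alpha_1}\cdots\mathbf{h}_{\alpha_\ell}$. The ribbon Schur functions are $\mathbf{s}_\alpha=\sum_{\beta\ge\alpha}(-1)^{\ell(\alpha)-\ell(\beta)}\mathbf{h}_\beta$. $\Lambda$ is the ring of (commutative) symmetric functions with complete homogeneous functions $h_k$ and Schur functions $s_\mu$. $\chi:NC\Lambda\to\Lambda$ is the algebra homomorphism with $\chi(\mathbf{h}_k)=h_k$, extended linearly to coefficients in $\mathbb{Q}(q,t)$. $K_{\mu\lambda}(q,t)$ are the Macdonald-Kostka coefficients, as in Macdonald's book: $J_\lambda(x;q,t)=\sum_\mu K_{\mu\lambda}(q,t)S_\mu(x;t)$, where $J_\lambda$ is the integral form Macdonald function and $S_\mu(x;t)$ is the dual basis of $s_\mu$ for the Hall-Littlewood scalar product $\langle p_\lambda,p_\mu\rangle_t=\delta_{\lambda\mu}z_\lambda\prod_i(1-t^{\lambda_i})^{-1}$. *)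

theory Defs
  imports
    "HOL-Library.Multiset"
    "HOL-Library.Poly_Mapping"
    "HOL-Computational_Algebra.Polynomial"
    "HOL-Computational_Algebra.Fraction_Field"
    "Jordan_Normal_Form.Determinant"
begin

section \<open>The coefficient field\<close>

text \<open>
  The field of rational functions in \<open>q\<close> and \<open>t\<close> over the rationals is the fraction field of
  \<open>\<rat>[q][t]\<close>.
\<close>

type_synonym qt = "rat poly poly fract"

definition q :: qt where
  "q = Fract [:[:0, 1:]:] 1"

definition t :: qt where
  "t = Fract [:0, 1:] 1"


section \<open>Compositions\<close>

definition compositions :: "nat \<Rightarrow> nat list set" where
  "compositions n = {\<alpha>. 0 \<notin> set \<alpha> \<and> sum_list \<alpha> = n}"

definition descents :: "nat list \<Rightarrow> nat set" where
  "descents \<alpha> = {sum_list (take k \<alpha>) | k. 1 \<le> k \<and> k < length \<alpha>}"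

definition complement :: "nat list \<Rightarrow> nat list" where
  "complement \<alpha> = (THE \<beta>. \<beta> \<in> compositions (sum_list \<alpha>) \<and>
     descents \<beta> = {1..<sum_list \<alpha>} - descents \<alpha>)"

definition conjugate :: "nat list \<Rightarrow> nat list" where
  "conjugate \<alpha> = rev (complement \<alpha>)"

text \<open>The compositions \<open>\<beta> \<ge> \<alpha>\<close>, i.e. those coarser than \<open>\<alpha>\<close>.\<close>

definition coarsenings :: "nat list \<Rightarrow> nat list set" where
  "coarsenings \<alpha> = {\<beta> \<in> compositions (sum_list \<alpha>). descents \<beta> \<subseteq> descents \<alpha>}"

definition common_sum :: "nat list \<Rightarrow> nat list \<Rightarrow> nat" where
  "common_sum \<alpha> \<beta> = \<Sum>(descents \<alpha> \<inter> descents \<beta>)"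


section \<open>Noncommutative symmetric functions\<close>

text \<open>
  The free associative algebra is the monoid algebra of the free monoid. The letter \<open>i\<close> stands
  for the generator \<open>\<^bold>h\<close> of degree \<open>i + 1\<close>.
\<close>

datatype 'a free_monoid = Word (letters: "'a list")

instantiation free_monoid :: (type) monoid_add
begin

definition "0 = Word []"
definition "u + v = Word (letters u @ letters v)"

instance
  by standard (simp_all add: zero_free_monoid_def plus_free_monoid_def)

end

type_synonym ncsym = "nat free_monoid \<Rightarrow>\<^sub>0 qt"

definition nc_scale :: "qt \<Rightarrow> ncsym \<Rightarrow> ncsym" where
  "nc_scale c f = Poly_Mapping.single 0 c * f"

definition nc_h :: "nat \<Rightarrow> ncsym" where
  "nc_h k = (if k = 0 then 1 else Poly_Mapping.single (Word [k - 1]) 1)"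

definition nc_h_comp :: "nat list \<Rightarrow> ncsym" where
  "nc_h_comp \<alpha> = prod_list (map nc_h \<alpha>)"

definition ribbon :: "nat list \<Rightarrow> ncsym" where
  "ribbon \<alpha> = (\<Sum>\<beta>\<in>coarsenings \<alpha>. (-1) ^ (length \<alpha> - length \<beta>) * nc_h_comp \<beta>)"

definition nc_H :: "nat list \<Rightarrow> ncsym" where
  "nc_H \<alpha> = (\<Sum>\<beta>\<in>compositions (sum_list \<alpha>).
     nc_scale (t ^ common_sum \<alpha> (complement \<beta>) * q ^ common_sum (conjugate \<alpha>) (rev \<beta>))
       (ribbon \<beta>))"


section \<open>The ring of symmetric functions\<close>

text \<open>
  Monomials in the variables \<open>x\<^sub>0, x\<^sub>1, \<dots>\<close> are finite multisets of indices. A symmetric function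
  is a formal power series (a coefficient for every monomial) of bounded degree that is invariant
  under all permutations of the variables.
\<close>

typedef (overloaded) 'a symfun =
  "{f :: nat multiset \<Rightarrow> 'a::comm_ring_1.
     (\<exists>d. \<forall>m. size m > d \<longrightarrow> f m = 0) \<and> (\<forall>\<sigma> m. bij \<sigma> \<longrightarrow> f (image_mset \<sigma> m) = f m)}"
  morphisms coeff_sf Abs_symfun
  by (rule exI[of _ "\<lambda>_. 0"]) auto

setup_lifting type_definition_symfun

definition msplits :: "'b multiset \<Rightarrow> ('b multiset \<times> 'b multiset) set" where
  "msplits m = {(a, b). a + b = m}"

lemma finite_msplits [simp]: "finite (msplits m)"
proof -
  have "finite (\<Union>n\<le>size m. multisets_of_size (set_mset m) n)"
    by auto
  moreover have "{a. a \<subseteq># m} \<subseteq> (\<Union>n\<le>size m. multisets_of_size (set_mset m) n)"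
    by (auto simp: multisets_of_size_def size_mset_mono dest: mset_subset_eqD)
  ultimately have "finite ({a. a \<subseteq># m} \<times> {a. a \<subseteq># m})"
    by (auto dest: finite_subset)
  moreover have "msplits m \<subseteq> {a. a \<subseteq># m} \<times> {a. a \<subseteq># m}"
    by (auto simp: msplits_def)
  ultimately show ?thesis
    by (rule rev_finite_subset)
qed

lemma msplits_image:
  assumes "bij \<sigma>"
  shows "bij_betw (\<lambda>(a, b). (image_mset \<sigma> a, image_mset \<sigma> b)) (msplits m) (msplits (image_mset \<sigma> m))"
proof -
  have j: "image_mset (inv_into UNIV \<sigma>) (image_mset \<sigma> a) = a" "image_mset \<sigma> (image_mset (inv_into UNIV \<sigma>) b) = b" for a b
    using assms
    by (simp_all add: multiset.map_comp comp_def bij_is_inj surj_f_inv_f bij_is_surj)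
  show ?thesis
    by (rule bij_betwI[where g = "\<lambda>(a, b). (image_mset (inv_into UNIV \<sigma>) a, image_mset (inv_into UNIV \<sigma>) b)"])
      (auto simp: msplits_def j image_mset_union [symmetric] simp del: image_mset_union)
qed

instantiation symfun :: (comm_ring_1) comm_ring_1
begin

lift_definition zero_symfun :: "'a symfun" is "\<lambda>_. 0"
  by auto

lift_definition one_symfun :: "'a symfun" is "\<lambda>m. if m = {#} then 1 else 0"
  by auto

lift_definition plus_symfun :: "'a symfun \<Rightarrow> 'a symfun \<Rightarrow> 'a symfun" is "\<lambda>f g m. f m + g m"
proof safe
  fix f g :: "nat multiset \<Rightarrow> 'a" and d e
  assume "\<forall>m. d < size m \<longrightarrow> f m = 0" "\<forall>m. e < size m \<longrightarrow> g m = 0"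
  then show "\<exists>d. \<forall>m. d < size m \<longrightarrow> f m + g m = 0"
    by (intro exI[of _ "max d e"]) auto
qed auto

lift_definition uminus_symfun :: "'a symfun \<Rightarrow> 'a symfun" is "\<lambda>f m. - f m"
  by auto

lift_definition minus_symfun :: "'a symfun \<Rightarrow> 'a symfun \<Rightarrow> 'a symfun" is "\<lambda>f g m. f m - g m"
proof safe
  fix f g :: "nat multiset \<Rightarrow> 'a" and d e
  assume "\<forall>m. d < size m \<longrightarrow> f m = 0" "\<forall>m. e < size m \<longrightarrow> g m = 0"
  then show "\<exists>d. \<forall>m. d < size m \<longrightarrow> f m - g m = 0"
    by (intro exI[of _ "max d e"]) auto
qed auto

lift_definition times_symfun :: "'a symfun \<Rightarrow> 'a symfun \<Rightarrow> 'a symfun" is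
  "\<lambda>f g m. \<Sum>(a, b)\<in>msplits m. f a * g b"
proof safe
  fix f g :: "nat multiset \<Rightarrow> 'a" and d e
  assume f: "\<forall>m. d < size m \<longrightarrow> f m = 0" and g: "\<forall>m. e < size m \<longrightarrow> g m = 0"
  have "(\<Sum>(a, b)\<in>msplits m. f a * g b) = 0" if m: "d + e < size m" for m
  proof (rule sum.neutral, safe)
    fix a b assume "(a, b) \<in> msplits m"
    then have "size a + size b = size m"
      by (auto simp: msplits_def)
    then have "d < size a \<or> e < size b"
      using m by linarith
    then show "f a * g b = 0"
      using f g by auto
  qed
  then show "\<exists>d. \<forall>m. d < size m \<longrightarrow> (\<Sum>(a, b)\<in>msplits m. f a * g b) = 0"
    by blast
next
  fix f g :: "nat multiset \<Rightarrow> 'a" and \<sigma> :: "nat \<Rightarrow> nat" and m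
  assume "\<forall>\<sigma> m. bij \<sigma> \<longrightarrow> f (image_mset \<sigma> m) = f m" "\<forall>\<sigma> m. bij \<sigma> \<longrightarrow> g (image_mset \<sigma> m) = g m"
    and \<sigma>: "bij \<sigma>"
  then show "(\<Sum>(a, b)\<in>msplits (image_mset \<sigma> m). f a * g b) = (\<Sum>(a, b)\<in>msplits m. f a * g b)"
    by (subst sum.reindex_bij_betw[OF msplits_image[OF \<sigma>], symmetric])
      (auto intro!: sum.cong)
qed

instance
proof
  fix f g k :: "'a symfun"
  show "f * g * k = f * (g * k)"
  proof (transfer, rule ext)
    fix f g k :: "nat multiset \<Rightarrow> 'a" and m :: "nat multiset"
    have "(\<Sum>(a, b)\<in>msplits m. (\<Sum>(c, d)\<in>msplits a. f c * g d) * k b) =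
        (\<Sum>((a, b), (c, d))\<in>(SIGMA p:msplits m. msplits (fst p)). f c * g d * k b)"
      by (subst sum.Sigma[symmetric]) (auto simp: case_prod_unfold sum_distrib_right)
    also have "\<dots> = (\<Sum>((a, b), (c, d))\<in>(SIGMA p:msplits m. msplits (snd p)). f a * (g c * k d))"
      by (rule sum.reindex_bij_witness[of _ "\<lambda>((a, b), (c, d)). ((a + c, d), (a, c))"
            "\<lambda>((a, b), (c, d)). ((c, d + b), (d, b))"])
        (auto simp: msplits_def add.assoc mult.assoc)
    also have "\<dots> = (\<Sum>(a, b)\<in>msplits m. f a * (\<Sum>(c, d)\<in>msplits b. g c * k d))"
      by (subst sum.Sigma[symmetric]) (auto simp: case_prod_unfold sum_distrib_left)
    finally show "(\<Sum>(a, b)\<in>msplits m. (\<Sum>(c, d)\<in>msplits a. f c * g d) * k b) =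
        (\<Sum>(a, b)\<in>msplits m. f a * (\<Sum>(c, d)\<in>msplits b. g c * k d))" .
  qed
  show "f * g = g * f"
  proof (transfer, rule ext)
    fix f g :: "nat multiset \<Rightarrow> 'a" and m :: "nat multiset"
    show "(\<Sum>(a, b)\<in>msplits m. f a * g b) = (\<Sum>(a, b)\<in>msplits m. g a * f b)"
      by (rule sum.reindex_bij_witness[of _ prod.swap prod.swap])
        (auto simp: msplits_def add.commute mult.commute)
  qed
  show "1 * f = f"
  proof (transfer, rule ext)
    fix f :: "nat multiset \<Rightarrow> 'a" and m :: "nat multiset"
    have "(\<Sum>(a, b)\<in>msplits m. (if a = {#} then 1 else 0) * f b) =
        (\<Sum>(a, b)\<in>{({#} :: nat multiset, m)}. (if a = {#} then 1 else 0) * f b)"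
      by (rule sum.mono_neutral_right[OF finite_msplits]) (auto simp: msplits_def split: if_splits)
    then show "(\<Sum>(a, b)\<in>msplits m. (if a = {#} then 1 else 0) * f b) = f m"
      by simp
  qed
  show "(f + g) * k = f * k + g * k"
    by (transfer, rule ext) (simp add: case_prod_unfold distrib_right sum.distrib)
  show "(0 :: 'a symfun) \<noteq> 1"
    by transfer (metis zero_neq_one)
qed (transfer; simp add: algebra_simps)+

end

lift_definition sf_scale :: "'a \<Rightarrow> 'a symfun \<Rightarrow> 'a::comm_ring_1 symfun" is "\<lambda>c f m. c * f m"
  by (metis mult_zero_right)

lemma sf_scale_zero: "sf_scale 0 f = 0"
  by transfer simp

lemma sf_scale_one: "sf_scale 1 f = f"
  by transfer simp

lemma sf_scale_add: "sf_scale (c + d) f = sf_scale c f + sf_scale d f"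
  by transfer (simp add: distrib_right)

lemma sf_scale_mult: "sf_scale (c * d) (f * g) = sf_scale c f * sf_scale d g"
  by (transfer, rule ext) (simp add: sum_distrib_left case_prod_unfold mult_ac)

lemma sf_scale_mult_left: "sf_scale c f = sf_scale c 1 * f"
  using sf_scale_mult[of c 1 1 f] by (simp add: sf_scale_one)

lift_definition sf_h :: "nat \<Rightarrow> 'a::comm_ring_1 symfun" is
  "\<lambda>k m. if size m = k then 1 else 0"
  by auto

lemma sf_h_zero: "sf_h 0 = 1"
  by transfer auto

text \<open>\<open>exponents m\<close> is the multiset of nonzero exponents of the monomial \<open>m\<close>.\<close>

definition exponents :: "'b multiset \<Rightarrow> nat multiset" where
  "exponents m = image_mset (count m) (mset_set (set_mset m))"

lemma exponents_image:
  assumes "bij \<sigma>"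
  shows "exponents (image_mset \<sigma> m) = exponents m"
proof -
  have inj: "inj \<sigma>"
    using assms by (rule bij_is_inj)
  then have "{y \<in> set_mset m. \<sigma> x = \<sigma> y} = (if x \<in># m then {x} else {})" for x
    by (auto dest: injD)
  then have c: "count (image_mset \<sigma> m) (\<sigma> x) = count m x" for x
    by (auto simp: count_image_mset' not_in_iff)
  have "mset_set (\<sigma> ` set_mset m) = image_mset \<sigma> (mset_set (set_mset m))"
    using inj by (simp add: image_mset_mset_set inj_on_subset)
  then show ?thesis
    by (simp add: exponents_def multiset.map_comp comp_def c)
qed

text \<open>
  Partitions are weakly decreasing lists of positive numbers. The monomial symmetric function
  \<open>m\<^sub>\<nu>\<close> is the sum of all monomials with exponents \<open>\<nu>\<close>, and \<open>p\<^sub>k = m\<^sub>(\<^sub>k\<^sub>)\<close> for \<open>k \<ge> 1\<close>.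
\<close>

definition partitions :: "nat \<Rightarrow> nat list set" where
  "partitions n = {\<nu>. sorted_wrt (\<ge>) \<nu> \<and> 0 \<notin> set \<nu> \<and> sum_list \<nu> = n}"

definition is_partition :: "nat list \<Rightarrow> bool" where
  "is_partition \<nu> \<longleftrightarrow> \<nu> \<in> partitions (sum_list \<nu>)"

lift_definition sf_m :: "nat list \<Rightarrow> 'a::comm_ring_1 symfun" is
  "\<lambda>\<nu> m. if exponents m = mset \<nu> then 1 else 0"
proof safe
  fix \<nu> :: "nat list"
  have "size m = sum_mset (exponents m)" for m :: "nat multiset"
    by (simp add: exponents_def size_multiset_overloaded_eq sum_unfold_sum_mset)
  then show "\<exists>d. \<forall>m::nat multiset. d < size m \<longrightarrow>
      (if exponents m = mset \<nu> then 1 else 0 :: 'a) = 0"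
    by (intro exI[of _ "sum_list \<nu>"]) (auto simp: sum_mset_sum_list)
qed (simp add: exponents_image)

definition sf_p :: "nat \<Rightarrow> 'a::comm_ring_1 symfun" where
  "sf_p k = sf_m [k]"

definition sf_p_part :: "nat list \<Rightarrow> 'a::comm_ring_1 symfun" where
  "sf_p_part \<nu> = prod_list (map sf_p \<nu>)"

text \<open>Schur functions by the Jacobi--Trudi formula \<open>s\<^sub>\<nu> = det (h\<^bsub>\<nu>\<^sub>i - i + j\<^esub>)\<close>, where
  \<open>h\<^sub>k = 0\<close> for \<open>k < 0\<close>.\<close>

definition schur :: "nat list \<Rightarrow> 'a::comm_ring_1 symfun" where
  "schur \<nu> = det (mat (length \<nu>) (length \<nu>)
     (\<lambda>(i, j). if i \<le> \<nu> ! i + j then sf_h (\<nu> ! i + j - i) else 0))"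


section \<open>The homomorphism from noncommutative to commutative symmetric functions\<close>

definition chi :: "ncsym \<Rightarrow> qt symfun" where
  "chi f = (\<Sum>w\<in>Poly_Mapping.keys f. sf_scale (Poly_Mapping.lookup f w)
     (prod_list (map (\<lambda>i. sf_h (Suc i)) (letters w))))"


lemma chi_eq:
  assumes "finite W" "Poly_Mapping.keys f \<subseteq> W"
  shows "chi f = (\<Sum>w\<in>W. sf_scale (Poly_Mapping.lookup f w)
    (prod_list (map (\<lambda>i. sf_h (Suc i)) (letters w))))"
  unfolding chi_def
  by (rule sum.mono_neutral_left) (use assms in \<open>auto simp: in_keys_iff sf_scale_zero\<close>)

lemma chi_single:
  "chi (Poly_Mapping.single w c) = sf_scale c (prod_list (map (\<lambda>i. sf_h (Suc i)) (letters w)))"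
  by (cases "c = 0") (simp_all add: chi_def sf_scale_zero)

lemma chi_add: "chi (f + g) = chi f + chi g"
proof -
  let ?W = "Poly_Mapping.keys f \<union> Poly_Mapping.keys g"
  have "Poly_Mapping.keys (f + g) \<subseteq> ?W"
    by (rule keys_add)
  then show ?thesis
    by (simp add: chi_eq[of ?W] lookup_add sf_scale_add sum.distrib)
qed

lemma ncsym_induct:
  fixes f :: ncsym
  assumes "P 0" and step: "\<And>f w c. P f \<Longrightarrow> P (f + Poly_Mapping.single w c)"
  shows "P f"
proof (induction f rule: update_induct)
  case (update f w c)
  then have "Poly_Mapping.update w c f = f + Poly_Mapping.single w c"
    by (intro poly_mapping_eqI) (auto simp: lookup_update lookup_add lookup_single in_keys_iff)
  then show ?case
    using step[OF update(3)] by simp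
qed fact

lemma chi_mult: "chi (f * g) = chi f * chi g"
proof -
  have single: "chi (Poly_Mapping.single u c * Poly_Mapping.single v d) =
      chi (Poly_Mapping.single u c) * chi (Poly_Mapping.single v d)" for u v c d
    by (simp add: mult_single chi_single plus_free_monoid_def sf_scale_mult)
  have zero: "chi 0 = 0"
    by (simp add: chi_def)
  have left: "chi (f * Poly_Mapping.single v d) = chi f * chi (Poly_Mapping.single v d)" for f v d
    by (induction f rule: ncsym_induct) (simp_all add: single distrib_right chi_add zero)
  show ?thesis
    by (induction g rule: ncsym_induct) (simp_all add: left distrib_left chi_add zero)
qed

lemma chi_one: "chi 1 = 1"
  by (simp add: chi_single zero_free_monoid_def sf_scale_one flip: single_one)

lemma chi_nc_scale: "chi (nc_scale c f) = sf_scale c (chi f)"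
  by (simp add: nc_scale_def chi_mult chi_single zero_free_monoid_def sf_scale_mult_left[of c "chi f"])

lemma chi_nc_h: "chi (nc_h k) = sf_h k"
  by (simp add: nc_h_def chi_one chi_single sf_scale_one sf_h_zero)


section \<open>Macdonald symmetric functions\<close>

text \<open>The coefficients of a symmetric function in the basis \<open>p\<^sub>\<nu>\<close>.\<close>

definition p_coeffs :: "qt symfun \<Rightarrow> nat list \<Rightarrow> qt" where
  "p_coeffs f = (THE c. finite {\<nu>. c \<nu> \<noteq> 0} \<and> (\<forall>\<nu>. c \<nu> \<noteq> 0 \<longrightarrow> is_partition \<nu>) \<and>
     f = (\<Sum>\<nu> | c \<nu> \<noteq> 0. sf_scale (c \<nu>) (sf_p_part \<nu>)))"

text \<open>The bilinear form with \<open>\<langle>p\<^sub>\<nu>, p\<^sub>\<mu>\<rangle> = \<delta>\<^bsub>\<nu>\<mu>\<^esub> w(\<nu>)\<close>.\<close>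

definition p_form :: "(nat list \<Rightarrow> qt) \<Rightarrow> qt symfun \<Rightarrow> qt symfun \<Rightarrow> qt" where
  "p_form w f g = (\<Sum>\<nu> | p_coeffs f \<nu> \<noteq> 0. p_coeffs f \<nu> * p_coeffs g \<nu> * w \<nu>)"

definition zee :: "nat list \<Rightarrow> nat" where
  "zee \<nu> = (\<Prod>i\<in>set \<nu>. i ^ count_list \<nu> i * fact (count_list \<nu> i))"

definition t_form :: "qt symfun \<Rightarrow> qt symfun \<Rightarrow> qt" where
  "t_form = p_form (\<lambda>\<nu>. of_nat (zee \<nu>) * prod_list (map (\<lambda>k. inverse (1 - t ^ k)) \<nu>))"

definition qt_form :: "qt symfun \<Rightarrow> qt symfun \<Rightarrow> qt" where
  "qt_form = p_form (\<lambda>\<nu>. of_nat (zee \<nu>) * prod_list (map (\<lambda>k. (1 - q ^ k) / (1 - t ^ k)) \<nu>))"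

definition dominated :: "nat list \<Rightarrow> nat list \<Rightarrow> bool" where
  "dominated \<mu> \<nu> \<longleftrightarrow> sum_list \<mu> = sum_list \<nu> \<and>
     (\<forall>k. sum_list (take k \<mu>) \<le> sum_list (take k \<nu>))"

text \<open>
  The Macdonald functions \<open>P\<^sub>\<nu>(x; q, t)\<close> form the unique family that is unitriangular with respect
  to the monomial symmetric functions in dominance order and pairwise orthogonal for \<open>qt_form\<close>.
\<close>

definition is_macdonald_family :: "(nat list \<Rightarrow> qt symfun) \<Rightarrow> bool" where
  "is_macdonald_family P \<longleftrightarrow>
     (\<forall>\<nu>. is_partition \<nu> \<longrightarrow> (\<exists>u. u \<nu> = 1 \<and>
        P \<nu> = (\<Sum>\<mu> | is_partition \<mu> \<and> dominated \<mu> \<nu>. sf_scale (u \<mu>) (sf_m \<mu>)))) \<and>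
     (\<forall>\<nu> \<mu>. is_partition \<nu> \<longrightarrow> is_partition \<mu> \<longrightarrow> \<nu> \<noteq> \<mu> \<longrightarrow> qt_form (P \<nu>) (P \<mu>) = 0)"

definition macdonald_P :: "nat list \<Rightarrow> qt symfun" where
  "macdonald_P = (THE P. is_macdonald_family P \<and> (\<forall>\<nu>. \<not> is_partition \<nu> \<longrightarrow> P \<nu> = 0))"

text \<open>
  Cells \<open>(i, j)\<close> of a diagram are numbered from \<open>0\<close>. The integral form is \<open>J\<^sub>\<nu> = c\<^sub>\<nu> P\<^sub>\<nu>\<close>, where
  \<open>c\<^sub>\<nu>\<close> is the product of \<open>1 - q\<^bsup>a(s)\<^esup> t\<^bsup>l(s) + 1\<^esup>\<close> over the cells \<open>s\<close> of \<open>\<nu>\<close> with arm length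
  \<open>a(s)\<close> and leg length \<open>l(s)\<close>.
\<close>

definition arm :: "nat list \<Rightarrow> nat \<Rightarrow> nat \<Rightarrow> nat" where
  "arm \<nu> i j = \<nu> ! i - Suc j"

definition leg :: "nat list \<Rightarrow> nat \<Rightarrow> nat \<Rightarrow> nat" where
  "leg \<nu> i j = card {k. i < k \<and> k < length \<nu> \<and> j < \<nu> ! k}"

definition macdonald_J :: "nat list \<Rightarrow> qt symfun" where
  "macdonald_J \<nu> = sf_scale (\<Prod>i<length \<nu>. \<Prod>j<\<nu> ! i. 1 - q ^ arm \<nu> i j * t ^ (leg \<nu> i j + 1))
     (macdonald_P \<nu>)"

definition big_schur :: "nat list \<Rightarrow> qt symfun" where
  "big_schur \<mu> = (THE f. \<forall>\<nu>. is_partition \<nu> \<longrightarrow> t_form f (schur \<nu>) = (if \<nu> = \<mu> then 1 else 0))"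

text \<open>\<open>kostka \<mu> \<nu>\<close> is \<open>K\<^bsub>\<mu>\<nu>\<^esub>(q, t)\<close>.\<close>

definition kostka :: "nat list \<Rightarrow> nat list \<Rightarrow> qt" where
  "kostka \<mu> \<nu> = (THE K. (\<forall>\<kappa>. \<kappa> \<notin> partitions (sum_list \<nu>) \<longrightarrow> K \<kappa> = 0) \<and>
     macdonald_J \<nu> = (\<Sum>\<kappa>\<in>partitions (sum_list \<nu>). sf_scale (K \<kappa>) (big_schur \<kappa>))) \<mu>"

definition macdonald_H :: "nat list \<Rightarrow> qt symfun" where
  "macdonald_H \<nu> = (\<Sum>\<mu>\<in>partitions (sum_list \<nu>). sf_scale (kostka \<mu> \<nu>) (schur \<mu>))"

end

theory Submission
  imports Defs "HOL-Computational_Algebra.Formal_Power_Series"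
begin

text \<open>
  For a weight \<open>\<sigma>\<close> on the power sums let \<open>pexp \<sigma> n\<close> be the degree \<open>n\<close> part of
  \<open>exp (\<Sum>k. \<sigma> k p\<^sub>k / k)\<close>. With respect to a form for which the \<open>p\<^sub>\<nu>\<close> are orthogonal, multiplication by it is
  adjoint to an explicit operator, and for the form of the Macdonald functions multiplication by
  \<open>g\<^sub>k = h\<^sub>k[X(1 - t)/(1 - q)]\<close> is adjoint to taking the coefficient of \<open>x\<^sub>0\<^sup>k\<close>. Hence the products \<open>g\<^sub>\<mu>\<close> are
  dual to the monomial functions, and the family \<open>P\<^sub>\<nu>\<close> exists because Macdonald's operator is self-adjoint,
  upper triangular on the \<open>g\<^sub>\<mu>\<close> and has distinct eigenvalues.

  For a hook, the function
  \<open>J = C \<Sum>r\<le>a. \<Sum>s<b. (-1)\<^sup>r q\<^sup>s e\<^sub>r g\<^sub>s h\<^bsub>a+b-r-s\<^esub>[X(1 - t)]\<close> vanishes in \<open>a\<close> variables (sum over \<open>r\<close> first) and is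
  orthogonal to all \<open>P\<^sub>\<mu>\<close> with \<open>\<mu>\<^sub>1 < b\<close> (sum over \<open>s\<close> first), so it is a multiple of \<open>P\<^bsub>(b,1\<^sup>a)\<^esub>\<close>; comparing the
  coefficients of the leading monomial shows that it is the integral form. On the noncommutative side,
  inclusion--exclusion turns the ribbon expansion into a sum over compositions of products of complete
  functions with weights that factor over the steps, and cutting each composition at the step across
  \<open>a\<close> gives the same sum with \<open>X\<close> replaced by \<open>X/(1 - t)\<close>. The Schur functions being orthonormal for
  the Hall scalar product, this substitution is the passage from \<open>J\<close> to \<open>H\<close>.
\<close>

section \<open>Coefficients of symmetric functions\<close>

text \<open>Power sum coordinates, \<open>macdonald_P\<close>, \<open>big_schur\<close> and
  \<open>kostka\<close> are all given by \<open>THE\<close>, so existence and uniqueness come before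
  any computation. Dominance is only a partial order, and orthogonalising along a total refinement
  does not by itself give the required triangularity; eigenvectors of a triangular operator do. With
  infinitely many variables this operator is taken as the constant term of a vertex operator made of
  multiplications and their adjoints: self-adjointness is then immediate, and triangularity becomes
  a commutation computation. Series exp(sum_k \<sigma> k p_k z^k / k) turn identities between
  alphabets into identities between the scalars \<sigma> k. Two of them explain the hook formula:
  sum_r (-1)^r e_r h_{n-r}[X(1-t)] = t^n (-1)^n e_n and sum_s q^s g_s h_{n-s}[X(1-t)] = g_n. Cutting
  the first at r = a leaves only e_r with r > a, which vanish in a variables; cutting the second at
  s = b - 1 leaves only g_s with s >= b, whose adjoints kill P_\<mu> with \<mu>_1 < b. One double
  sum has both properties.\<close>

lemmas coeff_sf_simps =
  zero_symfun.rep_eq one_symfun.rep_eq plus_symfun.rep_eq minus_symfun.rep_eq uminus_symfun.rep_eq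
  sf_scale.rep_eq

lemma symfun_eqI: "(\<And>m. coeff_sf f m = coeff_sf g m) \<Longrightarrow> f = g"
  by (rule coeff_sf_inject[THEN iffD1]) (rule ext)

lemma coeff_sf_sum: "coeff_sf (sum f S) m = (\<Sum>x\<in>S. coeff_sf (f x) m)"
  by (induction S rule: infinite_finite_induct) (simp_all add: coeff_sf_simps)

lemma coeff_sf_times: "coeff_sf (f * g) m = (\<Sum>(a, b)\<in>msplits m. coeff_sf f a * coeff_sf g b)"
  by (simp add: times_symfun.rep_eq)

lemma sf_scale_add_right: "sf_scale c (f + g) = sf_scale c f + sf_scale c g"
  by (rule symfun_eqI) (simp add: coeff_sf_simps algebra_simps)

lemma sf_scale_scale: "sf_scale c (sf_scale d f) = sf_scale (c * d) f"
  by (rule symfun_eqI) (simp add: coeff_sf_simps algebra_simps)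

lemma mult_sf_scale_left: "sf_scale c f * g = sf_scale c (f * g)"
  using sf_scale_mult[of c 1 f g] by (simp add: sf_scale_one)

lemma mult_sf_scale_right: "f * sf_scale c g = sf_scale c (f * g)"
  using sf_scale_mult[of 1 c f g] by (simp add: sf_scale_one)

interpretation sf: vector_space "sf_scale :: 'a::field \<Rightarrow> 'a symfun \<Rightarrow> 'a symfun"
  by standard (simp_all add: sf_scale_add_right sf_scale_add sf_scale_scale sf_scale_one)

abbreviation sf_linear :: "('a::field symfun \<Rightarrow> 'a symfun) \<Rightarrow> bool" where
  "sf_linear \<equiv> Vector_Spaces.linear sf_scale sf_scale"

lemma sf_linearI:
  "(\<And>f g. T (f + g) = T f + T g) \<Longrightarrow> (\<And>c f. T (sf_scale c f) = sf_scale c (T f)) \<Longrightarrow> sf_linear T"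
  by unfold_locales

lemma sf_linearD:
  assumes "sf_linear T"
  shows "T (f + g) = T f + T g" "T (f - g) = T f - T g" "T 0 = 0" "T (- f) = - T f"
    "T (sf_scale c f) = sf_scale c (T f)" "T (sum h S) = (\<Sum>x\<in>S. T (h x))"
proof -
  interpret Vector_Spaces.linear sf_scale sf_scale T by fact
  show "T (f + g) = T f + T g" "T (f - g) = T f - T g" "T 0 = 0" "T (- f) = - T f"
    "T (sf_scale c f) = sf_scale c (T f)" "T (sum h S) = (\<Sum>x\<in>S. T (h x))"
    by (simp_all add: add diff zero neg scale sum)
qed

lemma of_nat_sf_scale: "of_nat n * f = sf_scale (of_nat n) (f :: 'a::comm_ring_1 symfun)"
  by (induction n) (simp_all add: sf_scale_zero sf_scale_add sf_scale_one algebra_simps)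

text \<open>Newton's recursions determine only n times the n-th term; in characteristic 0 the factor
  can be removed.\<close>

lemma of_nat_mult_symfun_cancel:
  fixes f g :: "'a::field_char_0 symfun"
  assumes "n > 0" "of_nat n * f = of_nat n * g"
  shows "f = g"
  using assms by (simp add: of_nat_sf_scale)

text \<open>Symmetric functions are invariant under bijections of all indices, while a change of
  variables in one monomial is only injective on its support. The parts of S \<union> h(S) outside S
  and outside h(S) have equal size, and matching them closes h up to a permutation.\<close>

lemma bij_extending_inj_on:
  fixes h :: "nat \<Rightarrow> nat"
  assumes "finite S" "inj_on h S"
  obtains \<sigma> where "bij \<sigma>" "\<And>x. x \<in> S \<Longrightarrow> \<sigma> x = h x"
proof -
  let ?U = "S \<union> h ` S"
  have "card (?U - S) = card (?U - h ` S)"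
    using assms by (simp add: card_Diff_subset card_image)
  then obtain g where g: "bij_betw g (?U - S) (?U - h ` S)"
    using assms(1) by (metis finite_Diff finite_UnI finite_imageI finite_same_card_bij)
  define \<sigma> where "\<sigma> = (\<lambda>x. if x \<in> ?U then (if x \<in> S then h x else g x) else x)"
  have "bij_betw \<sigma> S (h ` S)"
    using assms(2) by (auto simp: bij_betw_def \<sigma>_def inj_on_def)
  moreover have "bij_betw \<sigma> (?U - S) (?U - h ` S)"
    using g by (subst bij_betw_cong[of _ _ g]) (auto simp: \<sigma>_def)
  ultimately have "bij_betw \<sigma> (S \<union> (?U - S)) (h ` S \<union> (?U - h ` S))"
    by (rule bij_betw_combine) blast
  then have "bij_betw \<sigma> ?U ?U"
    by (simp add: Un_absorb1 Un_absorb2 Un_commute Un_left_commute)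
  moreover have "bij_betw \<sigma> (- ?U) (- ?U)"
    by (subst bij_betw_cong[of _ _ id]) (auto simp: \<sigma>_def)
  ultimately have "bij_betw \<sigma> (?U \<union> - ?U) (?U \<union> - ?U)"
    by (rule bij_betw_combine) blast
  then have "bij \<sigma>"
    by (simp only: Compl_partition)
  then show thesis
    by (rule that) (simp add: \<sigma>_def)
qed

lemma coeff_sf_image_mset:
  assumes "inj_on h (set_mset m)"
  shows "coeff_sf f (image_mset h m) = coeff_sf f m"
proof -
  obtain \<sigma> where \<sigma>: "bij \<sigma>" "\<And>x. x \<in> set_mset m \<Longrightarrow> \<sigma> x = h x"
    using bij_extending_inj_on[OF finite_set_mset assms] by blast
  then have "image_mset h m = image_mset \<sigma> m"
    by (intro image_mset_cong) simp
  then show ?thesis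
    using coeff_sf[of f] \<sigma>(1) by simp
qed

text \<open>Entry i is the exponent of x_i, zeros allowed. The recursion shifts the variables so
  that \<open>h_adj\<close> undoes one step.\<close>

fun monomial_of :: "nat list \<Rightarrow> nat multiset" where
  "monomial_of [] = {#}"
| "monomial_of (k # \<alpha>) = image_mset Suc (monomial_of \<alpha>) + replicate_mset k 0"

lemma size_monomial_of [simp]: "size (monomial_of \<alpha>) = sum_list \<alpha>"
  by (induction \<alpha>) simp_all

lemma count_image_Suc: "count (image_mset Suc m) i = (case i of 0 \<Rightarrow> 0 | Suc j \<Rightarrow> count m j)"
proof (cases i)
  case (Suc j)
  then have "{x \<in> set_mset m. i = Suc x} = (if j \<in># m then {j} else {})"
    by auto
  with Suc show ?thesis
    by (auto simp: count_image_mset' not_in_iff)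
qed (auto simp: count_eq_zero_iff)

lemma count_monomial_of: "count (monomial_of \<alpha>) i = (if i < length \<alpha> then \<alpha> ! i else 0)"
  by (induction \<alpha> arbitrary: i) (auto simp: count_image_Suc nth_Cons split: nat.splits)

lemma set_monomial_of: "set_mset (monomial_of \<alpha>) = {i. i < length \<alpha> \<and> \<alpha> ! i \<noteq> 0}"
  unfolding set_eq_iff count_greater_zero_iff[symmetric] count_monomial_of by simp

lemma monomial_of_eq: "monomial_of \<alpha> = (\<Sum>i<length \<alpha>. replicate_mset (\<alpha> ! i) i)"
proof (rule multiset_eqI)
  fix i
  have "(\<Sum>j<length \<alpha>. count (replicate_mset (\<alpha> ! j) j) i) = (\<Sum>j<length \<alpha>. if j = i then \<alpha> ! j else 0)"
    by (rule sum.cong) auto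
  then show "count (monomial_of \<alpha>) i = count (\<Sum>i<length \<alpha>. replicate_mset (\<alpha> ! i) i) i"
    by (simp add: count_monomial_of count_sum)
qed

lemma image_mset_sum: "image_mset h (sum f S) = (\<Sum>x\<in>S. image_mset h (f x))"
  by (induction S rule: infinite_finite_induct) simp_all

lemma sum_mset_count_nat: "m = (\<Sum>x\<in>set_mset m. replicate_mset (count m x) x)"
proof (rule multiset_eqI)
  fix i
  have "(\<Sum>j\<in>set_mset m. count (replicate_mset (count m j) j) i) = (\<Sum>j\<in>set_mset m. if j = i then count m j else 0)"
    by (rule sum.cong) auto
  then show "count m i = count (\<Sum>x\<in>set_mset m. replicate_mset (count m x) x) i"
    by (auto simp: count_sum not_in_iff)
qed

lemma exponents_image_inj:
  fixes h :: "nat \<Rightarrow> nat"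
  assumes "inj_on h (set_mset m)"
  shows "exponents (image_mset h m) = exponents m"
proof -
  obtain \<sigma> where \<sigma>: "bij \<sigma>" "\<And>x. x \<in> set_mset m \<Longrightarrow> \<sigma> x = h x"
    using bij_extending_inj_on[OF finite_set_mset assms] by blast
  then have "image_mset h m = image_mset \<sigma> m"
    by (intro image_mset_cong) simp
  then show ?thesis
    by (simp add: exponents_image \<sigma>(1))
qed

lemma exponents_monomial_of:
  assumes "0 \<notin> set \<nu>"
  shows "exponents (monomial_of \<nu>) = mset \<nu>"
proof -
  have s: "set_mset (monomial_of \<nu>) = {..<length \<nu>}"
    using assms by (force simp: set_monomial_of in_set_conv_nth)
  have "exponents (monomial_of \<nu>) = image_mset ((!) \<nu>) (mset_set {..<length \<nu>})"
    unfolding exponents_def s by (intro image_mset_cong) (simp add: count_monomial_of)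
  also have "mset_set {..<length \<nu>} = mset [0..<length \<nu>]"
    by (simp add: atLeast0LessThan)
  also have "image_mset ((!) \<nu>) (mset [0..<length \<nu>]) = mset \<nu>"
    by (metis map_nth mset_map)
  finally show ?thesis .
qed

lemma obtain_monomial_of:
  fixes m :: "nat multiset"
  obtains \<nu> h where "is_partition \<nu>" "inj_on h (set_mset (monomial_of \<nu>))" "m = image_mset h (monomial_of \<nu>)"
proof -
  \<comment> \<open>The variables in order of decreasing multiplicity; position i of the partition
    is sent to \<open>xs ! i\<close>.\<close>
  define xs where "xs = rev (sort_key (count m) (sorted_list_of_set (set_mset m)))"
  define \<nu> where "\<nu> = map (count m) xs"
  have xs: "distinct xs" "set xs = set_mset m"
    by (simp_all add: xs_def)
  have "0 \<notin> set \<nu>"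
    by (auto simp: \<nu>_def xs count_eq_zero_iff)
  moreover have "sorted_wrt (\<ge>) \<nu>"
    by (simp add: \<nu>_def xs_def rev_map[symmetric] sorted_wrt_rev del: sorted_wrt_map)
  ultimately have part: "is_partition \<nu>"
    by (simp add: is_partition_def partitions_def)
  have len: "length \<nu> = length xs"
    by (simp add: \<nu>_def)
  have "inj_on ((!) xs) {..<length xs}"
    using xs(1) by (simp add: inj_on_nth)
  then have inj: "inj_on ((!) xs) (set_mset (monomial_of \<nu>))"
    by (rule inj_on_subset) (auto simp: set_monomial_of len)
  have "image_mset ((!) xs) (monomial_of \<nu>) = (\<Sum>i<length xs. replicate_mset (count m (xs ! i)) (xs ! i))"
    by (simp add: monomial_of_eq image_mset_sum len) (simp add: \<nu>_def)
  also have "\<dots> = (\<Sum>x\<in>set xs. replicate_mset (count m x) x)"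
    by (rule sum.reindex_bij_betw) (simp add: bij_betw_nth xs(1))
  also have "\<dots> = m"
    by (simp add: xs(2) sum_mset_count_nat[symmetric])
  finally show thesis
    using that[OF part inj] by simp
qed

lemma coeff_sf_monomial_of_cases:
  obtains \<nu> where "is_partition \<nu>" "exponents m = mset \<nu>" "size m = sum_list \<nu>"
    "\<And>f. coeff_sf f m = coeff_sf f (monomial_of \<nu>)"
proof -
  obtain \<nu> h where \<nu>: "is_partition \<nu>" "inj_on h (set_mset (monomial_of \<nu>))" "m = image_mset h (monomial_of \<nu>)"
    using obtain_monomial_of .
  show thesis
  proof (rule that[of \<nu>])
    show "exponents m = mset \<nu>"
      using \<nu> by (simp add: exponents_image_inj exponents_monomial_of is_partition_def partitions_def)
    show "coeff_sf f m = coeff_sf f (monomial_of \<nu>)" for f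
      using \<nu> by (simp add: coeff_sf_image_mset)
  qed (use \<nu> in simp_all)
qed

lemma symfun_eq_partitionI:
  assumes "\<And>\<nu>. is_partition \<nu> \<Longrightarrow> coeff_sf f (monomial_of \<nu>) = coeff_sf g (monomial_of \<nu>)"
  shows "f = g"
  by (rule symfun_eqI) (metis assms coeff_sf_monomial_of_cases)

lemma partition_mset_inject:
  assumes "is_partition \<mu>" "is_partition \<nu>" "mset \<mu> = mset \<nu>"
  shows "\<mu> = \<nu>"
proof -
  have "sorted (rev \<mu>)" "sorted (rev \<nu>)"
    using assms by (simp_all add: is_partition_def partitions_def sorted_wrt_rev)
  then have "rev \<mu> = rev \<nu>"
    using assms(3) by (metis mset_rev properties_for_sort)
  then show ?thesis by simp
qed

lemma coeff_sf_m:
  assumes "is_partition \<mu>" "is_partition \<nu>"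
  shows "coeff_sf (sf_m \<mu>) (monomial_of \<nu>) = (if \<mu> = \<nu> then 1 else 0)"
  using assms partition_mset_inject[OF assms]
  by (auto simp: sf_m.rep_eq exponents_monomial_of is_partition_def partitions_def)

section \<open>Adjoint operators on symmetric functions\<close>

text \<open>\<open>h_adj k f\<close> is the coefficient of \<open>y\<^sup>k\<close> in \<open>f(y, x\<^sub>0, x\<^sub>1, \<dots>)\<close>.\<close>

lift_definition h_adj :: "nat \<Rightarrow> 'a::comm_ring_1 symfun \<Rightarrow> 'a symfun" is
  "\<lambda>k f m. f (image_mset Suc m + replicate_mset k 0)"
proof safe
  fix k d :: nat and f :: "nat multiset \<Rightarrow> 'a"
  assume "\<forall>m. d < size m \<longrightarrow> f m = 0"
  then show "\<exists>d. \<forall>m. d < size m \<longrightarrow> f (image_mset Suc m + replicate_mset k 0) = 0"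
    by (intro exI[of _ d]) simp
next
  fix k :: nat and f :: "nat multiset \<Rightarrow> 'a" and \<sigma> :: "nat \<Rightarrow> nat" and m
  assume f: "\<forall>\<sigma> m. bij \<sigma> \<longrightarrow> f (image_mset \<sigma> m) = f m" and \<sigma>: "bij \<sigma>"
  define \<tau> where "\<tau> = case_nat 0 (\<lambda>i. Suc (\<sigma> i))"
  have "bij \<tau>"
    by (rule o_bij[of "case_nat 0 (\<lambda>i. Suc (inv_into UNIV \<sigma> i))"])
      (auto simp: fun_eq_iff \<tau>_def \<sigma> bij_is_inj surj_f_inv_f bij_is_surj split: nat.splits)
  moreover have "image_mset \<tau> (image_mset Suc m + replicate_mset k 0) =
      image_mset Suc (image_mset \<sigma> m) + replicate_mset k 0"
    by (simp add: multiset.map_comp comp_def \<tau>_def)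
  ultimately show "f (image_mset Suc (image_mset \<sigma> m) + replicate_mset k 0) =
      f (image_mset Suc m + replicate_mset k 0)"
    using f by metis
qed

lemma coeff_h_adj: "coeff_sf (h_adj k f) m = coeff_sf f (image_mset Suc m + replicate_mset k 0)"
  by (simp add: h_adj.rep_eq)

lemma coeff_monomial_Cons: "coeff_sf f (monomial_of (k # \<alpha>)) = coeff_sf (h_adj k f) (monomial_of \<alpha>)"
  by (simp add: coeff_h_adj)

lemma linear_h_adj: "sf_linear (h_adj k)"
  by (intro sf_linearI symfun_eqI) (simp_all add: coeff_h_adj coeff_sf_simps)

text \<open>Stated over any commutative ring, where \<open>linear_h_adj\<close> does not apply;
  \<open>h_adj_series\<close> needs this generality.\<close>

lemma h_adj_add: "h_adj k (f + g) = h_adj k f + h_adj k (g :: 'a::comm_ring_1 symfun)"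
  by (intro symfun_eqI) (simp add: coeff_h_adj coeff_sf_simps)

lemma h_adj_of_0 [simp]: "h_adj k 0 = 0"
  by (intro symfun_eqI) (simp add: coeff_h_adj coeff_sf_simps)

lemma h_adj_zero: "h_adj 0 f = f"
  by (rule symfun_eqI) (simp add: coeff_h_adj coeff_sf_image_mset)

lemma h_adj_one: "h_adj k 1 = (if k = 0 then 1 else 0)"
  by (rule symfun_eqI) (auto simp: coeff_h_adj coeff_sf_simps)

text \<open>Both sides extract a monomial in two new variables; exchanging the indices 0 and 1 swaps
  the roles of j and k.\<close>

lemma h_adj_commute: "h_adj j (h_adj k f) = h_adj k (h_adj j f)"
proof (rule symfun_eqI)
  fix m
  let ?m = "\<lambda>j k. image_mset Suc (image_mset Suc m + replicate_mset j 0) + replicate_mset k 0"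
  define \<tau> where "\<tau> = (\<lambda>i::nat. if i = 0 then 1 else if i = 1 then 0 else i)"
  have "image_mset \<tau> (?m j k) = ?m k j"
    by (simp add: multiset.map_comp comp_def \<tau>_def)
  moreover have "inj_on \<tau> (set_mset (?m j k))"
    by (auto simp: inj_on_def \<tau>_def)
  ultimately show "coeff_sf (h_adj j (h_adj k f)) m = coeff_sf (h_adj k (h_adj j f)) m"
    unfolding coeff_h_adj by (metis coeff_sf_image_mset)
qed

lemma image_Suc_decompose:
  obtains a' where "a = image_mset Suc a' + replicate_mset (count a 0) 0"
proof -
  have "image_mset Suc (image_mset (\<lambda>x. x - 1) (filter_mset (\<lambda>x. x \<noteq> 0) a)) = filter_mset (\<lambda>x. x \<noteq> 0) a"
    by (subst multiset.map_comp, subst (2) multiset.map_ident[symmetric], rule image_mset_cong) auto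
  then have "a = image_mset Suc (image_mset (\<lambda>x. x - 1) (filter_mset (\<lambda>x. x \<noteq> 0) a)) + replicate_mset (count a 0) 0"
    by (metis (mono_tags) filter_eq_replicate_mset multiset_partition union_commute)
  then show thesis
    by (rule that)
qed

lemma image_Suc_eq_iff: "image_mset Suc a = image_mset Suc b \<longleftrightarrow> a = b"
  by (metis count_image_Suc multiset_eqI old.nat.simps(5))

text \<open>Comparing coefficients of y^k in f(y, x) g(y, x): a splitting of x_0^k m is a splitting
  of m together with a distribution of the k copies of x_0.\<close>

lemma h_adj_mult: "h_adj k (f * g) = (\<Sum>i\<le>k. h_adj i f * h_adj (k - i) g)"
proof (rule symfun_eqI)
  fix m
  let ?S = "\<lambda>m k. image_mset Suc m + replicate_mset k (0::nat)"
  have "(\<Sum>i\<le>k. coeff_sf (h_adj i f * h_adj (k - i) g) m) =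
      (\<Sum>(i, (a, b))\<in>{..k} \<times> msplits m. coeff_sf f (?S a i) * coeff_sf g (?S b (k - i)))"
    by (subst sum.cartesian_product[symmetric]) (simp add: coeff_sf_times coeff_h_adj)
  also have "\<dots> = (\<Sum>(a, b)\<in>msplits (?S m k). coeff_sf f a * coeff_sf g b)"
  proof (rule sum.reindex_bij_betw[of "\<lambda>(i, (a, b)). (?S a i, ?S b (k - i))", THEN trans[rotated]])
    show "bij_betw (\<lambda>(i, (a, b)). (?S a i, ?S b (k - i))) ({..k} \<times> msplits m) (msplits (?S m k))"
    proof (rule bij_betw_imageI)
      have eq: "i = j \<and> a = b" if "?S a i = ?S b j" for i j a b
      proof -
        have "count (?S a i) 0 = count (?S b j) 0"
          using that by simp
        then have "i = j"
          by (simp add: count_image_Suc)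
        then show ?thesis
          using that by (simp add: image_Suc_eq_iff)
      qed
      show "inj_on (\<lambda>(i, (a, b)). (?S a i, ?S b (k - i))) ({..k} \<times> msplits m)"
        by (auto simp: inj_on_def dest: eq)
      show "(\<lambda>(i, (a, b)). (?S a i, ?S b (k - i))) ` ({..k} \<times> msplits m) = msplits (?S m k)"
      proof safe
        fix i a b assume "i \<le> k" "(a, b) \<in> msplits m"
        then show "(?S a i, ?S b (k - i)) \<in> msplits (?S m k)"
          by (auto simp: msplits_def multiset_eq_iff count_image_Suc split: nat.splits)
      next
        fix a b assume ab: "(a, b) \<in> msplits (?S m k)"
        obtain a' where a: "a = ?S a' (count a 0)" using image_Suc_decompose .
        obtain b' where b: "b = ?S b' (count b 0)" using image_Suc_decompose .
        have "?S (a' + b') (count a 0 + count b 0) = ?S a' (count a 0) + ?S b' (count b 0)"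
          by (auto simp: multiset_eq_iff)
        also have "\<dots> = a + b"
          by (simp only: a[symmetric] b[symmetric])
        also have "\<dots> = ?S m k"
          using ab by (simp add: msplits_def)
        finally have "a' + b' = m \<and> count a 0 + count b 0 = k"
          using eq by (metis (no_types))
        then have "a' + b' = m" "count a 0 + count b 0 = k"
          by simp_all
        then show "(a, b) \<in> (\<lambda>(i, (a, b)). (?S a i, ?S b (k - i))) ` ({..k} \<times> msplits m)"
          using a b by (intro image_eqI[of _ _ "(count a 0, (a', b'))"]) (auto simp: msplits_def)
      qed
    qed
  qed (auto intro!: sum.cong)
  finally show "coeff_sf (h_adj k (f * g)) m = coeff_sf (\<Sum>i\<le>k. h_adj i f * h_adj (k - i) g) m"
    by (simp add: coeff_h_adj coeff_sf_times coeff_sf_sum)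
qed

lemma h_adj_sf_h: "h_adj k (sf_h n) = (if k \<le> n then sf_h (n - k) else 0)"
  by (rule symfun_eqI) (auto simp: coeff_h_adj sf_h.rep_eq coeff_sf_simps)

lemma coeff_sf_p:
  assumes "n > 0"
  shows "coeff_sf (sf_p n) m = (if \<exists>i. m = replicate_mset n i then 1 else 0)"
proof -
  have "exponents m = {#n#} \<longleftrightarrow> (\<exists>i. m = replicate_mset n i)"
  proof
    assume *: "exponents m = {#n#}"
    then have "size (mset_set (set_mset m)) = 1"
      unfolding exponents_def by (metis size_image_mset size_single)
    then obtain i where i: "set_mset m = {i}"
      by (auto simp: card_1_singleton_iff)
    with * have "count m i = n"
      by (simp add: exponents_def)
    with i have "m = replicate_mset n i"
      by (metis set_mset_subset_singletonD singletonD subset_refl count_replicate_mset)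
    then show "\<exists>i. m = replicate_mset n i" ..
  next
    assume "\<exists>i. m = replicate_mset n i"
    then show "exponents m = {#n#}"
      using assms by (auto simp: exponents_def)
  qed
  then show ?thesis
    by (simp add: sf_p_def sf_m.rep_eq)
qed

lemma h_adj_sf_p:
  assumes "n > 0"
  shows "h_adj k (sf_p n) = (if k = 0 then sf_p n else if k = n then 1 else 0)"
proof (cases "k = 0")
  case False
  have "(\<exists>i. image_mset Suc m + replicate_mset k 0 = replicate_mset n i) \<longleftrightarrow> k = n \<and> m = {#}" for m
  proof
    assume "\<exists>i. image_mset Suc m + replicate_mset k 0 = replicate_mset n i"
    then obtain i where i: "image_mset Suc m + replicate_mset k 0 = replicate_mset n i" ..
    then have "0 \<in># replicate_mset n i"
      using False by (metis gr0I in_replicate_mset union_iff)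
    then have "i = 0" by (simp split: if_splits)
    moreover have "k = n"
      using arg_cong[OF i, of "\<lambda>m. count m 0"] \<open>i = 0\<close> by (simp add: count_image_Suc)
    ultimately show "k = n \<and> m = {#}"
      using i by simp
  qed auto
  then show ?thesis
    using False by (intro symfun_eqI) (simp add: coeff_h_adj coeff_sf_p[OF assms] coeff_sf_simps)
qed (simp add: h_adj_zero)

text \<open>A nonempty partition starts with a part k > 0, so its coefficient is one of
  \<open>h_adj k f\<close>; the empty one is the constant term.\<close>

lemma eq_if_h_adj_eq:
  assumes "\<And>k. k > 0 \<Longrightarrow> h_adj k f = h_adj k g" "coeff_sf f {#} = coeff_sf g {#}"
  shows "f = g"
proof (rule symfun_eq_partitionI)
  fix \<nu> assume "is_partition \<nu>"
  then show "coeff_sf f (monomial_of \<nu>) = coeff_sf g (monomial_of \<nu>)"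
    using assms by (cases \<nu>) (auto simp: is_partition_def partitions_def simp flip: coeff_h_adj)
qed

section \<open>Degree and homogeneity\<close>

definition degree_le :: "nat \<Rightarrow> 'a::comm_ring_1 symfun \<Rightarrow> bool" where
  "degree_le d f \<longleftrightarrow> (\<forall>m. size m > d \<longrightarrow> coeff_sf f m = 0)"

definition homogeneous :: "nat \<Rightarrow> 'a::comm_ring_1 symfun \<Rightarrow> bool" where
  "homogeneous n f \<longleftrightarrow> (\<forall>m. size m \<noteq> n \<longrightarrow> coeff_sf f m = 0)"

lemma degree_le_exists: "\<exists>d. degree_le d f"
  using coeff_sf[of f] by (auto simp: degree_le_def)

lemma degree_le_h_adj: "degree_le d f \<Longrightarrow> degree_le (d - k) (h_adj k f)"
  by (simp add: degree_le_def coeff_h_adj)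

lemma degree_le_h_adj_zero: "degree_le d f \<Longrightarrow> d < k \<Longrightarrow> h_adj k f = 0"
  by (intro symfun_eqI) (simp add: degree_le_def coeff_h_adj coeff_sf_simps)

lemma homogeneous_degree_le: "homogeneous n f \<Longrightarrow> degree_le n f"
  by (auto simp: homogeneous_def degree_le_def)

lemma homogeneous_h_adj: "homogeneous n f \<Longrightarrow> homogeneous (n - k) (h_adj k f)"
  by (auto simp: homogeneous_def coeff_h_adj)

lemma homogeneous_zero: "homogeneous n 0"
  by (simp add: homogeneous_def coeff_sf_simps)

lemma homogeneous_one: "homogeneous 0 1"
  by (simp add: homogeneous_def coeff_sf_simps)

lemma homogeneous_add: "homogeneous n f \<Longrightarrow> homogeneous n g \<Longrightarrow> homogeneous n (f + g)"
  by (simp add: homogeneous_def coeff_sf_simps)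

lemma homogeneous_diff: "homogeneous n f \<Longrightarrow> homogeneous n g \<Longrightarrow> homogeneous n (f - g)"
  by (simp add: homogeneous_def coeff_sf_simps)

lemma homogeneous_scale: "homogeneous n f \<Longrightarrow> homogeneous n (sf_scale c f)"
  by (auto simp: homogeneous_def coeff_sf_simps)

lemma homogeneous_sum: "(\<And>x. x \<in> S \<Longrightarrow> homogeneous n (f x)) \<Longrightarrow> homogeneous n (sum f S)"
  by (induction S rule: infinite_finite_induct) (simp_all add: homogeneous_zero homogeneous_add)

lemma homogeneous_mult:
  assumes "homogeneous n f" "homogeneous k g"
  shows "homogeneous (n + k) (f * g)"
  unfolding homogeneous_def
proof (intro allI impI)
  fix m :: "nat multiset" assume m: "size m \<noteq> n + k"
  show "coeff_sf (f * g) m = 0"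
    unfolding coeff_sf_times
  proof (rule sum.neutral, safe)
    fix a b assume "(a, b) \<in> msplits m"
    then have "size a \<noteq> n \<or> size b \<noteq> k"
      using m by (auto simp: msplits_def)
    then show "coeff_sf f a * coeff_sf g b = 0"
      using assms by (auto simp: homogeneous_def)
  qed
qed

lemma homogeneous_sf_p: "k > 0 \<Longrightarrow> homogeneous k (sf_p k)"
  by (auto simp: homogeneous_def coeff_sf_p)

text \<open>The derivation k d/dp_k, obtained from the \<open>h_adj\<close> by solving Newton's
  identity k h_k = p_1 h_{k-1} + ... + p_k for p_k. Defined this way it acts on coefficient
  functions directly, before the p_\<nu> are known to span.\<close>

fun p_adj :: "nat \<Rightarrow> 'a::field_char_0 symfun \<Rightarrow> 'a symfun" where
  "p_adj k f = of_nat k * h_adj k f - (\<Sum>j\<in>{1..<k}. p_adj j (h_adj (k - j) f))"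

declare p_adj.simps [simp del]

lemma h_adj_newton: "of_nat k * h_adj k f = (\<Sum>j=1..k. p_adj j (h_adj (k - j) f))"
proof (cases "k = 0")
  case False
  then have "{1..k} = insert k {1..<k}"
    by auto
  then show ?thesis
    by (simp add: p_adj.simps[of k f] h_adj_zero)
qed simp

lemma linear_ident: "sf_linear (\<lambda>f. f)"
  by (rule sf_linearI) simp_all

lemma linear_sum:
  assumes "\<And>x. x \<in> S \<Longrightarrow> sf_linear (T x)"
  shows "sf_linear (\<lambda>f. \<Sum>x\<in>S. T x f)"
  using assms by (intro sf_linearI) (simp_all add: sf_linearD sum.distrib sf.scale_sum_right)

lemma linear_compose: "sf_linear S \<Longrightarrow> sf_linear T \<Longrightarrow> sf_linear (\<lambda>f. S (T f))"
  by (intro sf_linearI) (simp_all add: sf_linearD)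

lemma linear_mult: "sf_linear (\<lambda>f. g * f)"
  by (intro sf_linearI) (simp_all add: distrib_left mult_sf_scale_right)

lemma linear_scale: "sf_linear (sf_scale c)"
  by (intro sf_linearI) (simp_all add: sf.scale_right_distrib mult.commute)

lemma linear_diff: "sf_linear S \<Longrightarrow> sf_linear T \<Longrightarrow> sf_linear (\<lambda>f. S f - T f)"
  by (intro sf_linearI) (simp_all add: sf_linearD sf.scale_right_diff_distrib)

lemma linear_p_adj: "sf_linear (p_adj k :: 'a::field_char_0 symfun \<Rightarrow> 'a symfun)"
proof (induction k rule: less_induct)
  case (less k)
  have "sf_linear (\<lambda>f :: 'a symfun. p_adj j (h_adj (k - j) f))" if "j \<in> {1..<k}" for j
    using that by (intro linear_compose[OF _ linear_h_adj] less) simp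
  then have "sf_linear (\<lambda>f :: 'a symfun. of_nat k * h_adj k f - (\<Sum>j\<in>{1..<k}. p_adj j (h_adj (k - j) f)))"
    by (intro linear_diff linear_sum linear_compose[OF linear_mult linear_h_adj])
  then show ?case
    by (subst p_adj.simps[abs_def])
qed

lemma p_adj_h_adj_commute: "p_adj j (h_adj k f) = h_adj k (p_adj j f)"
proof (induction j arbitrary: f rule: less_induct)
  case (less j)
  have "h_adj k (of_nat j * h_adj j f) = of_nat j * h_adj k (h_adj j f)"
    by (simp add: of_nat_sf_scale sf_linearD[OF linear_h_adj])
  moreover have "p_adj i (h_adj (j - i) (h_adj k f)) = h_adj k (p_adj i (h_adj (j - i) f))" if "i \<in> {1..<j}" for i
    using that less[of i "h_adj (j - i) f"] by (simp add: h_adj_commute[of k])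
  ultimately show ?case
    by (simp add: p_adj.simps[of j] sf_linearD[OF linear_h_adj] h_adj_commute[of k])
qed

lemma p_adj_commute: "p_adj j (p_adj k f) = p_adj k (p_adj j f)"
proof (induction j arbitrary: f rule: less_induct)
  case (less j)
  have "p_adj k (of_nat j * h_adj j f) = of_nat j * p_adj k (h_adj j f)"
    by (simp add: of_nat_sf_scale sf_linearD[OF linear_p_adj])
  then show ?case
    by (simp add: p_adj.simps[of j] sf_linearD[OF linear_p_adj] less p_adj_h_adj_commute)
qed

text \<open>Both sides sum over j >= 1, l, r with j + l + r = k. This version and the next differ in
  the factor from which Newton's recursion splits off j.\<close>

lemma sum_triangle_reindex:
  "(\<Sum>i\<le>k. \<Sum>j=1..i. F j (i - j) (k - i)) = (\<Sum>j=1..k. \<Sum>l\<le>k - j. F j l (k - j - (l::nat)))"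
  by (simp add: sum.Sigma)
    (rule sum.reindex_bij_witness[of _ "\<lambda>(j, l). (l + j, j)" "\<lambda>(i, j). (j, i - j)"]; auto)

lemma sum_triangle_reindex':
  "(\<Sum>i\<le>k. \<Sum>j=1..k - i. F j i (k - i - j)) = (\<Sum>j=1..k. \<Sum>l\<le>k - j. F j l (k - j - (l::nat)))"
  by (simp add: sum.Sigma)
    (rule sum.reindex_bij_witness[of _ "\<lambda>(j, l). (l, j)" "\<lambda>(i, j). (j, i)"]; auto simp: add.commute)

text \<open>The generating function of the \<open>h_adj k\<close> is multiplicative, so its logarithmic derivative is
  a derivation.\<close>

lemma p_adj_mult: "p_adj k (f * g) = p_adj k f * g + f * p_adj k g"
proof (induction k arbitrary: f g rule: less_induct)
  case (less k)
  show ?case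
  proof (cases "k = 0")
    case False
    let ?D = "\<lambda>j l. p_adj j (h_adj l f) * h_adj (k - j - l) g + h_adj l f * p_adj j (h_adj (k - j - l) g)"
    have "of_nat k * h_adj k (f * g) =
        (\<Sum>i\<le>k. of_nat i * h_adj i f * h_adj (k - i) g + h_adj i f * (of_nat (k - i) * h_adj (k - i) g))"
      unfolding h_adj_mult sum_distrib_left
      by (intro sum.cong refl) (simp add: of_nat_diff algebra_simps)
    also have "\<dots> = (\<Sum>i\<le>k. \<Sum>j=1..i. p_adj j (h_adj (i - j) f) * h_adj (k - i) g) +
        (\<Sum>i\<le>k. \<Sum>j=1..k - i. h_adj i f * p_adj j (h_adj (k - i - j) g))"
      by (simp add: h_adj_newton sum.distrib sum_distrib_left sum_distrib_right del: of_nat_diff)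
    also have "\<dots> = (\<Sum>j=1..k. \<Sum>l\<le>k - j. ?D j l)"
      unfolding sum_triangle_reindex[of "\<lambda>j l r. p_adj j (h_adj l f) * h_adj r g"]
        sum_triangle_reindex'[of "\<lambda>j l r. h_adj l f * p_adj j (h_adj r g)"]
      by (simp add: sum.distrib)
    also have "{1..k} = insert k {1..<k}"
      using False by auto
    also have "(\<Sum>j\<in>insert k {1..<k}. \<Sum>l\<le>k - j. ?D j l) =
        p_adj k f * g + f * p_adj k g + (\<Sum>j=1..<k. \<Sum>l\<le>k - j. ?D j l)"
      by (simp add: h_adj_zero)
    also have "(\<Sum>j=1..<k. \<Sum>l\<le>k - j. ?D j l) = (\<Sum>j=1..<k. p_adj j (h_adj (k - j) (f * g)))"
      by (intro sum.cong refl) (simp add: h_adj_mult sf_linearD[OF linear_p_adj] less)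
    finally show ?thesis
      by (simp add: p_adj.simps[of k "f * g"])
  qed (simp add: p_adj.simps[of 0])
qed

lemma p_adj_one: "p_adj k 1 = 0"
  using p_adj_mult[of k 1 1] by simp

lemma p_adj_sf_p:
  assumes "k > 0"
  shows "p_adj j (sf_p k) = (if j = k then of_nat k else 0 :: 'a::field_char_0 symfun)"
proof -
  \<comment> \<open>\<open>h_adj (j - i) (sf_p k)\<close> is a constant, and derivations kill
    constants.\<close>
  have "p_adj i (h_adj (j - i) (sf_p k)) = (0 :: 'a symfun)" if "i \<in> {1..<j}" for i
    using that assms by (simp add: h_adj_sf_p p_adj_one sf_linearD[OF linear_p_adj])
  then have "p_adj j (sf_p k) = of_nat j * h_adj j (sf_p k :: 'a symfun)"
    by (simp add: p_adj.simps[of j])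
  then show ?thesis
    using assms by (simp add: h_adj_sf_p)
qed

lemma degree_le_diff: "degree_le d f \<Longrightarrow> degree_le d g \<Longrightarrow> degree_le d (f - g)"
  by (simp add: degree_le_def coeff_sf_simps)

lemma degree_le_scale: "degree_le d f \<Longrightarrow> degree_le d (sf_scale c f)"
  by (simp add: degree_le_def coeff_sf_simps)

lemma degree_le_sum: "(\<And>x. x \<in> S \<Longrightarrow> degree_le d (f x)) \<Longrightarrow> degree_le d (sum f S)"
  by (simp add: degree_le_def coeff_sf_sum)

lemma degree_le_p_adj: "degree_le d f \<Longrightarrow> degree_le (d - k) (p_adj k f)"
proof (induction k arbitrary: d f rule: less_induct)
  case (less k)
  have "degree_le (d - k) (p_adj j (h_adj (k - j) f))" if "j \<in> {1..<k}" for j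
    using less.IH[of j "d - (k - j)" "h_adj (k - j) f"] that degree_le_h_adj[OF less.prems, of "k - j"]
    by simp
  then show ?case
    unfolding p_adj.simps[of k] of_nat_sf_scale
    by (intro degree_le_diff degree_le_scale degree_le_sum degree_le_h_adj less.prems) auto
qed

text \<open>With truncated subtraction \<open>degree_le_p_adj\<close> only bounds the degree by 0
  here and does not exclude constants.\<close>

lemma degree_le_p_adj_zero: "degree_le d f \<Longrightarrow> d < k \<Longrightarrow> p_adj k f = 0"
proof (induction k arbitrary: d f rule: less_induct)
  case (less k)
  have "p_adj j (h_adj (k - j) f) = 0" if "j \<in> {1..<k}" for j
  proof (cases "d < k - j")
    case True
    then show ?thesis
      by (simp add: degree_le_h_adj_zero[OF less.prems(1)] sf_linearD[OF linear_p_adj])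
  next
    case False
    then have "d - (k - j) < j"
      using that less.prems(2) by auto
    then show ?thesis
      using less.IH[of j "d - (k - j)" "h_adj (k - j) f"] that degree_le_h_adj[OF less.prems(1), of "k - j"]
      by simp
  qed
  then show ?case
    by (simp add: p_adj.simps[of k] degree_le_h_adj_zero[OF less.prems])
qed

lemma homogeneous_p_adj: "homogeneous n f \<Longrightarrow> homogeneous (n - k) (p_adj k f)"
proof (induction k arbitrary: n f rule: less_induct)
  case (less k)
  have "homogeneous (n - k) (p_adj j (h_adj (k - j) f))" if "j \<in> {1..<k}" for j
    using less.IH[of j "n - (k - j)" "h_adj (k - j) f"] that homogeneous_h_adj[OF less.prems, of "k - j"]
    by simp
  then show ?case
    unfolding p_adj.simps[of k] of_nat_sf_scale
    by (intro homogeneous_diff homogeneous_scale homogeneous_sum homogeneous_h_adj less.prems) auto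
qed

text \<open>Newton's identity writes k times \<open>h_adj k f\<close> through the functions
  \<open>h_adj (k - j) (p_adj j f)\<close>, so everything but the constant term vanishes.\<close>

lemma eq_zero_if_p_adj_zero:
  assumes "\<And>k. k > 0 \<Longrightarrow> p_adj k f = 0" "coeff_sf f {#} = 0"
  shows "f = 0"
proof (rule eq_if_h_adj_eq)
  fix k :: nat assume "k > 0"
  have "of_nat k * h_adj k f = of_nat k * 0"
    by (simp add: h_adj_newton p_adj_h_adj_commute assms(1) sf_linearD[OF linear_h_adj])
  then show "h_adj k f = h_adj k 0"
    using of_nat_mult_symfun_cancel[OF \<open>k > 0\<close>, of "h_adj k f" 0] by (simp add: sf_linearD[OF linear_h_adj])
qed (simp add: assms(2) coeff_sf_simps)


section \<open>Expansion in power sums\<close>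

lemma fold_p_adj_mset:
  assumes "mset \<mu> = mset \<nu>"
  shows "fold p_adj \<mu> = fold p_adj \<nu>"
  using assms by (intro fold_multiset_equiv) (auto simp: fun_eq_iff p_adj_commute)

lemma linear_fold_p_adj: "sf_linear (fold p_adj \<nu>)"
  by (induction \<nu>) (auto intro: linear_compose linear_p_adj sf_linearI simp: comp_def)

lemma sf_p_part_mset:
  assumes "mset \<mu> = mset \<nu>"
  shows "sf_p_part \<mu> = sf_p_part \<nu>"
  by (metis assms mset_map prod_mset_prod_list sf_p_part_def)

lemma sf_p_part_Cons: "sf_p_part (k # \<nu>) = sf_p k * sf_p_part \<nu>"
  by (simp add: sf_p_part_def)

lemma homogeneous_sf_p_part: "0 \<notin> set \<nu> \<Longrightarrow> homogeneous (sum_list \<nu>) (sf_p_part \<nu>)"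
  by (induction \<nu>)
    (auto simp: sf_p_part_def homogeneous_one intro!: homogeneous_mult homogeneous_sf_p)

lemma p_adj_sf_p_part:
  assumes "k > 0" "0 \<notin> set \<nu>"
  shows "p_adj k (sf_p_part \<nu>) =
    of_nat (k * count_list \<nu> k) * (sf_p_part (remove1 k \<nu>) :: 'a::field_char_0 symfun)"
  using assms(2)
proof (induction \<nu>)
  case Nil
  then show ?case
    by (simp add: sf_p_part_def p_adj_one)
next
  case (Cons a \<nu>)
  have "sf_p_part \<nu> = sf_p k * (sf_p_part (remove1 k \<nu>) :: 'a symfun)" if "k \<in> set \<nu>"
    unfolding sf_p_part_Cons[symmetric] by (rule sf_p_part_mset) (use that in simp)
  moreover have "count_list \<nu> k = 0" if "k \<notin> set \<nu>"
    using that by (simp add: count_list_0_iff)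
  ultimately show ?case
    using Cons assms(1)
    by (cases "k \<in> set \<nu>") (auto simp: sf_p_part_Cons p_adj_mult p_adj_sf_p algebra_simps)
qed

lemma zee_Cons: "zee (k # \<nu>) = k * Suc (count_list \<nu> k) * zee \<nu>"
proof -
  let ?w = "\<lambda>\<nu> i. i ^ count_list \<nu> i * fact (count_list \<nu> i)"
  have "zee (k # \<nu>) = ?w (k # \<nu>) k * (\<Prod>i\<in>set \<nu> - {k}. ?w (k # \<nu>) i)"
    unfolding zee_def by (simp add: prod.insert_remove)
  also have "(\<Prod>i\<in>set \<nu> - {k}. ?w (k # \<nu>) i) = (\<Prod>i\<in>set \<nu> - {k}. ?w \<nu> i)"
    by (intro prod.cong) auto
  also have "?w (k # \<nu>) k = k * Suc (count_list \<nu> k) * ?w \<nu> k"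
    by (simp add: algebra_simps)
  also have "k * Suc (count_list \<nu> k) * ?w \<nu> k * (\<Prod>i\<in>set \<nu> - {k}. ?w \<nu> i) =
      k * Suc (count_list \<nu> k) * zee \<nu>"
  proof (cases "k \<in> set \<nu>")
    case True
    then show ?thesis
      by (simp add: zee_def prod.remove[of _ k])
  next
    case False
    then show ?thesis
      by (simp add: zee_def count_list_0_iff)
  qed
  finally show ?thesis .
qed

lemma zee_pos: "0 \<notin> set \<nu> \<Longrightarrow> zee \<nu> > 0"
  unfolding zee_def by (intro prod_pos) (metis fact_gt_zero gr0I mult_pos_pos zero_less_power)

text \<open>The derivations remove the factors of p_\<mu> one at a time; the numbers k times
  multiplicity multiply up to z_\<nu>, and a constant remains only if nothing is left over.\<close>

lemma fold_p_adj_sf_p_part: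
  assumes "0 \<notin> set \<nu>" "0 \<notin> set \<mu>"
  shows "coeff_sf (fold p_adj \<nu> (sf_p_part \<mu>)) {#} = (if mset \<nu> = mset \<mu> then of_nat (zee \<nu>) else 0 :: 'a::field_char_0)"
  using assms
proof (induction \<nu> arbitrary: \<mu>)
  case Nil
  show ?case
  proof (cases \<mu>)
    case (Cons a \<mu>')
    then have "coeff_sf (sf_p_part \<mu> :: 'a symfun) {#} = 0"
      using homogeneous_sf_p_part[OF Nil(2), where 'a='a] Nil
      unfolding homogeneous_def by (auto dest!: spec[of _ "{#}"])
    then show ?thesis
      using Cons by simp
  qed (simp add: sf_p_part_def coeff_sf_simps zee_def)
next
  case (Cons k \<nu>)
  have "0 \<notin> set (remove1 k \<mu>)"
    using Cons.prems by (metis notin_set_remove1)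
  then have "coeff_sf (fold p_adj (k # \<nu>) (sf_p_part \<mu>)) {#} =
      of_nat (k * count_list \<mu> k) * (if mset \<nu> = mset (remove1 k \<mu>) then of_nat (zee \<nu>) else 0 :: 'a)"
    using Cons.prems Cons.IH[of "remove1 k \<mu>"]
    by (simp add: p_adj_sf_p_part of_nat_sf_scale sf_linearD[OF linear_fold_p_adj] coeff_sf_simps
        del: mset_remove1 of_nat_mult)
  also have "\<dots> = (if mset (k # \<nu>) = mset \<mu> then of_nat (zee (k # \<nu>)) else 0)"
  proof (cases "k \<in> set \<mu>")
    case True
    then have "mset (k # \<nu>) = mset \<mu> \<longleftrightarrow> mset \<nu> = mset (remove1 k \<mu>)"
      by (metis add_mset_eq_singleton_iff add_mset_remove_trivial insert_DiffM mset.simps(2) mset_remove1 set_mset_mset)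
    moreover have "count_list \<mu> k = Suc (count_list \<nu> k)" if "mset (k # \<nu>) = mset \<mu>"
      using that by (metis count_list.simps(2) count_mset Suc_eq_plus1)
    ultimately show ?thesis
      by (auto simp: zee_Cons algebra_simps)
  next
    case False
    then have "mset (k # \<nu>) \<noteq> mset \<mu>"
      by (metis list.set_intros(1) set_mset_mset)
    then show ?thesis
      using False by (simp add: count_list_0_iff)
  qed
  finally show ?case .
qed

text \<open>Induction on the degree: every \<open>p_adj k f\<close> with k > 0 inherits the property
  in smaller degree, hence is 0, and then f is constant. In dual form this says that the p_\<nu>
  span.\<close>

lemma eq_zero_if_fold_p_adj_zero:
  assumes "\<And>\<nu>. 0 \<notin> set \<nu> \<Longrightarrow> coeff_sf (fold p_adj \<nu> f) {#} = 0"
  shows "f = 0"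
proof -
  have "f = 0" if "degree_le d f" "\<And>\<nu>. 0 \<notin> set \<nu> \<Longrightarrow> coeff_sf (fold p_adj \<nu> f) {#} = 0" for d
    using that
  proof (induction d arbitrary: f rule: less_induct)
    case (less d)
    show ?case
    proof (rule eq_zero_if_p_adj_zero)
      fix k :: nat assume "k > 0"
      show "p_adj k f = 0"
      proof (cases "k \<le> d")
        case True
        then show ?thesis
          using \<open>k > 0\<close> less.prems(2)[of "k # _"] degree_le_p_adj[OF less.prems(1)]
          by (intro less.IH[of "d - k"]) auto
      qed (use degree_le_p_adj_zero[OF less.prems(1)] in simp)
    qed (use less.prems(2)[of "[]"] in simp)
  qed
  then show ?thesis
    using assms degree_le_exists by blast
qed

lemma is_partition_rev_sort: "0 \<notin> set \<nu> \<Longrightarrow> is_partition (rev (sort \<nu>))"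
  by (simp add: is_partition_def partitions_def sorted_wrt_rev)

lemma is_partitionD: "is_partition \<nu> \<Longrightarrow> 0 \<notin> set \<nu>"
  by (simp add: is_partition_def partitions_def)

lemma length_le_sum_list: "0 \<notin> set \<nu> \<Longrightarrow> length \<nu> \<le> sum_list (\<nu> :: nat list)"
  by (induction \<nu>) auto

lemma finite_partitions_le: "finite {\<nu>. is_partition \<nu> \<and> sum_list \<nu> \<le> d}"
proof (rule finite_subset)
  show "{\<nu>. is_partition \<nu> \<and> sum_list \<nu> \<le> d} \<subseteq> {\<nu>. set \<nu> \<subseteq> {..d} \<and> length \<nu> \<le> d}"
    using length_le_sum_list is_partitionD member_le_sum_list by (fastforce intro: order_trans)
qed (rule finite_lists_length_le, simp)

text \<open>Taylor's formula in the variables p_k. The value 0 off partitions follows the convention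
  of \<open>p_coeffs\<close>.\<close>

definition p_coeff :: "nat list \<Rightarrow> 'a::field_char_0 symfun \<Rightarrow> 'a" where
  "p_coeff \<nu> f = (if is_partition \<nu> then coeff_sf (fold p_adj \<nu> f) {#} / of_nat (zee \<nu>) else 0)"

lemma p_coeff_zero_if_degree:
  assumes "degree_le d f" "sum_list \<nu> > d"
  shows "p_coeff \<nu> f = 0"
proof -
  have "fold p_adj \<nu> f = 0" if "degree_le d f" "sum_list \<nu> > d" for \<nu> d and f :: "'b::field_char_0 symfun"
    using that
  proof (induction \<nu> arbitrary: d f)
    case (Cons k \<nu>)
    show ?case
    proof (cases "k \<le> d")
      case True
      then show ?thesis
        using Cons.prems degree_le_p_adj by (auto intro!: Cons.IH)
    next
      case False
      then show ?thesis
        by (simp add: degree_le_p_adj_zero[OF Cons.prems(1)] sf_linearD[OF linear_fold_p_adj])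
    qed
  qed simp
  from this[OF assms] show ?thesis
    by (simp add: p_coeff_def coeff_sf_simps)
qed

lemma p_coeff_linear:
  "p_coeff \<nu> (f + g) = p_coeff \<nu> f + p_coeff \<nu> g"
  "p_coeff \<nu> (f - g) = p_coeff \<nu> f - p_coeff \<nu> g"
  "p_coeff \<nu> (sf_scale c f) = c * p_coeff \<nu> f"
  "p_coeff \<nu> 0 = 0"
  "p_coeff \<nu> (sum h S) = (\<Sum>x\<in>S. p_coeff \<nu> (h x))"
  by (simp_all add: p_coeff_def sf_linearD[OF linear_fold_p_adj] coeff_sf_simps coeff_sf_sum
      add_divide_distrib diff_divide_distrib sum_divide_distrib)

lemma p_coeff_sf_p_part:
  assumes "is_partition \<mu>"
  shows "p_coeff \<nu> (sf_p_part \<mu>) = (if \<nu> = \<mu> then 1 else 0)"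
  using assms partition_mset_inject[of \<nu> \<mu>] zee_pos[of \<nu>]
  by (auto simp: p_coeff_def fold_p_adj_sf_p_part is_partitionD)

lemma symfun_eq_p_coeffI:
  assumes "\<And>\<nu>. is_partition \<nu> \<Longrightarrow> p_coeff \<nu> f = p_coeff \<nu> g"
  shows "f = g"
proof -
  have "coeff_sf (fold p_adj \<nu> (f - g)) {#} = 0" if "0 \<notin> set \<nu>" for \<nu>
  proof -
    have "p_coeff (rev (sort \<nu>)) (f - g) = 0" "zee (rev (sort \<nu>)) > 0"
      using assms is_partition_rev_sort[OF that] that by (simp_all add: p_coeff_linear zee_pos)
    then have "coeff_sf (fold p_adj (rev (sort \<nu>)) (f - g)) {#} = 0"
      using is_partition_rev_sort[OF that] by (simp add: p_coeff_def)
    then show ?thesis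
      using fold_p_adj_mset[of \<nu> "rev (sort \<nu>)", where 'a='a] by simp
  qed
  then have "f - g = 0"
    by (rule eq_zero_if_fold_p_adj_zero)
  then show ?thesis by simp
qed

lemma p_expansion:
  assumes "finite S" "{\<nu>. p_coeff \<nu> f \<noteq> 0} \<subseteq> S" "\<And>\<nu>. \<nu> \<in> S \<Longrightarrow> is_partition \<nu>"
  shows "f = (\<Sum>\<nu>\<in>S. sf_scale (p_coeff \<nu> f) (sf_p_part \<nu>))"
proof (rule symfun_eq_p_coeffI)
  fix \<nu>
  have "p_coeff \<nu> (\<Sum>\<nu>\<in>S. sf_scale (p_coeff \<nu> f) (sf_p_part \<nu>)) = (\<Sum>\<mu>\<in>S. if \<mu> = \<nu> then p_coeff \<mu> f else 0)"
    unfolding p_coeff_linear by (rule sum.cong) (auto simp: p_coeff_sf_p_part assms(3))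
  then show "p_coeff \<nu> f = p_coeff \<nu> (\<Sum>\<nu>\<in>S. sf_scale (p_coeff \<nu> f) (sf_p_part \<nu>))"
    using assms by auto
qed

lemma is_partition_if_p_coeff: "p_coeff \<nu> f \<noteq> 0 \<Longrightarrow> is_partition \<nu>"
  by (simp add: p_coeff_def split: if_splits)

lemma finite_p_coeff: "finite {\<nu>. p_coeff \<nu> f \<noteq> 0}"
proof -
  obtain d where "degree_le d f"
    using degree_le_exists by blast
  then have "{\<nu>. p_coeff \<nu> f \<noteq> 0} \<subseteq> {\<nu>. is_partition \<nu> \<and> sum_list \<nu> \<le> d}"
    using p_coeff_zero_if_degree[of d f] is_partition_if_p_coeff by (auto simp: not_le[symmetric])
  then show ?thesis
    using finite_partitions_le by (rule finite_subset)
qed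

lemma p_coeffs_eq: "p_coeffs f = (\<lambda>\<nu>. p_coeff \<nu> f)"
  unfolding p_coeffs_def
proof (rule the_equality)
  show "finite {\<nu>. p_coeff \<nu> f \<noteq> 0} \<and> (\<forall>\<nu>. p_coeff \<nu> f \<noteq> 0 \<longrightarrow> is_partition \<nu>) \<and>
      f = (\<Sum>\<nu> | p_coeff \<nu> f \<noteq> 0. sf_scale (p_coeff \<nu> f) (sf_p_part \<nu>))"
    using finite_p_coeff[of f] is_partition_if_p_coeff[of _ f] by (auto intro!: p_expansion)
next
  fix c
  assume c: "finite {\<nu>. c \<nu> \<noteq> 0} \<and> (\<forall>\<nu>. c \<nu> \<noteq> 0 \<longrightarrow> is_partition \<nu>) \<and>
      f = (\<Sum>\<nu> | c \<nu> \<noteq> 0. sf_scale (c \<nu>) (sf_p_part \<nu>))"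
  have "p_coeff \<nu> f = (\<Sum>\<mu> | c \<mu> \<noteq> 0. if \<mu> = \<nu> then c \<mu> else 0)" for \<nu>
    by (subst c[THEN conjunct2, THEN conjunct2], unfold p_coeff_linear, rule sum.cong)
      (auto simp: p_coeff_sf_p_part c)
  then show "c = (\<lambda>\<nu>. p_coeff \<nu> f)"
    using c by (auto simp: fun_eq_iff)
qed

lemma sf_linear_eq_if_eq_on_p:
  fixes S T :: "'a::field_char_0 symfun \<Rightarrow> 'b::ab_group_add" and sc :: "'a \<Rightarrow> 'b \<Rightarrow> 'b"
  assumes "Vector_Spaces.linear sf_scale sc S" "Vector_Spaces.linear sf_scale sc T"
    "\<And>\<nu>. is_partition \<nu> \<Longrightarrow> S (sf_p_part \<nu>) = T (sf_p_part \<nu>)"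
  shows "S f = T f"
proof -
  interpret S: Vector_Spaces.linear sf_scale sc S by fact
  interpret T: Vector_Spaces.linear sf_scale sc T by fact
  have f: "f = (\<Sum>\<nu> | p_coeff \<nu> f \<noteq> 0. sf_scale (p_coeff \<nu> f) (sf_p_part \<nu>))"
    using finite_p_coeff[of f] is_partition_if_p_coeff[of _ f] by (auto intro!: p_expansion)
  show ?thesis
    by (subst (1 2) f, unfold S.sum T.sum S.scale T.scale, rule sum.cong)
      (auto simp: assms(3) dest: is_partition_if_p_coeff)
qed

section \<open>Bilinear forms diagonal in the power sums\<close>

text \<open>\<open>qt_form\<close>, \<open>t_form\<close> and the Hall scalar product are the cases
  \<open>\<pi> k = (1 - t\<^sup>k) / (1 - q\<^sup>k)\<close>, \<open>\<pi> k = 1 - t\<^sup>k\<close> and \<open>\<pi> k = 1\<close>.\<close>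

definition weighted_form :: "(nat \<Rightarrow> qt) \<Rightarrow> qt symfun \<Rightarrow> qt symfun \<Rightarrow> qt" where
  "weighted_form \<pi> = p_form (\<lambda>\<nu>. of_nat (zee \<nu>) * prod_list (map (\<lambda>k. inverse (\<pi> k)) \<nu>))"

lemma p_form_eq_sum:
  assumes "finite S" "{\<nu>. p_coeff \<nu> f \<noteq> 0} \<subseteq> S"
  shows "p_form w f g = (\<Sum>\<nu>\<in>S. p_coeff \<nu> f * p_coeff \<nu> g * w \<nu>)"
  unfolding p_form_def p_coeffs_eq by (rule sum.mono_neutral_left) (use assms in auto)

text \<open>\<open>p_form\<close> sums over the support of its left argument only; both sides agree
  with the sum over the union of the supports.\<close>

lemma p_form_commute: "p_form w f g = p_form w g f"
proof -
  let ?S = "{\<nu>. p_coeff \<nu> f \<noteq> 0} \<union> {\<nu>. p_coeff \<nu> g \<noteq> 0}"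
  have "finite ?S"
    by (simp add: finite_p_coeff)
  then have "p_form w f g = (\<Sum>\<nu>\<in>?S. p_coeff \<nu> f * p_coeff \<nu> g * w \<nu>)"
    "p_form w g f = (\<Sum>\<nu>\<in>?S. p_coeff \<nu> g * p_coeff \<nu> f * w \<nu>)"
    by (intro p_form_eq_sum; blast)+
  then show ?thesis
    by (simp add: mult.commute)
qed

lemma p_form_linear_right:
  "p_form w f (g + h) = p_form w f g + p_form w f h"
  "p_form w f (g - h) = p_form w f g - p_form w f h"
  "p_form w f (sf_scale c g) = c * p_form w f g"
  "p_form w f 0 = 0"
  "p_form w f (sum k S) = (\<Sum>x\<in>S. p_form w f (k x))"
proof -
  show "p_form w f (sum k S) = (\<Sum>x\<in>S. p_form w f (k x))"
    unfolding p_form_def p_coeffs_eq p_coeff_linear sum_distrib_left sum_distrib_right by (rule sum.swap)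
qed (simp_all add: p_form_def p_coeffs_eq p_coeff_linear algebra_simps sum.distrib sum_subtractf
      flip: sum_distrib_left)

lemma p_form_linear_left:
  "p_form w (g + h) f = p_form w g f + p_form w h f"
  "p_form w (g - h) f = p_form w g f - p_form w h f"
  "p_form w (sf_scale c g) f = c * p_form w g f"
  "p_form w 0 f = 0"
  "p_form w (sum k S) f = (\<Sum>x\<in>S. p_form w (k x) f)"
  by (simp_all add: p_form_commute[of w _ f] p_form_linear_right)

lemmas weighted_form_commute = p_form_commute[of "\<lambda>\<nu>. of_nat (zee \<nu>) * prod_list (map (\<lambda>k. inverse (\<pi> k)) \<nu>)" for \<pi>,
    folded weighted_form_def]

lemmas weighted_form_linear =
  p_form_linear_right[of "\<lambda>\<nu>. of_nat (zee \<nu>) * prod_list (map (\<lambda>k. inverse (\<pi> k)) \<nu>)" for \<pi>, folded weighted_form_def]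
  p_form_linear_left[of "\<lambda>\<nu>. of_nat (zee \<nu>) * prod_list (map (\<lambda>k. inverse (\<pi> k)) \<nu>)" for \<pi>, folded weighted_form_def]

text \<open>The z_\<nu> of the form cancels the denominator of \<open>p_coeff\<close>. Unsorted
  lists are allowed so that a part can be added in front.\<close>

lemma weighted_form_sf_p_part:
  assumes "0 \<notin> set \<nu>"
  shows "weighted_form \<pi> (sf_p_part \<nu>) h =
    coeff_sf (fold p_adj \<nu> h) {#} * prod_list (map (\<lambda>k. inverse (\<pi> k)) \<nu>)"
proof -
  define \<mu> where "\<mu> = rev (sort \<nu>)"
  have \<mu>: "mset \<mu> = mset \<nu>" "is_partition \<mu>" "zee \<mu> > 0"
    using assms by (simp_all add: \<mu>_def is_partition_rev_sort zee_pos)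
  have "prod_list (map (\<lambda>k. inverse (\<pi> k)) \<mu>) = prod_list (map (\<lambda>k. inverse (\<pi> k)) \<nu>)"
    using \<mu>(1) by (metis mset_map prod_mset_prod_list)
  moreover have "weighted_form \<pi> (sf_p_part \<mu>) h =
      coeff_sf (fold p_adj \<mu> h) {#} * prod_list (map (\<lambda>k. inverse (\<pi> k)) \<mu>)"
    unfolding weighted_form_def using \<mu> p_form_eq_sum[of "{\<mu>}" "sf_p_part \<mu>"]
    by (simp add: p_coeff_sf_p_part) (simp add: p_coeff_def)
  ultimately show ?thesis
    using sf_p_part_mset[OF \<mu>(1), where 'a=qt] fold_p_adj_mset[OF \<mu>(1), where 'a=qt] by simp
qed

lemma weighted_form_one: "weighted_form \<pi> f 1 = coeff_sf f {#}"
  using weighted_form_sf_p_part[of "[]" \<pi> f] by (simp add: sf_p_part_def weighted_form_commute[of \<pi> f])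

text \<open>On h = p_\<nu> both sides apply the derivations for \<open>k # \<nu>\<close> to f and
  take the constant term; \<pi> k cancels the extra weight of the part k.\<close>

lemma weighted_form_p_adj:
  assumes "k > 0" "\<pi> k \<noteq> 0"
  shows "weighted_form \<pi> (p_adj k f) h = \<pi> k * weighted_form \<pi> f (sf_p k * h)"
proof -
  have "weighted_form \<pi> (p_adj k f) h = \<pi> k * weighted_form \<pi> (sf_p k * h) f"
  proof (rule sf_linear_eq_if_eq_on_p[of "(*)" "\<lambda>h. weighted_form \<pi> (p_adj k f) h"])
    show "Vector_Spaces.linear sf_scale (*) (weighted_form \<pi> (p_adj k f))"
      by unfold_locales (simp_all add: weighted_form_linear algebra_simps)
    show "Vector_Spaces.linear sf_scale (*) (\<lambda>h. \<pi> k * weighted_form \<pi> (sf_p k * h) f)"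
      by unfold_locales (simp_all add: weighted_form_linear algebra_simps mult_sf_scale_right)
    show "weighted_form \<pi> (p_adj k f) (sf_p_part \<nu>) = \<pi> k * weighted_form \<pi> (sf_p k * sf_p_part \<nu>) f"
      if "is_partition \<nu>" for \<nu>
      using that assms weighted_form_sf_p_part[of "k # \<nu>" \<pi> f]
      by (simp add: weighted_form_commute[of \<pi> "p_adj k f"] weighted_form_sf_p_part is_partitionD
          flip: sf_p_part_Cons)
  qed
  then show ?thesis
    by (simp add: weighted_form_commute[of \<pi> f])
qed

lemma weighted_form_nondegenerate:
  assumes "\<And>k. k > 0 \<Longrightarrow> \<pi> k \<noteq> 0" "\<And>h. weighted_form \<pi> f h = 0"
  shows "f = 0"
proof (rule eq_zero_if_fold_p_adj_zero)
  fix \<nu> :: "nat list" assume \<nu>: "0 \<notin> set \<nu>"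
  have "prod_list (map (\<lambda>k. inverse (\<pi> k)) \<nu>) \<noteq> 0"
    using \<nu> assms(1) by (auto simp: prod_list_zero_iff) (metis gr0I)
  then show "coeff_sf (fold p_adj \<nu> f) {#} = 0"
    using weighted_form_sf_p_part[OF \<nu>, of \<pi> f] assms(2)[of "sf_p_part \<nu>"]
    by (simp add: weighted_form_commute)
qed

lemma weighted_form_homogeneous:
  assumes "homogeneous m f" "homogeneous n g" "m \<noteq> n"
  shows "weighted_form \<pi> f g = 0"
proof -
  have *: "p_coeff \<nu> h = 0" if "homogeneous k h" "sum_list \<nu> \<noteq> k" for \<nu> k and h :: "qt symfun"
  proof (cases "sum_list \<nu> > k")
    case False
    have "homogeneous (k - sum_list \<nu>) (fold p_adj \<nu> h)"
      using that(1)
    proof (induction \<nu> arbitrary: k h)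
      case (Cons a \<nu>)
      show ?case
        using Cons.IH[OF homogeneous_p_adj[OF Cons.prems, of a]] by simp
    qed simp
    then show ?thesis
      using that False by (auto simp: p_coeff_def homogeneous_def)
  qed (use that homogeneous_degree_le p_coeff_zero_if_degree in blast)
  show ?thesis
    unfolding weighted_form_def p_form_def p_coeffs_eq
    by (rule sum.neutral) (metis * assms mult_zero_left mult_zero_right)
qed


section \<open>Plethystic exponentials\<close>

text \<open>\<open>pexp \<sigma> n\<close> is the coefficient of \<open>z\<^sup>n\<close> in \<open>exp (\<Sum>k\<ge>1. \<sigma> k p\<^sub>k z\<^sup>k / k)\<close>; \<open>pexp_coeff\<close> and
  \<open>pexp_adj\<close> are obtained by replacing \<open>p\<^sub>k\<close> with \<open>1\<close> and with its adjoint.\<close>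

fun pexp :: "(nat \<Rightarrow> qt) \<Rightarrow> nat \<Rightarrow> qt symfun" where
  "pexp \<sigma> n = (if n = 0 then 1 else
     sf_scale (inverse (of_nat n)) (\<Sum>j\<in>{1..n}. sf_scale (\<sigma> j) (sf_p j * pexp \<sigma> (n - j))))"

fun pexp_coeff :: "(nat \<Rightarrow> qt) \<Rightarrow> nat \<Rightarrow> qt" where
  "pexp_coeff \<sigma> n = (if n = 0 then 1 else
     inverse (of_nat n) * (\<Sum>j\<in>{1..n}. \<sigma> j * pexp_coeff \<sigma> (n - j)))"

fun pexp_adj :: "(nat \<Rightarrow> qt) \<Rightarrow> nat \<Rightarrow> qt symfun \<Rightarrow> qt symfun" where
  "pexp_adj \<sigma> n f = (if n = 0 then f else
     sf_scale (inverse (of_nat n)) (\<Sum>j\<in>{1..n}. sf_scale (\<sigma> j) (p_adj j (pexp_adj \<sigma> (n - j) f))))"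

declare pexp.simps [simp del] pexp_coeff.simps [simp del] pexp_adj.simps [simp del]

lemma pexp_0 [simp]: "pexp \<sigma> 0 = 1" "pexp_coeff \<sigma> 0 = 1" "pexp_adj \<sigma> 0 f = f"
  by (simp_all add: pexp.simps pexp_coeff.simps pexp_adj.simps)

lemma pexp_newton: "of_nat n * pexp \<sigma> n = (\<Sum>j=1..n. sf_scale (\<sigma> j) (sf_p j) * pexp \<sigma> (n - j))"
  by (cases "n = 0") (simp_all add: pexp.simps[of \<sigma> n] of_nat_sf_scale mult_sf_scale_left)

lemma pexp_coeff_newton: "of_nat n * pexp_coeff \<sigma> n = (\<Sum>j=1..n. \<sigma> j * pexp_coeff \<sigma> (n - j))"
  by (cases "n = 0") (simp_all add: pexp_coeff.simps[of \<sigma> n])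

lemma pexp_adj_newton:
  "of_nat n * pexp_adj \<sigma> n f = (\<Sum>j=1..n. sf_scale (\<sigma> j) (p_adj j (pexp_adj \<sigma> (n - j) f)))"
  by (cases "n = 0") (simp_all add: pexp_adj.simps[of \<sigma> n] of_nat_sf_scale)

text \<open>For generating series the hypotheses say z X' = S X and z Y' = R Y; then z (X Y)' = (S +
  R) X Y.\<close>

lemma newton_mult:
  fixes x y s r :: "nat \<Rightarrow> 'r::comm_ring_1"
  assumes "\<And>n. of_nat n * x n = (\<Sum>j=1..n. s j * x (n - j))" "\<And>n. of_nat n * y n = (\<Sum>j=1..n. r j * y (n - j))"
  shows "of_nat n * (\<Sum>i\<le>n. x i * y (n - i)) = (\<Sum>j=1..n. (s j + r j) * (\<Sum>i\<le>n - j. x i * y (n - j - i)))"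
proof -
  have "of_nat n * (\<Sum>i\<le>n. x i * y (n - i)) =
      (\<Sum>i\<le>n. of_nat i * x i * y (n - i) + x i * (of_nat (n - i) * y (n - i)))"
    unfolding sum_distrib_left by (intro sum.cong refl) (simp add: of_nat_diff algebra_simps)
  also have "\<dots> = (\<Sum>i\<le>n. \<Sum>j=1..i. s j * x (i - j) * y (n - i)) + (\<Sum>i\<le>n. \<Sum>j=1..n - i. x i * (r j * y (n - i - j)))"
    unfolding assms by (simp add: sum.distrib sum_distrib_left sum_distrib_right)
  also have "\<dots> = (\<Sum>j=1..n. (s j + r j) * (\<Sum>i\<le>n - j. x i * y (n - j - i)))"
    unfolding sum_triangle_reindex[of "\<lambda>j l k. s j * x l * y k"]
      sum_triangle_reindex'[of "\<lambda>j l k. x l * (r j * y k)"]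
    by (simp add: sum.distrib[symmetric] sum_distrib_left algebra_simps)
  finally show ?thesis .
qed

text \<open>Cancellation of n is a hypothesis because the lemma serves both \<open>qt\<close> and
  the ring of symmetric functions.\<close>

lemma newton_unique:
  fixes x y s :: "nat \<Rightarrow> 'r::comm_ring_1"
  assumes "\<And>n (a :: 'r) b. n > 0 \<Longrightarrow> of_nat n * a = of_nat n * b \<Longrightarrow> a = b"
    "x 0 = y 0" "\<And>n. of_nat n * x n = (\<Sum>j=1..n. s j * x (n - j))" "\<And>n. of_nat n * y n = (\<Sum>j=1..n. s j * y (n - j))"
  shows "x n = y n"
proof (induction n rule: less_induct)
  case (less n)
  show ?case
  proof (cases "n = 0")
    case False
    have "(\<Sum>j=1..n. s j * x (n - j)) = (\<Sum>j=1..n. s j * y (n - j))"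
      by (intro sum.cong refl) (simp add: less)
    then show ?thesis
      using assms(1)[of n "x n" "y n"] False by (simp add: assms(3,4))
  qed (simp add: assms)
qed

lemma pexp_add: "pexp (\<lambda>k. \<sigma> k + \<tau> k) n = (\<Sum>i\<le>n. pexp \<sigma> i * pexp \<tau> (n - i))"
proof (rule newton_unique[OF of_nat_mult_symfun_cancel _ pexp_newton])
  fix n
  show "of_nat n * (\<Sum>i\<le>n. pexp \<sigma> i * pexp \<tau> (n - i)) =
      (\<Sum>j=1..n. sf_scale (\<sigma> j + \<tau> j) (sf_p j) * (\<Sum>i\<le>n - j. pexp \<sigma> i * pexp \<tau> (n - j - i)))"
    unfolding sf_scale_add by (rule newton_mult[OF pexp_newton pexp_newton])
qed simp_all

lemma pexp_coeff_add: "pexp_coeff (\<lambda>k. \<sigma> k + \<tau> k) n = (\<Sum>i\<le>n. pexp_coeff \<sigma> i * pexp_coeff \<tau> (n - i))"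
  by (rule newton_unique[OF _ _ pexp_coeff_newton newton_mult[OF pexp_coeff_newton pexp_coeff_newton]]) simp_all

lemma pexp_power: "pexp (\<lambda>k. c ^ k * \<sigma> k) n = sf_scale (c ^ n) (pexp \<sigma> n)"
proof (rule newton_unique[OF of_nat_mult_symfun_cancel _ pexp_newton])
  fix n
  have "of_nat n * sf_scale (c ^ n) (pexp \<sigma> n) = sf_scale (c ^ n) (of_nat n * pexp \<sigma> n)"
    by (simp add: mult_sf_scale_right)
  also have "\<dots> = (\<Sum>j=1..n. sf_scale (c ^ j * \<sigma> j) (sf_p j) * sf_scale (c ^ (n - j)) (pexp \<sigma> (n - j)))"
    unfolding pexp_newton sf.scale_sum_right
    by (intro sum.cong refl) (simp add: mult_sf_scale_left mult_sf_scale_right mult_ac flip: power_add)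
  finally show "of_nat n * sf_scale (c ^ n) (pexp \<sigma> n) = \<dots>" .
qed simp_all

lemma pexp_coeff_power: "pexp_coeff (\<lambda>k. c ^ k * \<sigma> k) n = c ^ n * pexp_coeff \<sigma> n"
proof (rule newton_unique[OF _ _ pexp_coeff_newton])
  fix n
  have "of_nat n * (c ^ n * pexp_coeff \<sigma> n) = c ^ n * (of_nat n * pexp_coeff \<sigma> n)"
    by simp
  also have "\<dots> = (\<Sum>j=1..n. c ^ j * \<sigma> j * (c ^ (n - j) * pexp_coeff \<sigma> (n - j)))"
    unfolding pexp_coeff_newton sum_distrib_left
    by (intro sum.cong refl) (simp add: mult_ac flip: power_add)
  finally show "of_nat n * (c ^ n * pexp_coeff \<sigma> n) = \<dots>" .
qed simp_all

lemma pexp_coeff_const_one: "pexp_coeff (\<lambda>k. 1) n = 1"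
proof (induction n rule: less_induct)
  case (less n)
  then show ?case
    by (cases "n = 0") (simp_all add: pexp_coeff.simps[of _ n])
qed

lemma homogeneous_pexp: "homogeneous n (pexp \<sigma> n)"
proof (induction n rule: less_induct)
  case (less n)
  have "homogeneous n (sf_p j * pexp \<sigma> (n - j))" if "j \<in> {1..n}" for j
    using homogeneous_mult[OF homogeneous_sf_p less, of j "n - j"] that by simp
  then show ?case
    by (cases "n = 0") (auto simp: pexp.simps[of _ n] homogeneous_one intro!: homogeneous_scale homogeneous_sum)
qed

lemma h_adj_sf_p_mult:
  assumes "j > 0"
  shows "h_adj k (sf_p j * f) = sf_p j * h_adj k f + (if j \<le> k then h_adj (k - j) f else 0)"
proof -
  have "h_adj k (sf_p j * f) = (\<Sum>i\<in>insert 0 (if j \<le> k then {j} else {}). h_adj i (sf_p j) * h_adj (k - i) f)"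
    unfolding h_adj_mult by (rule sum.mono_neutral_right) (use assms in \<open>auto simp: h_adj_sf_p\<close>)
  then show ?thesis
    using assms by (auto simp: h_adj_sf_p)
qed

text \<open>Since p_j(y, x) = y^j + p_j(x), the exponential in the variables (y, x) is the product
  of the one in x and the one in y alone. In the induction these two summands contribute the factors
  n - k and k.\<close>

lemma h_adj_pexp: "h_adj k (pexp \<sigma> n) = (if k \<le> n then sf_scale (pexp_coeff \<sigma> k) (pexp \<sigma> (n - k)) else 0)"
proof (induction n arbitrary: k rule: less_induct)
  case (less n)
  show ?case
  proof (cases "n = 0")
    case False
    have IH: "h_adj i (pexp \<sigma> (n - j)) = (if i \<le> n - j then sf_scale (pexp_coeff \<sigma> i) (pexp \<sigma> (n - j - i)) else 0)"
      if "j \<in> {1..n}" for i j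
      using less[of "n - j" i] that False by simp
    have "of_nat n * h_adj k (pexp \<sigma> n) = (\<Sum>j=1..n. sf_scale (\<sigma> j) (h_adj k (sf_p j * pexp \<sigma> (n - j))))"
      using arg_cong[OF pexp_newton[of n \<sigma>], of "h_adj k"]
      by (simp add: of_nat_sf_scale sf_linearD[OF linear_h_adj] mult_sf_scale_left)
    also have "\<dots> = (\<Sum>j=1..n. sf_scale (\<sigma> j) (sf_p j) * h_adj k (pexp \<sigma> (n - j))) +
        (\<Sum>j=1..n. sf_scale (\<sigma> j) (if j \<le> k then h_adj (k - j) (pexp \<sigma> (n - j)) else 0))"
      unfolding sum.distrib[symmetric]
      by (intro sum.cong refl) (simp add: h_adj_sf_p_mult sf.scale_right_distrib mult_sf_scale_left)
    also have "\<dots> = of_nat n * (if k \<le> n then sf_scale (pexp_coeff \<sigma> k) (pexp \<sigma> (n - k)) else 0)"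
    proof (cases "k \<le> n")
      case True
      have "(\<Sum>j=1..n. sf_scale (\<sigma> j) (sf_p j) * h_adj k (pexp \<sigma> (n - j))) =
          (\<Sum>j=1..n - k. sf_scale (\<sigma> j) (sf_p j) * h_adj k (pexp \<sigma> (n - j)))"
        by (rule sum.mono_neutral_right) (auto simp: IH)
      also have "\<dots> = (\<Sum>j=1..n - k. sf_scale (\<sigma> j) (sf_p j) * sf_scale (pexp_coeff \<sigma> k) (pexp \<sigma> (n - k - j)))"
      proof (intro sum.cong refl)
        fix j assume "j \<in> {1..n - k}"
        then have "j \<in> {1..n}" "k \<le> n - j"
          using True by auto
        then show "sf_scale (\<sigma> j) (sf_p j) * h_adj k (pexp \<sigma> (n - j)) =
            sf_scale (\<sigma> j) (sf_p j) * sf_scale (pexp_coeff \<sigma> k) (pexp \<sigma> (n - k - j))"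
          by (simp only: IH if_True diff_commute[of n j k])
      qed
      also have "\<dots> = sf_scale (pexp_coeff \<sigma> k) (of_nat (n - k) * pexp \<sigma> (n - k))"
        unfolding pexp_newton by (simp add: mult_sf_scale_right mult_sf_scale_left sf.scale_sum_right mult.commute)
      finally have 1: "(\<Sum>j=1..n. sf_scale (\<sigma> j) (sf_p j) * h_adj k (pexp \<sigma> (n - j))) = \<dots>" .
      have "(\<Sum>j=1..n. sf_scale (\<sigma> j) (if j \<le> k then h_adj (k - j) (pexp \<sigma> (n - j)) else 0)) =
          (\<Sum>j=1..k. sf_scale (\<sigma> j) (h_adj (k - j) (pexp \<sigma> (n - j))))"
        using True by (intro sum.mono_neutral_cong_right) auto
      also have "\<dots> = (\<Sum>j=1..k. sf_scale (\<sigma> j * pexp_coeff \<sigma> (k - j)) (pexp \<sigma> (n - k)))"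
        by (intro sum.cong refl) (use True in \<open>auto simp: IH\<close>)
      also have "\<dots> = sf_scale (pexp_coeff \<sigma> k) (of_nat k * pexp \<sigma> (n - k))"
        unfolding sf.scale_sum_left[symmetric] pexp_coeff_newton[symmetric]
        by (simp add: of_nat_sf_scale mult.commute)
      finally have "(\<Sum>j=1..n. sf_scale (\<sigma> j) (if j \<le> k then h_adj (k - j) (pexp \<sigma> (n - j)) else 0)) = \<dots>" .
      moreover have "sf_scale c (of_nat (n - k) * f) + sf_scale c (of_nat k * f) = of_nat n * sf_scale c f" for c f
        using True by (simp only: of_nat_sf_scale sf_scale_scale sf_scale_add[symmetric]
            distrib_right[symmetric] of_nat_add[symmetric] le_add_diff_inverse2 mult.commute[of c])
      ultimately show ?thesis
        using 1 True by simp
    next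
      case False
      have "(\<Sum>j=1..n. sf_scale (\<sigma> j) (sf_p j) * h_adj k (pexp \<sigma> (n - j))) = 0"
        "(\<Sum>j=1..n. sf_scale (\<sigma> j) (if j \<le> k then h_adj (k - j) (pexp \<sigma> (n - j)) else 0)) = 0"
        by (rule sum.neutral; use False in \<open>auto simp: IH\<close>)+
      then show ?thesis
        using False by simp
    qed
    finally show ?thesis
      using False of_nat_mult_symfun_cancel by blast
  qed (simp add: h_adj_one)
qed

lemma sf_h_eq_pexp: "sf_h n = pexp (\<lambda>k. 1) n"
proof (induction n rule: less_induct)
  case (less n)
  show ?case
  proof (cases "n = 0")
    case False
    show ?thesis
    proof (rule eq_if_h_adj_eq)
      fix k :: nat assume "k > 0"
      with False show "h_adj k (sf_h n) = h_adj k (pexp (\<lambda>k. 1) n)"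
        using less[of "n - k"] by (simp add: h_adj_sf_h h_adj_pexp pexp_coeff_const_one)
    next
      show "coeff_sf (sf_h n) {#} = coeff_sf (pexp (\<lambda>k. 1) n) {#}"
        using homogeneous_pexp[of n "\<lambda>k. 1"] False by (simp add: homogeneous_def sf_h.rep_eq)
    qed
  qed (simp add: sf_h_zero)
qed

text \<open>\<open>h_adj_newton\<close> is the recursion of \<open>pexp_adj\<close> with all weights
  1.\<close>

lemma h_adj_eq_pexp_adj: "h_adj n f = pexp_adj (\<lambda>k. 1) n f"
proof (induction n rule: less_induct)
  case (less n)
  show ?case
  proof (cases "n = 0")
    case False
    have "of_nat n * h_adj n f = of_nat n * pexp_adj (\<lambda>k. 1) n f"
      unfolding h_adj_newton pexp_adj_newton by (intro sum.cong refl) (simp add: less)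
    then show ?thesis
      using False of_nat_mult_symfun_cancel by blast
  qed (simp add: h_adj_zero)
qed

lemma linear_pexp_adj: "sf_linear (pexp_adj \<sigma> n)"
proof (induction n rule: less_induct)
  case (less n)
  have "sf_linear (\<lambda>f. sf_scale (\<sigma> j) (p_adj j (pexp_adj \<sigma> (n - j) f)))" if "j \<in> {1..n}" for j
    using that by (intro linear_compose[OF linear_scale linear_compose[OF linear_p_adj]] less) simp
  then have "sf_linear (\<lambda>f. if n = 0 then f else
     sf_scale (inverse (of_nat n)) (\<Sum>j\<in>{1..n}. sf_scale (\<sigma> j) (p_adj j (pexp_adj \<sigma> (n - j) f))))"
    by (cases "n = 0") (auto intro!: linear_compose[OF linear_scale linear_sum] linear_ident)
  then show ?case
    by (subst pexp_adj.simps[abs_def])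
qed

lemma degree_le_pexp_adj_zero:
  assumes "degree_le d f"
  shows "degree_le (d - n) (pexp_adj \<sigma> n f)" "d < n \<Longrightarrow> pexp_adj \<sigma> n f = 0"
proof -
  have "degree_le (d - n) (pexp_adj \<sigma> n f) \<and> (d < n \<longrightarrow> pexp_adj \<sigma> n f = 0)"
  proof (induction n rule: less_induct)
    case (less n)
    have "degree_le (d - n) (p_adj j (pexp_adj \<sigma> (n - j) f))" if "j \<in> {1..n}" for j
      using degree_le_p_adj[of "d - (n - j)" "pexp_adj \<sigma> (n - j) f" j] less[of "n - j"] that by simp
    moreover have "p_adj j (pexp_adj \<sigma> (n - j) f) = 0" if "j \<in> {1..n}" "d < n" for j
    proof (cases "d < n - j")
      case True
      then show ?thesis
        using less[of "n - j"] that by (simp add: sf_linearD[OF linear_p_adj])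
    next
      case False
      then have "d - (n - j) < j"
        using that by auto
      then show ?thesis
        using degree_le_p_adj_zero[of "d - (n - j)" "pexp_adj \<sigma> (n - j) f" j] less[of "n - j"] that by simp
    qed
    ultimately show ?case
      using assms by (auto simp: pexp_adj.simps[of _ n] intro!: degree_le_scale degree_le_sum)
  qed
  then show "degree_le (d - n) (pexp_adj \<sigma> n f)" "d < n \<Longrightarrow> pexp_adj \<sigma> n f = 0"
    by auto
qed

text \<open>Each \<open>p_adj j\<close> crosses the form as multiplication by \<pi> j p_j, so the
  weights are multiplied by \<pi>. The operator itself does not depend on the form, which later
  allows two forms to be compared.\<close>

lemma weighted_form_pexp_adj:
  assumes \<pi>: "\<And>k. k > 0 \<Longrightarrow> \<pi> k \<noteq> 0"
  shows "weighted_form \<pi> (pexp_adj \<sigma> n f) h = weighted_form \<pi> f (pexp (\<lambda>k. \<pi> k * \<sigma> k) n * h)"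
proof (induction n arbitrary: h rule: less_induct)
  case (less n)
  show ?case
  proof (cases "n = 0")
    case False
    have "of_nat n * weighted_form \<pi> (pexp_adj \<sigma> n f) h =
        (\<Sum>j=1..n. \<sigma> j * weighted_form \<pi> (p_adj j (pexp_adj \<sigma> (n - j) f)) h)"
      using arg_cong[OF pexp_adj_newton[of n \<sigma> f], of "\<lambda>f. weighted_form \<pi> f h"]
      by (simp add: of_nat_sf_scale weighted_form_linear)
    also have "\<dots> = (\<Sum>j=1..n. weighted_form \<pi> f (sf_scale (\<pi> j * \<sigma> j) (sf_p j) * pexp (\<lambda>k. \<pi> k * \<sigma> k) (n - j) * h))"
      by (intro sum.cong refl)
        (simp add: weighted_form_p_adj \<pi> less weighted_form_linear mult_sf_scale_left mult_sf_scale_right mult_ac)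
    also have "\<dots> = weighted_form \<pi> f (of_nat n * pexp (\<lambda>k. \<pi> k * \<sigma> k) n * h)"
      unfolding pexp_newton by (simp add: weighted_form_linear sum_distrib_right)
    finally show ?thesis
      using False by (simp add: of_nat_sf_scale weighted_form_linear mult_sf_scale_left)
  qed simp
qed

lemma weighted_form_h_adj:
  assumes "\<And>k. k > 0 \<Longrightarrow> \<pi> k \<noteq> 0"
  shows "weighted_form \<pi> (h_adj n f) h = weighted_form \<pi> f (pexp \<pi> n * h)"
  using weighted_form_pexp_adj[of \<pi> "\<lambda>k. 1", OF assms] by (simp add: h_adj_eq_pexp_adj)

definition pexp_list :: "(nat \<Rightarrow> qt) \<Rightarrow> nat list \<Rightarrow> qt symfun" where
  "pexp_list \<sigma> \<alpha> = prod_list (map (pexp \<sigma>) \<alpha>)"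

lemma pexp_list_simps [simp]: "pexp_list \<sigma> [] = 1" "pexp_list \<sigma> (k # \<alpha>) = pexp \<sigma> k * pexp_list \<sigma> \<alpha>"
  by (simp_all add: pexp_list_def)

lemma weighted_form_pexp_list:
  assumes "\<And>k. k > 0 \<Longrightarrow> \<pi> k \<noteq> 0"
  shows "weighted_form \<pi> f (pexp_list \<pi> \<alpha>) = coeff_sf f (monomial_of \<alpha>)"
proof (induction \<alpha> arbitrary: f)
  case (Cons k \<alpha>)
  have "weighted_form \<pi> f (pexp_list \<pi> (k # \<alpha>)) = weighted_form \<pi> (h_adj k f) (pexp_list \<pi> \<alpha>)"
    using weighted_form_h_adj[of \<pi> k f, OF assms] by simp
  then show ?case
    by (simp add: Cons coeff_h_adj)
qed (simp add: weighted_form_one)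

section \<open>The parameters q and t\<close>

lemma Fract_power: "Fract a 1 ^ n = Fract (a ^ n) (1 :: 'a::idom)"
  by (induction n) (simp_all add: One_fract_def)

lemma t_power_eq: "t ^ n = Fract (monom 1 n) 1"
  by (simp add: t_def Fract_power monom_altdef)

lemma q_power_eq: "q ^ n = Fract [:monom 1 n:] 1"
proof -
  have "[:[:0, 1:]:] ^ n = [:[:0, 1 :: rat:] ^ n:]"
    by (induction n) (simp_all add: one_pCons mult.commute)
  then show ?thesis
    by (simp add: q_def Fract_power monom_altdef)
qed

lemma t_power_neq_one:
  assumes "k > 0"
  shows "t ^ k \<noteq> 1"
proof
  assume "t ^ k = 1"
  then have "monom (1 :: rat poly) k = 1"
    unfolding t_power_eq One_fract_def by (subst (asm) eq_fract) simp_all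
  then show False
    using assms degree_monom_eq[of "1 :: rat poly" k] by simp
qed

lemma q_power_neq_one:
  assumes "k > 0"
  shows "q ^ k \<noteq> 1"
proof
  assume "q ^ k = 1"
  then have "[:monom (1 :: rat) k:] = 1"
    unfolding q_power_eq One_fract_def by (subst (asm) eq_fract) simp_all
  then show False
    using assms degree_monom_eq[of "1 :: rat" k] by (simp add: one_pCons)
qed

lemma t_neq_zero [simp]: "t \<noteq> 0"
  by (simp add: t_def Zero_fract_def eq_fract)

lemma t_neq_one [simp]: "t \<noteq> 1"
  using t_power_neq_one[of 1] by simp

lemma t_inverse_cancel [simp]: "t * (inverse t * x) = x" "inverse t * (t * x) = x"
  by (simp_all flip: mult.assoc)

definition qt_weight :: "nat \<Rightarrow> qt" where
  "qt_weight k = (1 - t ^ k) / (1 - q ^ k)"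

lemma qt_weight_nonzero: "k > 0 \<Longrightarrow> qt_weight k \<noteq> 0"
  using t_power_neq_one q_power_neq_one by (auto simp: qt_weight_def)

lemma qt_weight_mult_q: "qt_weight k * (q ^ k - 1) = t ^ k - 1"
  using q_power_neq_one[of k] by (cases "k = 0") (simp_all add: qt_weight_def field_simps)

lemma qt_form_eq: "qt_form = weighted_form qt_weight"
  by (simp add: qt_form_def weighted_form_def qt_weight_def)

text \<open>The eigenvalue of the self-adjoint operator below on the Macdonald function \<open>P\<^sub>\<alpha>\<close>:
  \<open>1 + (1 - t\<^sup>-\<^sup>1) \<Sum>\<^sub>i t\<^bsup>-i\<^esup> (q\<^bsup>\<alpha>\<^sub>i\<^esup> - 1)\<close>.\<close>

fun eigenvalue :: "nat list \<Rightarrow> qt" where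
  "eigenvalue [] = 1"
| "eigenvalue (k # \<alpha>) = inverse t * eigenvalue \<alpha> + (1 - inverse t) * q ^ k"

text \<open>What remains of t^l times the eigenvalue, l the length, after removing 1 and the factor
  t - 1. In it the power of t marks the position of a part and the power of q its size.\<close>

fun eigenvalue_poly :: "nat list \<Rightarrow> rat poly poly" where
  "eigenvalue_poly [] = 0"
| "eigenvalue_poly (k # \<alpha>) = eigenvalue_poly \<alpha> + monom (monom 1 k) (length \<alpha>)"

lemma eigenvalue_eq_poly:
  "t ^ length \<alpha> * eigenvalue \<alpha> = 1 + (t - 1) * Fract (eigenvalue_poly \<alpha>) 1"
proof (induction \<alpha>)
  case (Cons k \<alpha>)
  have "t ^ length (k # \<alpha>) * eigenvalue (k # \<alpha>) =
      t ^ length \<alpha> * eigenvalue \<alpha> + (t - 1) * (q ^ k * t ^ length \<alpha>)"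
    by (simp add: algebra_simps)
  moreover have "q ^ k * t ^ length \<alpha> = Fract (monom (monom 1 k) (length \<alpha>)) 1"
    by (simp add: t_power_eq q_power_eq smult_monom)
  moreover have "Fract (eigenvalue_poly (k # \<alpha>)) 1 =
      Fract (eigenvalue_poly \<alpha>) 1 + Fract (monom (monom 1 k) (length \<alpha>)) 1"
    by simp
  ultimately show ?case
    unfolding Cons by (simp only: algebra_simps)
qed (simp add: Zero_fract_def[symmetric])

lemma coeff_eigenvalue_poly: "n \<ge> length \<alpha> \<Longrightarrow> coeff (eigenvalue_poly \<alpha>) n = 0"
  by (induction \<alpha>) simp_all

lemma eigenvalue_poly_inject:
  "length \<alpha> = length \<beta> \<Longrightarrow> eigenvalue_poly \<alpha> = eigenvalue_poly \<beta> \<Longrightarrow> \<alpha> = \<beta>"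
proof (induction \<alpha> \<beta> rule: list_induct2)
  case (Cons k \<alpha> l \<beta>)
  have "coeff (eigenvalue_poly (k # \<alpha>)) (length \<alpha>) = monom 1 k"
    "coeff (eigenvalue_poly (l # \<beta>)) (length \<alpha>) = monom 1 l"
    using Cons.hyps by (simp_all add: coeff_eigenvalue_poly)
  then have "k = l"
    using Cons.prems by (metis degree_monom_eq zero_neq_one)
  then show ?case
    using Cons by simp
qed simp

text \<open>A part 0 turns the initial value 1 into inverse t + (1 - inverse t) = 1, so partitions
  can be padded to a common length.\<close>

lemma eigenvalue_append_zeros: "eigenvalue (\<alpha> @ replicate m 0) = eigenvalue \<alpha>"
proof (induction \<alpha>)
  case Nil
  show ?case
    by (induction m) simp_all
qed simp

lemma eigenvalue_inject:
  assumes "is_partition \<mu>" "is_partition \<nu>" "eigenvalue \<mu> = eigenvalue \<nu>"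
  shows "\<mu> = \<nu>"
proof -
  define \<alpha> where "\<alpha> = \<mu> @ replicate (length \<nu> - length \<mu>) 0"
  define \<beta> where "\<beta> = \<nu> @ replicate (length \<mu> - length \<nu>) 0"
  have len: "length \<alpha> = length \<beta>"
    by (simp add: \<alpha>_def \<beta>_def)
  have "(t - 1) * Fract (eigenvalue_poly \<alpha>) 1 = (t - 1) * Fract (eigenvalue_poly \<beta>) 1"
    using eigenvalue_eq_poly[of \<alpha>] eigenvalue_eq_poly[of \<beta>] assms(3) len
    by (simp add: \<alpha>_def \<beta>_def eigenvalue_append_zeros)
  then have "eigenvalue_poly \<alpha> = eigenvalue_poly \<beta>"
    by (simp add: eq_fract)
  then have "\<alpha> = \<beta>"
    using len by (rule eigenvalue_poly_inject[rotated])
  then have "filter (\<lambda>x. x \<noteq> 0) \<alpha> = filter (\<lambda>x. x \<noteq> 0) \<beta>"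
    by simp
  moreover have "filter (\<lambda>x. x \<noteq> 0) \<mu> = \<mu>" "filter (\<lambda>x. x \<noteq> 0) \<nu> = \<nu>"
    using assms(1,2)[THEN is_partitionD] by (auto intro!: filter_True) (metis gr0I)+
  ultimately show ?thesis
    by (simp add: \<alpha>_def \<beta>_def)
qed


section \<open>A self-adjoint operator triangular on the dual basis of the monomials\<close>

abbreviation "qt_g \<equiv> pexp qt_weight"
abbreviation "qt_G \<equiv> pexp_list qt_weight"
abbreviation "qt_H \<equiv> pexp (\<lambda>k. t ^ k - 1)"
abbreviation "qt_T \<equiv> pexp_adj (\<lambda>k. q ^ k - 1)"
abbreviation "qt_eta \<equiv> pexp_coeff (\<lambda>k. t ^ k - 1)"

lemma qt_form_adjoint:
  "weighted_form qt_weight (qt_T n f) h = weighted_form qt_weight f (qt_H n * h)"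
  "weighted_form qt_weight (h_adj n f) h = weighted_form qt_weight f (qt_g n * h)"
  using weighted_form_pexp_adj[of qt_weight "\<lambda>k. q ^ k - 1", OF qt_weight_nonzero]
    weighted_form_h_adj[of qt_weight, OF qt_weight_nonzero]
  by (simp_all add: qt_weight_mult_q)

text \<open>The generating series is (1 - y)/(1 - t y), whose partial sums are the coefficients of
  1/(1 - t y). The exceptional term at k = 0 is split off so that the rest is geometric.\<close>

lemma qt_eta_eq: "qt_eta k = (1 - inverse t) * t ^ k + (if k = 0 then inverse t else 0)"
proof -
  have sum: "(\<Sum>i\<le>n. qt_eta i) = t ^ n" for n
    using pexp_coeff_add[of "\<lambda>k. t ^ k - 1" "\<lambda>k. 1" n] pexp_coeff_power[of t "\<lambda>k. 1" n]
      pexp_coeff_const_one by simp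
  show ?thesis
  proof (cases k)
    case (Suc n)
    then show ?thesis
      using sum[of "Suc n"] sum[of n] by (simp add: algebra_simps)
  qed simp
qed

text \<open>As series, H(z) G(z) = G(q z).\<close>

lemma qt_g_mult_qt_H: "(\<Sum>b\<le>n. qt_g (n - b) * qt_H b) = sf_scale (q ^ n) (qt_g n)"
proof -
  have "(\<lambda>k. (t ^ k - 1) + qt_weight k) = (\<lambda>k. q ^ k * qt_weight k)"
    by (simp add: fun_eq_iff algebra_simps flip: qt_weight_mult_q)
  then show ?thesis
    using pexp_add[of "\<lambda>k. t ^ k - 1" qt_weight n] pexp_power[of q qt_weight n]
    by (simp add: mult.commute)
qed

text \<open>The transpose of a known relation: T_n is adjoint to H_n and g_k to
  \<open>h_adj k\<close>, and \<open>h_adj k (qt_H n * h)\<close> is computed by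
  \<open>h_adj_mult\<close> and \<open>h_adj_pexp\<close>. Nondegeneracy of the form transfers
  it.\<close>

lemma qt_T_g_mult:
  "qt_T n (qt_g k * f) = (\<Sum>i | i \<le> k \<and> i \<le> n. sf_scale (qt_eta i) (qt_g (k - i) * qt_T (n - i) f))"
  (is "?l = ?r")
proof -
  let ?F = "weighted_form qt_weight"
  have "?F ?l h = ?F ?r h" for h
  proof -
    have "?F ?l h = ?F (h_adj k (qt_H n * h)) f"
      unfolding qt_form_adjoint by (rule weighted_form_commute)
    also have "h_adj k (qt_H n * h) =
        (\<Sum>i\<le>k. if i \<le> n then sf_scale (qt_eta i) (qt_H (n - i) * h_adj (k - i) h) else 0)"
      unfolding h_adj_mult by (intro sum.cong refl) (simp add: h_adj_pexp mult_sf_scale_left)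
    also have "\<dots> = (\<Sum>i | i \<le> k \<and> i \<le> n. sf_scale (qt_eta i) (qt_H (n - i) * h_adj (k - i) h))"
      by (simp add: sum.If_cases Int_def)
    also have "?F \<dots> f = ?F ?r h"
      unfolding weighted_form_linear
    proof (intro sum.cong refl)
      fix i
      have "?F (qt_H (n - i) * h_adj (k - i) h) f = ?F (qt_T (n - i) f) (h_adj (k - i) h)"
        by (metis qt_form_adjoint(1) weighted_form_commute)
      also have "\<dots> = ?F (qt_g (k - i) * qt_T (n - i) f) h"
        by (metis qt_form_adjoint(2) weighted_form_commute)
      finally show "qt_eta i * ?F (qt_H (n - i) * h_adj (k - i) h) f =
          qt_eta i * ?F (qt_g (k - i) * qt_T (n - i) f) h"
        by simp
    qed
    finally show ?thesis .
  qed
  then have "?l - ?r = 0"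
    by (intro weighted_form_nondegenerate[of qt_weight, OF qt_weight_nonzero])
      (simp_all only: weighted_form_linear diff_self)
  then show ?thesis by simp
qed

text \<open>For \<open>D\<close> at least the degree of \<open>f\<close>, \<open>qt_op D m f\<close> is the coefficient of \<open>z\<^bsup>-m\<^esup>\<close> in the vertex
  operator \<open>(\<Sum>b. qt_H b (z/t)\<^sup>b) (\<Sum>n. qt_T n z\<^bsup>-n\<^esup>)\<close> applied to \<open>f\<close>; its case \<open>m = 0\<close> is Macdonald's operator.\<close>

definition qt_op :: "nat \<Rightarrow> nat \<Rightarrow> qt symfun \<Rightarrow> qt symfun" where
  "qt_op D m f = (\<Sum>b\<le>D. sf_scale (inverse t ^ b) (qt_H b * qt_T (b + m) f))"

lemma linear_qt_op: "sf_linear (qt_op D m)"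
  unfolding qt_op_def[abs_def]
  by (intro linear_sum linear_compose[OF linear_scale linear_compose[OF linear_mult linear_pexp_adj]])

lemma qt_op_self_adjoint:
  "weighted_form qt_weight (qt_op D 0 f) g = weighted_form qt_weight f (qt_op D 0 g)"
proof -
  have "weighted_form qt_weight (qt_H b * qt_T b f) g = weighted_form qt_weight f (qt_H b * qt_T b g)" for b
    by (metis qt_form_adjoint(1) weighted_form_commute)
  then show ?thesis
    by (simp add: qt_op_def weighted_form_linear)
qed

text \<open>With the weights split as in \<open>qt_eta_eq\<close>, the exceptional term i = 0 gives
  the first summand. The geometric part has a total weight independent of i, so its sum is a tail of
  the convolution in \<open>qt_g_mult_qt_H\<close>: the full value minus the terms b < j -
  m.\<close>

lemma qt_op_g_mult_coefficient:
  "(\<Sum>i | i \<le> k \<and> m \<le> i + j. sf_scale (qt_eta i * inverse t ^ (i + j - m)) (qt_g (k - i) * qt_H (i + j - m))) =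
    (if m \<le> j then sf_scale (inverse t * inverse t ^ (j - m)) (qt_g k * qt_H (j - m)) else 0) +
    (if m \<le> k + j then sf_scale ((1 - inverse t) * t ^ m * inverse t ^ j)
      (sf_scale (q ^ (k + j - m)) (qt_g (k + j - m)) - (\<Sum>b<j - m. qt_g (k + j - m - b) * qt_H b)) else 0)"
proof -
  let ?I = "{i. i \<le> k \<and> m \<le> i + j}"
  let ?f = "\<lambda>i. qt_g (k - i) * qt_H (i + j - m)"
  let ?c = "(1 - inverse t) * t ^ m * inverse t ^ j"
  have c: "(1 - inverse t) * t ^ i * inverse t ^ (i + j - m) = ?c" if "m \<le> i + j" for i
  proof -
    have "t ^ m * t ^ (i + j - m) = t ^ i * t ^ j"
      using that by (simp flip: power_add)
    then show ?thesis
      by (simp add: field_simps)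
  qed
  have "(\<Sum>i\<in>?I. sf_scale (qt_eta i * inverse t ^ (i + j - m)) (?f i)) =
      (\<Sum>i\<in>?I. if i = 0 then sf_scale (inverse t * inverse t ^ (j - m)) (qt_g k * qt_H (j - m)) else 0) +
      (\<Sum>i\<in>?I. sf_scale ?c (?f i))"
    unfolding sum.distrib[symmetric]
  proof (intro sum.cong refl)
    fix i assume "i \<in> ?I"
    then show "sf_scale (qt_eta i * inverse t ^ (i + j - m)) (?f i) =
      (if i = 0 then sf_scale (inverse t * inverse t ^ (j - m)) (qt_g k * qt_H (j - m)) else 0) +
      sf_scale ?c (?f i)"
      using c[of i] by (auto simp: qt_eta_eq distrib_right sf.scale_left_distrib add.commute)
  qed
  also have "(\<Sum>i\<in>?I. if i = 0 then sf_scale (inverse t * inverse t ^ (j - m)) (qt_g k * qt_H (j - m)) else 0) =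
      (if m \<le> j then sf_scale (inverse t * inverse t ^ (j - m)) (qt_g k * qt_H (j - m)) else 0)"
    by (subst sum.delta) auto
  also have "(\<Sum>i\<in>?I. sf_scale ?c (?f i)) = (if m \<le> k + j then sf_scale ?c
      (sf_scale (q ^ (k + j - m)) (qt_g (k + j - m)) - (\<Sum>b<j - m. qt_g (k + j - m - b) * qt_H b)) else 0)"
  proof (cases "m \<le> k + j")
    case True
    have "(\<Sum>i\<in>?I. ?f i) = (\<Sum>b\<in>{..k + j - m} - {..<j - m}. qt_g (k + j - m - b) * qt_H b)"
      by (rule sum.reindex_bij_witness[of _ "\<lambda>b. b + m - j" "\<lambda>i. i + j - m"]) (use True in auto)
    also have "\<dots> = (\<Sum>b\<le>k + j - m. qt_g (k + j - m - b) * qt_H b) - (\<Sum>b<j - m. qt_g (k + j - m - b) * qt_H b)"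
      by (rule sum_diff) auto
    finally show ?thesis
      unfolding qt_g_mult_qt_H sf.scale_sum_right[symmetric] using True by simp
  next
    case False
    then have I: "?I = {}" by auto
    show ?thesis
      unfolding I using False by simp
  qed
  finally show ?thesis .
qed

text \<open>After \<open>qt_T_g_mult\<close> the terms are collected by the index j = b + m - i of
  T; those with j > d vanish.\<close>

lemma qt_op_g_mult_aux:
  assumes f: "degree_le d f" and D: "k + d \<le> D"
  shows "qt_op D m (qt_g k * f) = (\<Sum>j\<le>d. (\<Sum>i | i \<le> k \<and> m \<le> i + j.
    sf_scale (qt_eta i * inverse t ^ (i + j - m)) (qt_g (k - i) * qt_H (i + j - m))) * qt_T j f)"
proof -
  have T: "qt_T n f = 0" if "n > d" for n
    using degree_le_pexp_adj_zero(2)[OF f that] .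
  let ?F = "\<lambda>i b n. sf_scale (qt_eta i * inverse t ^ b) (qt_g (k - i) * qt_H b * qt_T n f)"
  have "qt_op D m (qt_g k * f) = (\<Sum>b\<le>D. \<Sum>i | i \<le> k \<and> i \<le> b + m. ?F i b (b + m - i))"
    unfolding qt_op_def qt_T_g_mult
    by (simp add: sum_distrib_left sf.scale_sum_right mult_sf_scale_right mult_ac)
  also have "\<dots> = (\<Sum>(b, i)\<in>(SIGMA b:{..D}. {i. i \<le> k \<and> i \<le> b + m}). ?F i b (b + m - i))"
    by (rule sum.Sigma) auto
  also have "\<dots> = (\<Sum>(b, i)\<in>{(b, i)\<in>(SIGMA b:{..D}. {i. i \<le> k \<and> i \<le> b + m}). b + m - i \<le> d}. ?F i b (b + m - i))"
    by (rule sum.mono_neutral_right) (auto, (rule ccontr, simp add: T)+)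
  also have "\<dots> = (\<Sum>(j, i)\<in>(SIGMA j:{..d}. {i. i \<le> k \<and> m \<le> i + j}). ?F i (i + j - m) j)"
    by (rule sum.reindex_bij_witness[of _ "\<lambda>(j, i). (i + j - m, i)" "\<lambda>(b, i). (b + m - i, i)"])
      (use D in auto)
  also have "\<dots> = (\<Sum>j\<le>d. \<Sum>i | i \<le> k \<and> m \<le> i + j. ?F i (i + j - m) j)"
    by (rule sum.Sigma[symmetric]) auto
  finally show ?thesis
    by (simp add: sum_distrib_right mult_sf_scale_left)
qed

text \<open>The subtracted low terms of \<open>qt_op_g_mult_coefficient\<close> reassemble to
  \<open>qt_op D (m + i) f\<close>. This forces an induction over all shifts m, although Macdonald's
  operator is the case m = 0.\<close>

lemma qt_op_g_mult:
  assumes f: "degree_le d f" and D: "k + d \<le> D"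
  shows "qt_op D m (qt_g k * f) = sf_scale (inverse t) (qt_g k * qt_op D m f) +
    (\<Sum>j | j \<le> d \<and> m \<le> k + j. sf_scale ((1 - inverse t) * t ^ m * inverse t ^ j * q ^ (k + j - m)) (qt_g (k + j - m) * qt_T j f)) -
    sf_scale (1 - inverse t) (\<Sum>i=1..D. sf_scale (inverse t ^ i) (qt_g (k + i) * qt_op D (m + i) f))"
proof -
  have T: "qt_T n f = 0" if "n > d" for n
    using degree_le_pexp_adj_zero(2)[OF f that] .
  let ?c = "\<lambda>j. (1 - inverse t) * t ^ m * inverse t ^ j"
  let ?A = "\<lambda>j. sf_scale (inverse t * inverse t ^ (j - m)) (qt_g k * qt_H (j - m)) * qt_T j f"
  let ?B = "\<lambda>j. sf_scale (?c j * q ^ (k + j - m)) (qt_g (k + j - m) * qt_T j f)"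
  let ?C = "\<lambda>j. sf_scale (?c j) ((\<Sum>b<j - m. qt_g (k + j - m - b) * qt_H b) * qt_T j f)"
  have "qt_op D m (qt_g k * f) = (\<Sum>j\<le>d. (if m \<le> j then ?A j else 0) + ((if m \<le> k + j then ?B j else 0) -
      (if m \<le> k + j then ?C j else 0)))"
    unfolding qt_op_g_mult_aux[OF f D] qt_op_g_mult_coefficient
    by (intro sum.cong refl)
      (simp add: distrib_right left_diff_distrib mult_sf_scale_left sf.scale_right_diff_distrib)
  also have "\<dots> = (\<Sum>j\<le>d. if m \<le> j then ?A j else 0) + (\<Sum>j\<le>d. if m \<le> k + j then ?B j else 0) -
      (\<Sum>j\<le>d. if m \<le> k + j then ?C j else 0)"
    by (simp add: sum.distrib sum_subtractf)
  also have "(\<Sum>j\<le>d. if m \<le> j then ?A j else 0) = sf_scale (inverse t) (qt_g k * qt_op D m f)"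
  proof -
    have "(\<Sum>j\<le>d. if m \<le> j then ?A j else 0) = (\<Sum>j\<in>{j. j \<le> d \<and> m \<le> j}. ?A j)"
      by (simp add: sum.If_cases Int_def)
    also have "\<dots> = (\<Sum>b\<in>{b. b \<le> D \<and> b + m \<le> d}. sf_scale (inverse t) (qt_g k * sf_scale (inverse t ^ b) (qt_H b * qt_T (b + m) f)))"
      by (rule sum.reindex_bij_witness[of _ "\<lambda>b. b + m" "\<lambda>j. j - m"])
        (use D in \<open>auto simp: mult_sf_scale_left mult_sf_scale_right mult.assoc\<close>)
    also have "\<dots> = (\<Sum>b\<le>D. sf_scale (inverse t) (qt_g k * sf_scale (inverse t ^ b) (qt_H b * qt_T (b + m) f)))"
      by (rule sum.mono_neutral_left) (auto, (rule ccontr, simp add: T)+)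
    finally show ?thesis
      by (simp add: qt_op_def sf.scale_sum_right sum_distrib_left)
  qed
  also have "(\<Sum>j\<le>d. if m \<le> k + j then ?B j else 0) = (\<Sum>j | j \<le> d \<and> m \<le> k + j. ?B j)"
    by (simp add: sum.If_cases Int_def)
  also have "(\<Sum>j\<le>d. if m \<le> k + j then ?C j else 0) =
      sf_scale (1 - inverse t) (\<Sum>i=1..D. sf_scale (inverse t ^ i) (qt_g (k + i) * qt_op D (m + i) f))"
  proof -
    let ?F = "\<lambda>i b. sf_scale ((1 - inverse t) * inverse t ^ (i + b)) (qt_g (k + i) * qt_H b * qt_T (b + (m + i)) f)"
    have c: "?c (m + n) = (1 - inverse t) * inverse t ^ n" for n
      by (simp add: power_add field_simps)
    have "(\<Sum>j\<le>d. if m \<le> k + j then ?C j else 0) =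
        (\<Sum>j\<le>d. \<Sum>b<j - m. sf_scale (?c j) (qt_g (k + j - m - b) * qt_H b * qt_T j f))"
      by (intro sum.cong refl) (auto simp: sum_distrib_right sf.scale_sum_right)
    also have "\<dots> = (\<Sum>(j, b)\<in>(SIGMA j:{..d}. {..<j - m}). sf_scale (?c j) (qt_g (k + j - m - b) * qt_H b * qt_T j f))"
      by (rule sum.Sigma) auto
    also have "\<dots> = (\<Sum>(i, b)\<in>{(i, b)\<in>{1..D} \<times> {..D}. b + (m + i) \<le> d}. ?F i b)"
    proof (rule sum.reindex_bij_witness[of _ "\<lambda>(i, b). (b + (m + i), b)" "\<lambda>(j, b). (j - m - b, b)"], safe)
      fix j b assume "j \<le> d" "b < j - m"
      then obtain i where j: "j = m + (i + b)"
        by (metis add.commute le_add_diff_inverse less_imp_le_nat less_numeral_extra(3) zero_less_diff nat_le_linear diff_is_0_eq not_less_zero)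
      have 1: "j - m - b = i" "k + j - m - b = k + i" "b + (m + i) = j"
        by (simp_all add: j)
      show "?F (j - m - b) b = sf_scale (?c j) (qt_g (k + j - m - b) * qt_H b * qt_T j f)"
        unfolding 1 using c[of "i + b"] by (simp add: j)
    qed (use D in auto)
    also have "\<dots> = (\<Sum>(i, b)\<in>{1..D} \<times> {..D}. ?F i b)"
      by (rule sum.mono_neutral_left) (auto, (rule ccontr, simp add: T)+)
    also have "\<dots> = (\<Sum>i=1..D. \<Sum>b\<le>D. ?F i b)"
      by (rule sum.cartesian_product[symmetric])
    finally show ?thesis
      by (simp add: qt_op_def sf.scale_sum_right sum_distrib_left mult_sf_scale_right power_add mult_ac)
  qed
  finally show ?thesis .
qed

text \<open>Dominance over \<alpha> up to a loss m, the amount by which \<open>qt_op D m\<close>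
  lowers the degree. The lists may be unsorted and contain 0, since the recursion along \<alpha>
  produces such lists.\<close>

definition dominating :: "nat \<Rightarrow> nat list \<Rightarrow> nat list set" where
  "dominating m \<alpha> = {\<beta>. length \<beta> = length \<alpha> \<and> sum_list \<beta> + m = sum_list \<alpha> \<and>
     (\<forall>j. sum_list (take j \<alpha>) \<le> sum_list (take j \<beta>) + m)}"

definition lowerings :: "nat \<Rightarrow> nat list \<Rightarrow> nat list set" where
  "lowerings j \<alpha> = {\<beta>. list_all2 (\<le>) \<beta> \<alpha> \<and> sum_list \<beta> + j = sum_list \<alpha>}"

lemma sum_list_all2_mono: "list_all2 (\<le>) xs ys \<Longrightarrow> sum_list xs \<le> sum_list (ys :: nat list)"
  by (induction rule: list_all2_induct) auto

lemma lowerings_0: "lowerings 0 \<alpha> = {\<alpha>}"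
proof -
  have "\<beta> = \<alpha>" if "list_all2 (\<le>) \<beta> \<alpha>" "sum_list \<beta> = sum_list \<alpha>" for \<beta>
    using that
  proof (induction rule: list_all2_induct)
    case (Cons x xs y ys)
    then show ?case
      using sum_list_all2_mono[of xs ys] by simp
  qed simp
  then show ?thesis
    by (auto simp: lowerings_def list_all2_refl)
qed

lemma lowerings_take:
  assumes "\<beta> \<in> lowerings j \<alpha>"
  shows "sum_list (take l \<alpha>) \<le> j + sum_list (take l \<beta>)"
proof -
  have "sum_list (drop l \<beta>) \<le> sum_list (drop l \<alpha>)"
    using assms by (intro sum_list_all2_mono) (auto simp: lowerings_def)
  moreover have "sum_list (take l \<alpha>) + sum_list (drop l \<alpha>) = sum_list \<alpha>"
    "sum_list (take l \<beta>) + sum_list (drop l \<beta>) = sum_list \<beta>"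
    by (metis append_take_drop_id sum_list_append)+
  ultimately show ?thesis
    using assms by (auto simp: lowerings_def)
qed

lemma span_g_mult:
  assumes "f \<in> sf.span (qt_G ` A)" "\<And>\<beta>. \<beta> \<in> A \<Longrightarrow> k # \<beta> \<in> B"
  shows "qt_g k * f \<in> sf.span (qt_G ` B)"
  using assms(1)
proof (induction rule: sf.span_induct_alt)
  case (step c x y)
  then obtain \<beta> where "\<beta> \<in> A" "x = qt_G \<beta>" by auto
  then have "qt_g k * x \<in> sf.span (qt_G ` B)"
    using assms(2) by (intro sf.span_base) (auto intro!: image_eqI[of _ _ "k # \<beta>"])
  then show ?case
    using step by (simp add: distrib_left mult_sf_scale_right sf.span_add sf.span_scale)
qed (simp add: sf.span_zero)

lemma homogeneous_pexp_list: "homogeneous (sum_list \<alpha>) (pexp_list \<sigma> \<alpha>)"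
  by (induction \<alpha>) (auto simp: homogeneous_one intro!: homogeneous_mult homogeneous_pexp)

lemma degree_le_pexp_list: "degree_le (sum_list \<alpha>) (pexp_list \<sigma> \<alpha>)"
  by (rule homogeneous_degree_le[OF homogeneous_pexp_list])

lemma qt_T_one: "qt_T n 1 = (if n = 0 then 1 else 0)"
  using degree_le_pexp_adj_zero(2)[OF homogeneous_degree_le[OF homogeneous_one]] by auto

lemma qt_T_G_in_span: "qt_T j (qt_G \<alpha>) \<in> sf.span (qt_G ` lowerings j \<alpha>)"
proof (induction \<alpha> arbitrary: j)
  case Nil
  show ?case
    by (auto simp: qt_T_one sf.span_zero lowerings_0 intro: sf.span_base)
next
  case (Cons k \<alpha>)
  have "qt_g (k - i) * qt_T (j - i) (qt_G \<alpha>) \<in> sf.span (qt_G ` lowerings j (k # \<alpha>))" if "i \<le> k" "i \<le> j" for i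
    by (rule span_g_mult[OF Cons[of "j - i"]]) (use that in \<open>auto simp: lowerings_def\<close>)
  then show ?case
    by (auto simp: qt_T_g_mult intro!: sf.span_sum sf.span_scale)
qed

lemma qt_op_Nil: "qt_op D m 1 = (if m = 0 then 1 else 0)"
proof -
  have "qt_op D m 1 = (\<Sum>b\<le>D. if b = 0 then (if m = 0 then 1 else 0) else 0)"
    unfolding qt_op_def by (rule sum.cong) (auto simp: qt_T_one)
  then show ?thesis
    by simp
qed

lemma Cons_in_dominating:
  assumes "length \<beta> = length \<alpha>" "l + sum_list \<beta> + m = k + sum_list \<alpha>"
    "\<And>j. k + sum_list (take j \<alpha>) \<le> l + sum_list (take j \<beta>) + m"
  shows "l # \<beta> \<in> dominating m (k # \<alpha>)"
  using assms by (auto simp: dominating_def take_Cons split: nat.splits)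

text \<open>In the three kinds of terms of \<open>qt_op_g_mult\<close> the first part is k, k + j -
  m, k + i while the rest loses m, j, m + i: the first part gains exactly what the rest loses beyond
  m.\<close>

lemma qt_op_G_in_span:
  assumes "sum_list \<alpha> \<le> D"
  shows "qt_op D m (qt_G \<alpha>) \<in> sf.span (qt_G ` dominating m \<alpha>)"
  using assms
proof (induction \<alpha> arbitrary: m)
  case Nil
  show ?case
    by (auto simp: qt_op_Nil sf.span_zero dominating_def intro!: sf.span_base)
next
  case (Cons k \<alpha>)
  let ?S = "sf.span (qt_G ` dominating m (k # \<alpha>))"
  have IH: "qt_op D m (qt_G \<alpha>) \<in> sf.span (qt_G ` dominating m \<alpha>)" for m
    using Cons by simp
  have 1: "qt_g k * qt_op D m (qt_G \<alpha>) \<in> ?S"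
    by (rule span_g_mult[OF IH]) (intro Cons_in_dominating, auto simp: dominating_def)
  have 2: "qt_g (k + j - m) * qt_T j (qt_G \<alpha>) \<in> ?S" if "m \<le> k + j" for j
  proof (rule span_g_mult[OF qt_T_G_in_span])
    fix \<beta> assume "\<beta> \<in> lowerings j \<alpha>"
    then show "(k + j - m) # \<beta> \<in> dominating m (k # \<alpha>)"
      using lowerings_take[of \<beta> j \<alpha>] that
      by (intro Cons_in_dominating) (auto simp: lowerings_def list_all2_lengthD)
  qed
  have 3: "qt_g (k + i) * qt_op D (m + i) (qt_G \<alpha>) \<in> ?S" for i
    by (rule span_g_mult[OF IH]) (intro Cons_in_dominating, auto simp: dominating_def add_ac)
  show ?case
    unfolding pexp_list_simps qt_op_g_mult[OF degree_le_pexp_list Cons.prems[unfolded sum_list.Cons]]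
    using 1 2 3 by (intro sf.span_diff sf.span_add sf.span_scale sf.span_sum) auto
qed

text \<open>Terms with j > 0 or i > 0 enlarge the first part and are off the diagonal. The diagonal
  receives inverse t times the eigenvalue of the tail, and (1 - inverse t) q^k from j = 0; this is
  the recursion of \<open>eigenvalue\<close>.\<close>

lemma qt_op_G_triangular:
  assumes "sum_list \<alpha> \<le> D"
  shows "qt_op D 0 (qt_G \<alpha>) - sf_scale (eigenvalue \<alpha>) (qt_G \<alpha>) \<in> sf.span (qt_G ` (dominating 0 \<alpha> - {\<alpha>}))"
  using assms
proof (induction \<alpha>)
  case Nil
  show ?case
    by (simp add: qt_op_Nil sf.span_zero)
next
  case (Cons k \<alpha>)
  let ?S = "sf.span (qt_G ` (dominating 0 (k # \<alpha>) - {k # \<alpha>}))"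
  let ?B = "\<lambda>j. sf_scale ((1 - inverse t) * t ^ 0 * inverse t ^ j * q ^ (k + j - 0)) (qt_g (k + j - 0) * qt_T j (qt_G \<alpha>))"
  have D: "k + sum_list \<alpha> \<le> D"
    using Cons.prems by simp
  have 1: "qt_g k * (qt_op D 0 (qt_G \<alpha>) - sf_scale (eigenvalue \<alpha>) (qt_G \<alpha>)) \<in> ?S"
  proof (rule span_g_mult[OF Cons.IH])
    fix \<beta> assume "\<beta> \<in> dominating 0 \<alpha> - {\<alpha>}"
    then show "k # \<beta> \<in> dominating 0 (k # \<alpha>) - {k # \<alpha>}"
      using Cons_in_dominating[of \<beta> \<alpha> k 0 k] by (auto simp: dominating_def)
  qed (use D in simp)
  have 2: "qt_g (k + j - 0) * qt_T j (qt_G \<alpha>) \<in> ?S" if "j > 0" for j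
  proof (rule span_g_mult[OF qt_T_G_in_span])
    fix \<beta> assume "\<beta> \<in> lowerings j \<alpha>"
    then show "(k + j - 0) # \<beta> \<in> dominating 0 (k # \<alpha>) - {k # \<alpha>}"
      using lowerings_take[of \<beta> j \<alpha>] that Cons_in_dominating[of \<beta> \<alpha> "k + j" 0 k]
      by (auto simp: lowerings_def list_all2_lengthD)
  qed
  have 3: "qt_g (k + i) * qt_op D i (qt_G \<alpha>) \<in> ?S" if "i > 0" for i
  proof (rule span_g_mult[OF qt_op_G_in_span])
    fix \<beta> assume "\<beta> \<in> dominating i \<alpha>"
    then show "(k + i) # \<beta> \<in> dominating 0 (k # \<alpha>) - {k # \<alpha>}"
      using that Cons_in_dominating[of \<beta> \<alpha> "k + i" 0 k] by (auto simp: dominating_def add_ac)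
  qed (use D in simp)
  have "{j. j \<le> sum_list \<alpha> \<and> 0 \<le> k + j} = insert 0 {1..sum_list \<alpha>}"
    by auto
  then have B: "(\<Sum>j | j \<le> sum_list \<alpha> \<and> 0 \<le> k + j. ?B j) =
      sf_scale ((1 - inverse t) * q ^ k) (qt_G (k # \<alpha>)) + (\<Sum>j=1..sum_list \<alpha>. ?B j)"
    by simp
  have "qt_op D 0 (qt_G (k # \<alpha>)) - sf_scale (eigenvalue (k # \<alpha>)) (qt_G (k # \<alpha>)) =
      sf_scale (inverse t) (qt_g k * (qt_op D 0 (qt_G \<alpha>) - sf_scale (eigenvalue \<alpha>) (qt_G \<alpha>))) +
      (\<Sum>j=1..sum_list \<alpha>. ?B j) -
      sf_scale (1 - inverse t) (\<Sum>i=1..D. sf_scale (inverse t ^ i) (qt_g (k + i) * qt_op D (0 + i) (qt_G \<alpha>)))"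
    unfolding pexp_list_simps qt_op_g_mult[OF degree_le_pexp_list D] B
    by (simp add: right_diff_distrib mult_sf_scale_right sf.scale_right_diff_distrib sf.scale_left_distrib)
  also have "\<dots> \<in> ?S"
    using 1 2 3 by (intro sf.span_diff sf.span_add sf.span_scale sf.span_sum) auto
  finally show ?case .
qed

section \<open>Dominance order\<close>

lemma dominated_refl: "dominated \<nu> \<nu>"
  by (simp add: dominated_def)

lemma dominated_trans: "dominated \<mu> \<nu> \<Longrightarrow> dominated \<nu> \<kappa> \<Longrightarrow> dominated \<mu> \<kappa>"
  by (auto simp: dominated_def intro: order_trans)

lemma list_eq_if_take_sums_eq:
  fixes xs ys :: "nat list"
  assumes "0 \<notin> set xs" "0 \<notin> set ys" "\<And>k. sum_list (take k xs) = sum_list (take k ys)"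
  shows "xs = ys"
  using assms
proof (induction xs arbitrary: ys)
  case Nil
  then show ?case
    using Nil(3)[of 1] by (cases ys) auto
next
  case (Cons x xs)
  obtain y ys' where ys: "ys = y # ys'"
    using Cons.prems(1) Cons.prems(3)[of 1] by (cases ys) auto
  then have "x = y"
    using Cons.prems(3)[of 1] by simp
  moreover have "sum_list (take k xs) = sum_list (take k ys')" for k
    using Cons.prems(3)[of "Suc k"] \<open>x = y\<close> ys by simp
  ultimately show ?case
    using Cons ys by simp
qed

lemma dominated_antisym:
  "is_partition \<mu> \<Longrightarrow> is_partition \<nu> \<Longrightarrow> dominated \<mu> \<nu> \<Longrightarrow> dominated \<nu> \<mu> \<Longrightarrow> \<mu> = \<nu>"
  by (rule list_eq_if_take_sums_eq) (auto simp: is_partitionD dominated_def intro: antisym)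

lemma sum_submset_le_take:
  assumes "sorted_wrt (\<ge>) ys" "A \<subseteq># mset ys" "size A \<le> k"
  shows "sum_mset A \<le> sum_list (take k (ys :: nat list))"
  using assms
proof (induction ys arbitrary: A k)
  case (Cons y ys)
  show ?case
  proof (cases "A = {#}")
    case False
    \<comment> \<open>Remove y itself if it occurs in A, and any element otherwise; either way the
      rest fits into \<open>ys\<close>.\<close>
    obtain x where x: "x \<in># A" "y \<in># A \<longrightarrow> x = y"
      using False by (metis multiset_nonemptyE)
    then have "x \<in># mset (y # ys)"
      using Cons.prems(2) by (meson mset_subset_eqD)
    then have "x \<le> y"
      using Cons.prems(1) by auto
    obtain k' where k: "k = Suc k'"
      using Cons.prems(3) False by (cases k) auto
    have "A - {#x#} \<subseteq># mset ys"
    proof (cases "y \<in># A")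
      case True
      then show ?thesis
        using Cons.prems(2) x(2) by (simp add: subset_eq_diff_conv)
    next
      case False
      then have "A \<subseteq># mset ys"
        using Cons.prems(2) by (metis inter_add_right1 mset.simps(2) subset_mset.inf.absorb_iff1)
      then show ?thesis
        by (meson diff_subset_eq_self subset_mset.order_trans)
    qed
    moreover have "size (A - {#x#}) \<le> k'"
      using x(1) Cons.prems(3) k by (simp add: size_Diff_singleton)
    ultimately have "sum_mset (A - {#x#}) \<le> sum_list (take k' ys)"
      using Cons by simp
    moreover have "sum_mset A = x + sum_mset (A - {#x#})"
      using arg_cong[OF insert_DiffM[OF x(1)], of sum_mset] by simp
    ultimately show ?thesis
      using \<open>x \<le> y\<close> k by simp
  qed simp
qed simp

definition partition_of :: "nat list \<Rightarrow> nat list" where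
  "partition_of \<beta> = rev (sort (filter (\<lambda>x. x \<noteq> 0) \<beta>))"

lemma is_partition_partition_of: "is_partition (partition_of \<beta>)"
  unfolding partition_of_def by (rule is_partition_rev_sort) simp

text \<open>Since \<open>pexp \<sigma> 0 = 1\<close> and the factors commute, zeros and order do not
  matter. This brings the lists of \<open>dominating\<close> back to partitions.\<close>

lemma pexp_list_partition_of: "pexp_list \<sigma> (partition_of \<beta>) = pexp_list \<sigma> \<beta>"
proof -
  have "pexp_list \<sigma> (partition_of \<beta>) = prod_mset (image_mset (pexp \<sigma>) (filter_mset (\<lambda>x. x \<noteq> 0) (mset \<beta>)))"
    by (simp add: pexp_list_def partition_of_def flip: prod_mset_prod_list)
  also have "\<dots> = pexp_list \<sigma> \<beta>"
    by (induction \<beta>) auto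
  finally show ?thesis .
qed

lemma sum_list_take_le_partition_of: "sum_list (take k \<beta>) \<le> sum_list (take k (partition_of \<beta>))"
proof -
  let ?A = "filter_mset (\<lambda>x. x \<noteq> 0) (mset (take k \<beta>))"
  have "?A \<subseteq># mset (partition_of \<beta>)"
    by (simp add: partition_of_def) (metis append_take_drop_id mset_append mset_subset_eq_add_left multiset_filter_mono)
  moreover have "size ?A \<le> k"
    by (rule order_trans[OF size_filter_mset_lesseq]) simp
  ultimately have "sum_mset ?A \<le> sum_list (take k (partition_of \<beta>))"
    using is_partition_partition_of[of \<beta>]
    by (intro sum_submset_le_take) (auto simp: is_partition_def partitions_def)
  moreover have "sum_mset (filter_mset (\<lambda>x. x \<noteq> 0) M) = sum_mset M" for M :: "nat multiset"
    by (induction M) auto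
  ultimately show ?thesis
    by (simp add: sum_mset_sum_list)
qed

lemma sum_list_partition_of: "sum_list (partition_of \<beta>) = sum_list \<beta>"
  by (induction \<beta>) (auto simp: partition_of_def simp flip: sum_mset_sum_list)

lemma dominated_partition_of:
  assumes "\<beta> \<in> dominating 0 \<alpha>"
  shows "dominated \<alpha> (partition_of \<beta>)"
  using assms sum_list_take_le_partition_of order_trans
  unfolding dominated_def dominating_def sum_list_partition_of by fastforce

text \<open>The partial sums of \<beta> lie between those of \<alpha> and those of the sorted list,
  which coincide. So off-diagonal lists stay strictly above after sorting.\<close>

lemma partition_of_eqD:
  assumes "is_partition \<alpha>" "\<beta> \<in> dominating 0 \<alpha>" "partition_of \<beta> = \<alpha>"
  shows "\<beta> = \<alpha>"
proof -
  have take: "sum_list (take k \<beta>) = sum_list (take k \<alpha>)" for k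
    using assms sum_list_take_le_partition_of[of k \<beta>] by (auto simp: dominating_def intro: antisym)
  have len: "length \<beta> = length \<alpha>"
    using assms by (simp add: dominating_def)
  have "\<beta> ! i = \<alpha> ! i" if "i < length \<alpha>" for i
    using take[of "Suc i"] take[of i] that len by (simp add: take_Suc_conv_app_nth)
  then show ?thesis
    using len by (simp add: list_eq_iff_nth_eq)
qed

section \<open>Strict up-sets and down-sets of the dominance order, and induction along them\<close>

definition above :: "nat list \<Rightarrow> nat list set" where
  "above \<nu> = {\<kappa>. is_partition \<kappa> \<and> dominated \<nu> \<kappa> \<and> \<kappa> \<noteq> \<nu>}"

definition below :: "nat list \<Rightarrow> nat list set" where
  "below \<nu> = {\<kappa>. is_partition \<kappa> \<and> dominated \<kappa> \<nu> \<and> \<kappa> \<noteq> \<nu>}"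

lemma is_partition_above: "\<kappa> \<in> above \<nu> \<Longrightarrow> is_partition \<kappa>"
  by (simp add: above_def)

lemma finite_above: "finite (above \<nu>)"
  by (rule finite_subset[OF _ finite_partitions_le[of "sum_list \<nu>"]]) (auto simp: above_def dominated_def)

lemma is_partition_below: "\<kappa> \<in> below \<nu> \<Longrightarrow> is_partition \<kappa>"
  by (simp add: below_def)

lemma finite_below: "finite (below \<nu>)"
  by (rule finite_subset[OF _ finite_partitions_le[of "sum_list \<nu>"]]) (auto simp: below_def dominated_def)

lemma above_trans: "is_partition \<nu> \<Longrightarrow> \<kappa> \<in> above \<nu> \<Longrightarrow> insert \<kappa> (above \<kappa>) \<subseteq> above \<nu>"
  by (auto simp: above_def intro: dominated_trans dominated_antisym)

lemma below_trans: "is_partition \<nu> \<Longrightarrow> \<kappa> \<in> below \<nu> \<Longrightarrow> insert \<kappa> (below \<kappa>) \<subseteq> below \<nu>"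
  by (auto simp: below_def intro: dominated_trans dominated_antisym)

lemma card_above_less:
  assumes "is_partition \<nu>" "\<kappa> \<in> above \<nu>"
  shows "card (above \<kappa>) < card (above \<nu>)"
  using above_trans[OF assms] assms by (intro psubset_card_mono finite_above) (auto simp: above_def)

lemma card_below_less:
  assumes "is_partition \<nu>" "\<kappa> \<in> below \<nu>"
  shows "card (below \<kappa>) < card (below \<nu>)"
  using below_trans[OF assms] assms by (intro psubset_card_mono finite_below) (auto simp: below_def)

lemma above_induct [consumes 1, case_names above]:
  assumes "is_partition \<nu>"
    "\<And>\<nu>. is_partition \<nu> \<Longrightarrow> (\<And>\<kappa>. \<kappa> \<in> above \<nu> \<Longrightarrow> P \<kappa>) \<Longrightarrow> P \<nu>"
  shows "P \<nu>"
  using assms(1)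
proof (induction "card (above \<nu>)" arbitrary: \<nu> rule: less_induct)
  case less
  then show ?case
    using card_above_less is_partition_above assms(2) by blast
qed

lemma below_induct [consumes 1, case_names below]:
  assumes "is_partition \<nu>"
    "\<And>\<nu>. is_partition \<nu> \<Longrightarrow> (\<And>\<kappa>. \<kappa> \<in> below \<nu> \<Longrightarrow> P \<kappa>) \<Longrightarrow> P \<nu>"
  shows "P \<nu>"
  using assms(1)
proof (induction "card (below \<nu>)" arbitrary: \<nu> rule: less_induct)
  case less
  then show ?case
    using card_below_less is_partition_below assms(2) by blast
qed


section \<open>Existence and uniqueness of the Macdonald functions\<close>

abbreviation "qt_E \<nu> \<equiv> qt_op (sum_list \<nu>) 0"

lemma qt_E_triangular:
  assumes "is_partition \<nu>"
  shows "qt_E \<nu> (qt_G \<nu>) - sf_scale (eigenvalue \<nu>) (qt_G \<nu>) \<in> sf.span (qt_G ` above \<nu>)"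
proof -
  have "qt_G ` (dominating 0 \<nu> - {\<nu>}) \<subseteq> qt_G ` above \<nu>"
  proof (rule image_subsetI)
    fix \<beta> assume "\<beta> \<in> dominating 0 \<nu> - {\<nu>}"
    then have "partition_of \<beta> \<in> above \<nu>"
      using partition_of_eqD[OF assms] is_partition_partition_of dominated_partition_of
      by (auto simp: above_def)
    then show "qt_G \<beta> \<in> qt_G ` above \<nu>"
      by (rule image_eqI[rotated]) (simp add: pexp_list_partition_of)
  qed
  then show ?thesis
    using qt_op_G_triangular[of \<nu> "sum_list \<nu>"] sf.span_mono by blast
qed

lemma span_G_above_mono:
  assumes "is_partition \<nu>" "\<kappa> \<in> above \<nu>"
  shows "sf.span (H ` insert \<kappa> (above \<kappa>)) \<subseteq> sf.span (H ` above \<nu>)"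
  using above_trans[OF assms] by (intro sf.span_mono image_mono)

lemma resolvent_on_span:
  assumes "f \<in> sf.span (qt_G ` S)" "sf_linear E"
    "\<And>\<kappa>. \<kappa> \<in> S \<Longrightarrow> \<exists>s\<in>sf.span (qt_G ` S). sf_scale e s - E s = qt_G \<kappa>"
  shows "\<exists>s\<in>sf.span (qt_G ` S). sf_scale e s - E s = f"
  using assms(1)
proof (induction rule: sf.span_induct_alt)
  case base
  show ?case
    by (rule bexI[of _ 0]) (simp_all add: sf_linearD[OF assms(2)] sf.span_zero)
next
  case (step c x y)
  then obtain s \<kappa> r where "s \<in> sf.span (qt_G ` S)" "sf_scale e s - E s = y"
    "r \<in> sf.span (qt_G ` S)" "sf_scale e r - E r = x"
    using assms(3) by blast
  moreover have "sf_scale e (sf_scale c r + s) - E (sf_scale c r + s) =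
      sf_scale c (sf_scale e r - E r) + (sf_scale e s - E s)"
    by (simp add: sf_linearD[OF assms(2)] sf.scale_right_distrib sf.scale_right_diff_distrib mult.commute)
  ultimately show ?case
    by (intro bexI[of _ "sf_scale c r + s"]) (simp_all add: sf.span_add sf.span_scale)
qed

text \<open>Back substitution: modulo the span above \<kappa> the operator acts on
  \<open>qt_G \<kappa>\<close> as the scalar \<open>eigenvalue \<kappa>\<close>, and the remainder
  is handled by induction.\<close>

lemma resolvent:
  assumes "is_partition \<kappa>" "sum_list \<kappa> = n" "\<And>\<mu>. \<mu> \<in> insert \<kappa> (above \<kappa>) \<Longrightarrow> e \<noteq> eigenvalue \<mu>"
  shows "\<exists>s\<in>sf.span (qt_G ` insert \<kappa> (above \<kappa>)). sf_scale e s - qt_op n 0 s = qt_G \<kappa>"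
  using assms
proof (induction rule: above_induct)
  case (above \<kappa>)
  let ?E = "qt_op n 0"
  have "\<exists>s\<in>sf.span (qt_G ` above \<kappa>). sf_scale e s - ?E s = qt_G \<mu>" if \<mu>: "\<mu> \<in> above \<kappa>" for \<mu>
  proof -
    have "sum_list \<mu> = n" "\<And>\<mu>'. \<mu>' \<in> insert \<mu> (above \<mu>) \<Longrightarrow> e \<noteq> eigenvalue \<mu>'"
      using \<mu> above.prems above_trans[OF above.hyps(1) \<mu>] by (auto simp: above_def dominated_def)
    then show ?thesis
      using above.IH[OF \<mu>] span_G_above_mono[OF above.hyps(1) \<mu>] by blast
  qed
  then obtain s where s: "s \<in> sf.span (qt_G ` above \<kappa>)"
    "sf_scale e s - ?E s = ?E (qt_G \<kappa>) - sf_scale (eigenvalue \<kappa>) (qt_G \<kappa>)"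
    using resolvent_on_span[OF qt_E_triangular[OF above.hyps(1)] linear_qt_op[of n 0]] above.prems(1)
    by blast
  \<comment> \<open>With u the part of E G above \<kappa>, (e - E) G = (e -
    \<open>eigenvalue \<kappa>\<close>) G - u, and s solves (e - E) s = u.\<close>
  let ?r = "sf_scale (inverse (e - eigenvalue \<kappa>)) (qt_G \<kappa> + s)"
  have "sf_scale e (qt_G \<kappa> + s) - ?E (qt_G \<kappa> + s) = sf_scale (e - eigenvalue \<kappa>) (qt_G \<kappa>)"
    using s(2) by (simp add: sf_linearD[OF linear_qt_op] sf.scale_right_distrib sf.scale_left_diff_distrib algebra_simps)
  moreover have "sf_scale e ?r - ?E ?r = sf_scale (inverse (e - eigenvalue \<kappa>)) (sf_scale e (qt_G \<kappa> + s) - ?E (qt_G \<kappa> + s))"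
    by (simp add: sf_linearD(5)[OF linear_qt_op] sf.scale_right_diff_distrib mult.commute)
  ultimately have "sf_scale e ?r - ?E ?r = qt_G \<kappa>"
    using above.prems(2)[of \<kappa>] by simp
  moreover have "s \<in> sf.span (qt_G ` insert \<kappa> (above \<kappa>))"
    using s(1) sf.span_mono[of "qt_G ` above \<kappa>" "qt_G ` insert \<kappa> (above \<kappa>)"] by auto
  then have "?r \<in> sf.span (qt_G ` insert \<kappa> (above \<kappa>))"
    by (intro sf.span_scale sf.span_add) (auto intro: sf.span_base)
  ultimately show ?case by blast
qed

text \<open>Macdonald's Q, dual to P: triangular upwards in the g_\<mu>, as P is triangular
  downwards in the monomials.\<close>

definition qt_Q :: "nat list \<Rightarrow> qt symfun" where
  "qt_Q \<nu> = (SOME f. f - qt_G \<nu> \<in> sf.span (qt_G ` above \<nu>) \<and> qt_E \<nu> f = sf_scale (eigenvalue \<nu>) f)"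

lemma qt_Q:
  assumes "is_partition \<nu>"
  shows "qt_Q \<nu> - qt_G \<nu> \<in> sf.span (qt_G ` above \<nu>)" "qt_E \<nu> (qt_Q \<nu>) = sf_scale (eigenvalue \<nu>) (qt_Q \<nu>)"
proof -
  have "\<exists>s\<in>sf.span (qt_G ` above \<nu>). sf_scale (eigenvalue \<nu>) s - qt_E \<nu> s = qt_G \<kappa>" if \<kappa>: "\<kappa> \<in> above \<nu>" for \<kappa>
  proof -
    have "is_partition \<kappa>" "sum_list \<kappa> = sum_list \<nu>"
      using \<kappa> by (auto simp: above_def dominated_def)
    moreover have "eigenvalue \<nu> \<noteq> eigenvalue \<mu>" if "\<mu> \<in> insert \<kappa> (above \<kappa>)" for \<mu>
      using above_trans[OF assms \<kappa>] that eigenvalue_inject[OF assms, of \<mu>] by (auto simp: above_def)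
    ultimately show ?thesis
      using resolvent[of \<kappa> "sum_list \<nu>" "eigenvalue \<nu>"] span_G_above_mono[OF assms \<kappa>] by blast
  qed
  \<comment> \<open>The eigenvector will be \<open>qt_G \<nu> + s\<close>; the equation is solvable
    above \<nu> because no index there has the eigenvalue of \<nu>.\<close>
  then obtain s where "s \<in> sf.span (qt_G ` above \<nu>)"
    "sf_scale (eigenvalue \<nu>) s - qt_E \<nu> s = qt_E \<nu> (qt_G \<nu>) - sf_scale (eigenvalue \<nu>) (qt_G \<nu>)"
    using resolvent_on_span[OF qt_E_triangular[OF assms] linear_qt_op] by blast
  then have "(qt_G \<nu> + s) - qt_G \<nu> \<in> sf.span (qt_G ` above \<nu>) \<and>
      qt_E \<nu> (qt_G \<nu> + s) = sf_scale (eigenvalue \<nu>) (qt_G \<nu> + s)"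
    by (simp add: sf_linearD[OF linear_qt_op] sf.scale_right_distrib algebra_simps)
  then show "qt_Q \<nu> - qt_G \<nu> \<in> sf.span (qt_G ` above \<nu>)"
    "qt_E \<nu> (qt_Q \<nu>) = sf_scale (eigenvalue \<nu>) (qt_Q \<nu>)"
    unfolding qt_Q_def by (rule someI[THEN conjunct1], rule someI[THEN conjunct2])
qed

lemma homogeneous_span: "f \<in> sf.span S \<Longrightarrow> (\<And>g. g \<in> S \<Longrightarrow> homogeneous n g) \<Longrightarrow> homogeneous n f"
  by (induction rule: sf.span_induct_alt) (auto simp: homogeneous_zero homogeneous_add homogeneous_scale)

lemma homogeneous_qt_Q:
  assumes "is_partition \<nu>"
  shows "homogeneous (sum_list \<nu>) (qt_Q \<nu>)"
proof -
  have "homogeneous (sum_list \<nu>) (qt_G \<kappa>)" if "\<kappa> \<in> above \<nu>" for \<kappa>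
    using that homogeneous_pexp_list[of \<kappa>] by (simp add: above_def dominated_def)
  then have "homogeneous (sum_list \<nu>) (qt_Q \<nu> - qt_G \<nu>)"
    by (intro homogeneous_span[OF qt_Q(1)[OF assms]]) auto
  from homogeneous_add[OF this homogeneous_pexp_list[of \<nu> qt_weight]] show ?thesis
    by simp
qed

lemma qt_Q_orthogonal:
  assumes "is_partition \<mu>" "is_partition \<nu>" "\<mu> \<noteq> \<nu>"
  shows "weighted_form qt_weight (qt_Q \<mu>) (qt_Q \<nu>) = 0"
proof (cases "sum_list \<mu> = sum_list \<nu>")
  case True
  have "eigenvalue \<mu> * weighted_form qt_weight (qt_Q \<mu>) (qt_Q \<nu>) =
      eigenvalue \<nu> * weighted_form qt_weight (qt_Q \<mu>) (qt_Q \<nu>)"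
    using qt_op_self_adjoint[of "sum_list \<nu>" "qt_Q \<mu>" "qt_Q \<nu>"] qt_Q(2)[OF assms(1)] qt_Q(2)[OF assms(2)] True
    by (simp add: weighted_form_linear)
  then show ?thesis
    using eigenvalue_inject assms by auto
next
  case False
  then show ?thesis
    using weighted_form_homogeneous homogeneous_qt_Q assms by blast
qed

lemma weighted_form_span_zero:
  assumes "g \<in> sf.span S" "\<And>h. h \<in> S \<Longrightarrow> weighted_form \<pi> f h = 0"
  shows "weighted_form \<pi> f g = 0"
  using assms by (induction rule: sf.span_induct_alt) (auto simp: weighted_form_linear)

lemmas qt_form_G = weighted_form_pexp_list[of qt_weight, OF qt_weight_nonzero]

lemma qt_form_Q:
  assumes "is_partition \<nu>" "\<And>\<kappa>. \<kappa> \<in> above \<nu> \<Longrightarrow> coeff_sf f (monomial_of \<kappa>) = 0"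
  shows "weighted_form qt_weight f (qt_Q \<nu>) = coeff_sf f (monomial_of \<nu>)"
proof -
  have "weighted_form qt_weight f (qt_Q \<nu> - qt_G \<nu>) = 0"
    using assms(2) by (intro weighted_form_span_zero[OF qt_Q(1)[OF assms(1)]]) (auto simp: qt_form_G)
  then show ?thesis
    by (simp add: weighted_form_linear qt_form_G)
qed

lemma qt_G_in_span_Q: "is_partition \<nu> \<Longrightarrow> qt_G \<nu> \<in> sf.span (qt_Q ` insert \<nu> (above \<nu>))"
  and qt_Q_diff_in_span_Q: "is_partition \<nu> \<Longrightarrow> qt_Q \<nu> - qt_G \<nu> \<in> sf.span (qt_Q ` above \<nu>)"
proof -
  have *: "qt_Q \<nu> - qt_G \<nu> \<in> sf.span (qt_Q ` above \<nu>)"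
    if "is_partition \<nu>" "\<And>\<kappa>. \<kappa> \<in> above \<nu> \<Longrightarrow> qt_G \<kappa> \<in> sf.span (qt_Q ` insert \<kappa> (above \<kappa>))" for \<nu>
  proof -
    have "qt_G ` above \<nu> \<subseteq> sf.span (qt_Q ` above \<nu>)"
      using span_G_above_mono[OF that(1)] that(2) by blast
    then have "sf.span (qt_G ` above \<nu>) \<subseteq> sf.span (qt_Q ` above \<nu>)"
      by (rule sf.span_minimal) simp
    then show ?thesis
      using qt_Q(1)[OF that(1)] by blast
  qed
  have 1: "qt_G \<nu> \<in> sf.span (qt_Q ` insert \<nu> (above \<nu>))" if "is_partition \<nu>" for \<nu>
    using that
  proof (induction rule: above_induct)
    case (above \<nu>)
    have "qt_Q \<nu> - (qt_Q \<nu> - qt_G \<nu>) \<in> sf.span (qt_Q ` insert \<nu> (above \<nu>))"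
    proof (rule sf.span_diff)
      show "qt_Q \<nu> - qt_G \<nu> \<in> sf.span (qt_Q ` insert \<nu> (above \<nu>))"
        using *[OF above.hyps(1) above.IH] sf.span_mono[of "qt_Q ` above \<nu>" "qt_Q ` insert \<nu> (above \<nu>)"] by auto
    qed (auto intro: sf.span_base)
    then show ?case by simp
  qed
  then show "is_partition \<nu> \<Longrightarrow> qt_G \<nu> \<in> sf.span (qt_Q ` insert \<nu> (above \<nu>))" .
  show "is_partition \<nu> \<Longrightarrow> qt_Q \<nu> - qt_G \<nu> \<in> sf.span (qt_Q ` above \<nu>)"
    by (rule *) (assumption | rule 1 is_partition_above)+
qed

text \<open>With norm 0, Q_\<nu> would be orthogonal to all Q_\<kappa>, hence to all g_\<mu>, hence
  have no nonzero coefficient; but its pairing with m_\<nu> is 1.\<close>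

lemma qt_Q_norm_nonzero:
  assumes "is_partition \<nu>"
  shows "weighted_form qt_weight (qt_Q \<nu>) (qt_Q \<nu>) \<noteq> 0"
proof
  assume *: "weighted_form qt_weight (qt_Q \<nu>) (qt_Q \<nu>) = 0"
  have "qt_Q \<nu> = 0"
  proof (rule symfun_eq_partitionI)
    fix \<mu> assume \<mu>: "is_partition \<mu>"
    have "weighted_form qt_weight (qt_Q \<nu>) (qt_Q \<kappa>) = 0" if "is_partition \<kappa>" for \<kappa>
      using * qt_Q_orthogonal assms that by (cases "\<kappa> = \<nu>") auto
    then have "weighted_form qt_weight (qt_Q \<nu>) (qt_G \<mu>) = 0"
      using \<mu> by (intro weighted_form_span_zero[OF qt_G_in_span_Q]) (auto simp: above_def)
    then show "coeff_sf (qt_Q \<nu>) (monomial_of \<mu>) = coeff_sf 0 (monomial_of \<mu>)"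
      by (simp add: qt_form_G coeff_sf_simps)
  qed
  moreover have "weighted_form qt_weight (sf_m \<nu>) (qt_Q \<nu>) = 1"
    using assms by (subst qt_form_Q) (auto simp: coeff_sf_m above_def)
  ultimately show False
    by (simp add: weighted_form_linear)
qed

definition qt_P :: "nat list \<Rightarrow> qt symfun" where
  "qt_P \<nu> = (if is_partition \<nu> then sf_scale (inverse (weighted_form qt_weight (qt_Q \<nu>) (qt_Q \<nu>))) (qt_Q \<nu>) else 0)"

lemma qt_P_orthogonal:
  "is_partition \<mu> \<Longrightarrow> is_partition \<nu> \<Longrightarrow> \<mu> \<noteq> \<nu> \<Longrightarrow> weighted_form qt_weight (qt_P \<mu>) (qt_P \<nu>) = 0"
  by (simp add: qt_P_def weighted_form_linear qt_Q_orthogonal)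

text \<open>Pairing with g_\<mu> reads off the coefficient at \<mu>. As g_\<mu> lies in the span of
  the Q_\<kappa> with \<kappa> equal to or above \<mu>, and P_\<nu> is dual to Q_\<nu>, the
  triangularity of Q is transposed.\<close>

lemma coeff_qt_P:
  assumes "is_partition \<nu>" "is_partition \<mu>"
  shows "\<not> dominated \<mu> \<nu> \<Longrightarrow> coeff_sf (qt_P \<nu>) (monomial_of \<mu>) = 0"
    and "coeff_sf (qt_P \<nu>) (monomial_of \<nu>) = 1"
proof -
  have P_Q: "weighted_form qt_weight (qt_P \<nu>) (qt_Q \<kappa>) = (if \<kappa> = \<nu> then 1 else 0)" if "is_partition \<kappa>" for \<kappa>
    using assms(1) that qt_Q_norm_nonzero qt_Q_orthogonal by (simp add: qt_P_def weighted_form_linear)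
  show "coeff_sf (qt_P \<nu>) (monomial_of \<mu>) = 0" if "\<not> dominated \<mu> \<nu>"
  proof -
    have "weighted_form qt_weight (qt_P \<nu>) (qt_G \<mu>) = 0"
      using assms that P_Q dominated_refl
      by (intro weighted_form_span_zero[OF qt_G_in_span_Q]) (auto simp: above_def)
    then show ?thesis
      by (simp add: qt_form_G)
  qed
  have "weighted_form qt_weight (qt_P \<nu>) (qt_Q \<nu> - qt_G \<nu>) = 0"
    using assms P_Q by (intro weighted_form_span_zero[OF qt_Q_diff_in_span_Q]) (auto simp: above_def)
  then show "coeff_sf (qt_P \<nu>) (monomial_of \<nu>) = 1"
    using P_Q[OF assms(1)] by (simp add: weighted_form_linear qt_form_G)
qed

text \<open>Otherwise take \<mu> with nonzero coefficient and as few partitions above it as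
  possible. The coefficients above \<mu> vanish, so pairing with Q_\<mu>, a multiple of P_\<mu>,
  gives the coefficient at \<mu>.\<close>

lemma eq_zero_if_orthogonal_below:
  assumes "\<And>\<mu>. is_partition \<mu> \<Longrightarrow> \<mu> \<notin> below \<nu> \<Longrightarrow> coeff_sf f (monomial_of \<mu>) = 0"
    "\<And>\<mu>. \<mu> \<in> below \<nu> \<Longrightarrow> weighted_form qt_weight f (qt_P \<mu>) = 0"
  shows "f = 0"
proof (rule ccontr)
  assume "f \<noteq> 0"
  then obtain \<mu>0 where "is_partition \<mu>0 \<and> coeff_sf f (monomial_of \<mu>0) \<noteq> 0"
    using symfun_eq_partitionI[of f 0] by (auto simp: coeff_sf_simps)
  then obtain \<mu> where \<mu>: "is_partition \<mu>" "coeff_sf f (monomial_of \<mu>) \<noteq> 0"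
    and min: "\<And>\<kappa>. is_partition \<kappa> \<and> coeff_sf f (monomial_of \<kappa>) \<noteq> 0 \<Longrightarrow> card (above \<mu>) \<le> card (above \<kappa>)"
    using ex_has_least_nat[of "\<lambda>\<mu>. is_partition \<mu> \<and> coeff_sf f (monomial_of \<mu>) \<noteq> 0" \<mu>0 "\<lambda>\<mu>. card (above \<mu>)"]
    by blast
  have "coeff_sf f (monomial_of \<kappa>) = 0" if "\<kappa> \<in> above \<mu>" for \<kappa>
    using min[of \<kappa>] card_above_less[OF \<mu>(1) that] that by (force simp: above_def)
  then have "weighted_form qt_weight f (qt_Q \<mu>) \<noteq> 0"
    using \<mu> by (simp add: qt_form_Q)
  moreover have "\<mu> \<in> below \<nu>"
    using assms(1) \<mu> by blast
  ultimately show False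
    using assms(2)[of \<mu>] \<mu>(1) qt_Q_norm_nonzero by (simp add: qt_P_def weighted_form_linear)
qed

lemma unitriangular_iff:
  assumes "is_partition \<nu>"
  shows "(\<exists>u. u \<nu> = 1 \<and> f = (\<Sum>\<mu> | is_partition \<mu> \<and> dominated \<mu> \<nu>. sf_scale (u \<mu>) (sf_m \<mu>))) \<longleftrightarrow>
    coeff_sf f (monomial_of \<nu>) = (1 :: qt) \<and>
    (\<forall>\<mu>. is_partition \<mu> \<longrightarrow> \<not> dominated \<mu> \<nu> \<longrightarrow> coeff_sf f (monomial_of \<mu>) = 0)" (is "?l \<longleftrightarrow> ?r")
proof -
  let ?S = "{\<mu>. is_partition \<mu> \<and> dominated \<mu> \<nu>}"
  have fin: "finite ?S"
    by (rule finite_subset[OF _ finite_partitions_le[of "sum_list \<nu>"]]) (auto simp: dominated_def)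
  have c: "coeff_sf (\<Sum>\<mu>\<in>?S. sf_scale (u \<mu>) (sf_m \<mu>)) (monomial_of \<kappa>) = (if dominated \<kappa> \<nu> then u \<kappa> else (0 :: qt))"
    if "is_partition \<kappa>" for u \<kappa>
  proof -
    have "coeff_sf (\<Sum>\<mu>\<in>?S. sf_scale (u \<mu>) (sf_m \<mu>)) (monomial_of \<kappa>) = (\<Sum>\<mu>\<in>?S. if \<mu> = \<kappa> then u \<kappa> else 0)"
      unfolding coeff_sf_sum by (rule sum.cong) (auto simp: coeff_sf_simps coeff_sf_m that)
    then show ?thesis
      using fin that by simp
  qed
  show ?thesis
  proof
    assume ?l
    then show ?r
      using c assms dominated_refl by auto
  next
    assume ?r
    then show ?l
      using c by (intro exI[of _ "\<lambda>\<mu>. coeff_sf f (monomial_of \<mu>)"]) (auto intro!: symfun_eq_partitionI)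
  qed
qed

lemma is_macdonald_family_iff:
  "is_macdonald_family P \<longleftrightarrow>
    (\<forall>\<nu>. is_partition \<nu> \<longrightarrow> coeff_sf (P \<nu>) (monomial_of \<nu>) = 1 \<and>
      (\<forall>\<mu>. is_partition \<mu> \<longrightarrow> \<not> dominated \<mu> \<nu> \<longrightarrow> coeff_sf (P \<nu>) (monomial_of \<mu>) = 0)) \<and>
    (\<forall>\<nu> \<mu>. is_partition \<nu> \<longrightarrow> is_partition \<mu> \<longrightarrow> \<nu> \<noteq> \<mu> \<longrightarrow> weighted_form qt_weight (P \<nu>) (P \<mu>) = 0)"
  unfolding is_macdonald_family_def qt_form_eq by (simp add: unitriangular_iff cong: imp_cong)

text \<open>Uniqueness by induction from below: the difference of two candidates has its monomials
  strictly below \<nu> and is orthogonal to the P_\<mu> there, on which the families already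
  agree.\<close>

lemma macdonald_P_eq: "macdonald_P = qt_P"
  unfolding macdonald_P_def
proof (rule the_equality)
  show "is_macdonald_family qt_P \<and> (\<forall>\<nu>. \<not> is_partition \<nu> \<longrightarrow> qt_P \<nu> = 0)"
    by (simp add: is_macdonald_family_iff coeff_qt_P qt_P_orthogonal) (simp add: qt_P_def)
next
  fix P assume P: "is_macdonald_family P \<and> (\<forall>\<nu>. \<not> is_partition \<nu> \<longrightarrow> P \<nu> = 0)"
  have "P \<nu> = qt_P \<nu>" if "is_partition \<nu>" for \<nu>
    using that
  proof (induction rule: below_induct)
    case (below \<nu>)
    have "P \<nu> - qt_P \<nu> = 0"
    proof (rule eq_zero_if_orthogonal_below[of \<nu>])
      show "coeff_sf (P \<nu> - qt_P \<nu>) (monomial_of \<mu>) = 0" if "is_partition \<mu>" "\<mu> \<notin> below \<nu>" for \<mu>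
        using P that below.hyps(1) coeff_qt_P[OF below.hyps(1) that(1)]
        by (cases "\<mu> = \<nu>") (auto simp: is_macdonald_family_iff below_def coeff_sf_simps)
      show "weighted_form qt_weight (P \<nu> - qt_P \<nu>) (qt_P \<mu>) = 0" if "\<mu> \<in> below \<nu>" for \<mu>
      proof -
        have "is_partition \<mu>" "\<nu> \<noteq> \<mu>" "P \<mu> = qt_P \<mu>"
          using that below.IH by (auto simp: below_def)
        moreover from this have "weighted_form qt_weight (P \<nu>) (P \<mu>) = 0"
          using P below.hyps(1) unfolding is_macdonald_family_iff by blast
        ultimately have "weighted_form qt_weight (P \<nu>) (qt_P \<mu>) = 0" "weighted_form qt_weight (qt_P \<nu>) (qt_P \<mu>) = 0"
          using below.hyps(1) qt_P_orthogonal by auto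
        then show ?thesis
          by (simp add: weighted_form_linear)
      qed
    qed
    then show ?case by simp
  qed
  then show "P = qt_P"
    using P by (auto simp: fun_eq_iff qt_P_def)
qed

lemma macdonald_P_eqI:
  assumes "is_partition \<nu>" "\<And>\<mu>. is_partition \<mu> \<Longrightarrow> \<not> dominated \<mu> \<nu> \<Longrightarrow> coeff_sf f (monomial_of \<mu>) = 0"
    "\<And>\<mu>. \<mu> \<in> below \<nu> \<Longrightarrow> weighted_form qt_weight f (macdonald_P \<mu>) = 0"
  shows "f = sf_scale (coeff_sf f (monomial_of \<nu>)) (macdonald_P \<nu>)"
proof -
  have "f - sf_scale (coeff_sf f (monomial_of \<nu>)) (macdonald_P \<nu>) = 0"
  proof (rule eq_zero_if_orthogonal_below[of \<nu>])
    show "coeff_sf (f - sf_scale (coeff_sf f (monomial_of \<nu>)) (macdonald_P \<nu>)) (monomial_of \<mu>) = 0"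
      if "is_partition \<mu>" "\<mu> \<notin> below \<nu>" for \<mu>
      using that assms coeff_qt_P[OF assms(1) that(1)]
      by (cases "\<mu> = \<nu>") (auto simp: macdonald_P_eq below_def coeff_sf_simps)
    show "weighted_form qt_weight (f - sf_scale (coeff_sf f (monomial_of \<nu>)) (macdonald_P \<nu>)) (qt_P \<mu>) = 0"
      if "\<mu> \<in> below \<nu>" for \<mu>
      using that assms(1,3) qt_P_orthogonal[of \<nu> \<mu>] by (auto simp: weighted_form_linear macdonald_P_eq below_def)
  qed
  then show ?thesis by simp
qed

section \<open>The Macdonald functions of hooks\<close>

text \<open>\<open>signed_e r\<close> is \<open>(-1)\<^sup>r e\<^sub>r\<close>, and \<open>t_h n\<close> is \<open>h\<^sub>n[X(1 - t)]\<close>.\<close>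

abbreviation "signed_e \<equiv> pexp (\<lambda>k. - 1)"
abbreviation "t_h \<equiv> pexp (\<lambda>k. 1 - t ^ k)"

text \<open>On weights, - 1 + (1 - t^k) = - t^k.\<close>

lemma signed_e_mult_t_h: "(\<Sum>r\<le>n. signed_e r * t_h (n - r)) = sf_scale (t ^ n) (signed_e n)"
  using pexp_add[of "\<lambda>k. - 1" "\<lambda>k. 1 - t ^ k" n] pexp_power[of t "\<lambda>k. - 1" n] by simp

text \<open>G(q z) times the series of the \<open>t_h\<close> is G(z).\<close>

lemma g_mult_t_h: "(\<Sum>s\<le>n. sf_scale (q ^ s) (qt_g s * t_h (n - s))) = qt_g n"
proof -
  have "(\<lambda>k. q ^ k * qt_weight k + (1 - t ^ k)) = qt_weight"
    using qt_weight_mult_q by (auto simp: fun_eq_iff algebra_simps)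
  then show ?thesis
    using pexp_add[of "\<lambda>k. q ^ k * qt_weight k" "\<lambda>k. 1 - t ^ k" n]
    by (simp add: pexp_power mult_sf_scale_left)
qed

lemma coeff_pexp:
  "coeff_sf (pexp \<sigma> n) (monomial_of \<alpha>) =
    (if sum_list \<alpha> = n then prod_list (map (pexp_coeff \<sigma>) \<alpha>) else 0)"
proof (induction \<alpha> arbitrary: n)
  case Nil
  then show ?case
    using homogeneous_pexp[of n \<sigma>] by (auto simp: homogeneous_def coeff_sf_simps)
next
  case (Cons k \<alpha>)
  then show ?case
    by (auto simp: coeff_monomial_Cons h_adj_pexp coeff_sf_simps simp del: monomial_of.simps)
qed

lemma pexp_coeff_minus_one: "pexp_coeff (\<lambda>k. - 1) k = (if k = 0 then 1 else if k = 1 then - 1 else 0)"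
proof -
  have "pexp_coeff (\<lambda>k. 0) n = (if n = 0 then 1 else 0)" for n
    by (simp add: pexp_coeff.simps)
  then have sum: "(\<Sum>i\<le>n. pexp_coeff (\<lambda>k. - 1) i) = (if n = 0 then 1 else 0)" for n
    using pexp_coeff_add[of "\<lambda>k. - 1" "\<lambda>k. 1" n] pexp_coeff_const_one by simp
  show ?thesis
  proof (cases k)
    case (Suc n)
    then show ?thesis
      using sum[of "Suc n"] sum[of n] by (auto simp: eq_neg_iff_add_eq_0 add.commute)
  qed simp
qed

text \<open>By \<open>pexp_coeff_minus_one\<close> no exponent exceeds 1, so the monomials of e_r
  are squarefree of degree r.\<close>

lemma coeff_signed_e:
  assumes "coeff_sf (signed_e r) m \<noteq> 0"
  shows "card (set_mset m) = r"
proof -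
  obtain \<nu> h where \<nu>: "is_partition \<nu>" "inj_on h (set_mset (monomial_of \<nu>))" "m = image_mset h (monomial_of \<nu>)"
    using obtain_monomial_of .
  have "coeff_sf (signed_e r) (monomial_of \<nu>) \<noteq> 0"
    using assms \<nu> by (simp add: coeff_sf_image_mset)
  then have r: "sum_list \<nu> = r" "\<forall>k\<in>set \<nu>. k = 1"
    using is_partitionD[OF \<nu>(1)]
    by (auto simp: coeff_pexp prod_list_zero_iff pexp_coeff_minus_one split: if_splits)
  have "sum_list \<nu> = length \<nu>"
    using r(2) by (induction \<nu>) auto
  then have "length \<nu> = r"
    using r(1) by simp
  moreover have "set_mset (monomial_of \<nu>) = {..<length \<nu>}"
    using is_partitionD[OF \<nu>(1)] by (force simp: set_monomial_of in_set_conv_nth)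
  ultimately show ?thesis
    using \<nu>(2,3) by (simp add: card_image)
qed

lemma coeff_signed_e_mult:
  assumes "card (set_mset m) < r"
  shows "coeff_sf (signed_e r * f) m = 0"
  unfolding coeff_sf_times
proof (rule sum.neutral, safe)
  fix a b assume "(a, b) \<in> msplits m"
  then have "set_mset a \<subseteq> set_mset m"
    by (auto simp: msplits_def)
  then have "card (set_mset a) < r"
    using assms by (meson card_mono finite_set_mset le_less_trans)
  then have "coeff_sf (signed_e r) a = 0"
    using coeff_signed_e[of r a] by auto
  then show "coeff_sf (signed_e r) a * coeff_sf f b = 0"
    by simp
qed

text \<open>Coefficients of (1 - y) G(y) = (1 - t y) G(q y) for the one-variable series G. Available
  is G(q y) = G(y) (1 - y)/(1 - t y); S collects the geometric tail and is eliminated between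
  consecutive n.\<close>

lemma pexp_coeff_qt_weight_Suc:
  "(1 - q ^ Suc n) * pexp_coeff qt_weight (Suc n) = (1 - t * q ^ n) * pexp_coeff qt_weight n"
proof -
  let ?\<gamma> = "pexp_coeff qt_weight"
  define S where "S = (\<lambda>n. \<Sum>i<n. ?\<gamma> i * t ^ (n - i))"
  have S_Suc: "S (Suc n) = t * (S n + ?\<gamma> n)" for n
    by (simp add: S_def sum_distrib_left Suc_diff_le algebra_simps)
  have "q ^ n * ?\<gamma> n = ?\<gamma> n + (1 - inverse t) * S n" for n
  proof -
    have "(\<lambda>k. qt_weight k + (t ^ k - 1)) = (\<lambda>k. q ^ k * qt_weight k)"
      by (simp add: fun_eq_iff algebra_simps flip: qt_weight_mult_q)
    then have "q ^ n * ?\<gamma> n = (\<Sum>i\<le>n. ?\<gamma> i * qt_eta (n - i))"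
      using pexp_coeff_add[of qt_weight "\<lambda>k. t ^ k - 1" n] pexp_coeff_power[of q qt_weight n] by simp
    also have "{..n} = insert n {..<n}"
      by auto
    also have "(\<Sum>i\<in>insert n {..<n}. ?\<gamma> i * qt_eta (n - i)) = ?\<gamma> n + (\<Sum>i<n. ?\<gamma> i * ((1 - inverse t) * t ^ (n - i)))"
      by (simp add: qt_eta_eq)
    finally show ?thesis
      by (simp add: S_def sum_distrib_left mult_ac)
  qed
  note * = this
  have "q ^ Suc n * ?\<gamma> (Suc n) = ?\<gamma> (Suc n) + (t - 1) * (S n + ?\<gamma> n)"
    unfolding *[of "Suc n"] S_Suc by (simp add: algebra_simps)
  moreover have "t * (q ^ n * ?\<gamma> n) = t * ?\<gamma> n + (t - 1) * S n"
    unfolding * by (simp add: algebra_simps)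
  ultimately show ?thesis
    by (simp add: left_diff_distrib distrib_left mult.assoc)
qed

lemma pexp_coeff_qt_weight:
  "pexp_coeff qt_weight n * (\<Prod>j=1..n. 1 - q ^ j) = (\<Prod>j<n. 1 - q ^ j * t)"
proof (induction n)
  case (Suc n)
  have "pexp_coeff qt_weight (Suc n) * (\<Prod>j=1..Suc n. 1 - q ^ j) =
      ((1 - q ^ Suc n) * pexp_coeff qt_weight (Suc n)) * (\<Prod>j=1..n. 1 - q ^ j)"
    by (simp add: mult_ac)
  also have "\<dots> = (1 - t * q ^ n) * (pexp_coeff qt_weight n * (\<Prod>j=1..n. 1 - q ^ j))"
    unfolding pexp_coeff_qt_weight_Suc by (simp only: mult.assoc)
  also have "\<dots> = (\<Prod>j<Suc n. 1 - q ^ j * t)"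
    unfolding Suc by (simp only: prod.lessThan_Suc mult.commute)
  finally show ?case .
qed simp

section \<open>Hooks in the dominance order and the candidate for their integral form\<close>

abbreviation hook :: "nat \<Rightarrow> nat \<Rightarrow> nat list" where
  "hook a b \<equiv> b # replicate a (Suc 0)"

text \<open>The product of \<open>hook_v a b\<close> over all inner points of the paths from 0 to a
  + b on the noncommutative side.\<close>

definition hook_factor :: "nat \<Rightarrow> nat \<Rightarrow> qt" where
  "hook_factor a b = (\<Prod>i=1..a. t ^ i - 1) * (\<Prod>j=1..<b. 1 - q ^ j)"

definition hook_J :: "nat \<Rightarrow> nat \<Rightarrow> qt symfun" where
  "hook_J a b = sf_scale (hook_factor a b)
     (\<Sum>r\<le>a. \<Sum>s<b. sf_scale (q ^ s) (signed_e r * (qt_g s * t_h (a + b - r - s))))"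

lemma nth_hook: "i \<le> a \<Longrightarrow> hook a b ! i = (if i = 0 then b else 1)"
  by (cases i) simp_all

lemma sum_list_hook: "sum_list (hook a b) = a + b"
  by (simp add: sum_list_replicate)

lemma is_partition_hook: "b \<ge> 1 \<Longrightarrow> is_partition (hook a b)"
  by (auto simp: is_partition_def partitions_def sorted_wrt_iff_nth_less nth_Cons split: nat.splits)

lemma sum_list_take_hook: "sum_list (take k (hook a b)) = (if k = 0 then 0 else b + min (k - 1) a)"
  by (cases k) (simp_all add: sum_list_replicate)

lemma sum_list_take_drop: "sum_list (take k xs) + sum_list (drop k xs) = sum_list (xs :: nat list)"
  by (metis append_take_drop_id sum_list_append)

text \<open>After k <= a parts at least a + 1 - k remain, each at least 1.\<close>

lemma dominated_hook:
  assumes "is_partition \<mu>" "sum_list \<mu> = a + b" "b \<ge> 1" "length \<mu> > a"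
  shows "dominated \<mu> (hook a b)"
  unfolding dominated_def
proof (intro conjI allI)
  fix k
  have "0 \<notin> set (drop k \<mu>)"
    using is_partitionD[OF assms(1)] in_set_dropD by metis
  then have "length \<mu> - k \<le> sum_list (drop k \<mu>)"
    using length_le_sum_list[of "drop k \<mu>"] by simp
  then show "sum_list (take k \<mu>) \<le> sum_list (take k (hook a b))"
    using sum_list_take_drop[of k \<mu>] assms(2,4) unfolding sum_list_take_hook by auto
qed (simp add: assms(2) sum_list_replicate)

lemma hook_dominated:
  assumes "is_partition (m # \<mu>)" "sum_list (m # \<mu>) = a + b" "m \<ge> b"
  shows "dominated (hook a b) (m # \<mu>)"
  unfolding dominated_def
proof (intro conjI allI)
  fix k
  have "min k (sum_list \<mu>) \<le> sum_list (take k \<mu>)" for k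
  proof (cases "k \<le> length \<mu>")
    case True
    have "0 \<notin> set (take k \<mu>)"
      using is_partitionD[OF assms(1)] in_set_takeD by fastforce
    then show ?thesis
      using length_le_sum_list[of "take k \<mu>"] True by simp
  qed simp
  from this[of "k - 1"] show "sum_list (take k (hook a b)) \<le> sum_list (take k (m # \<mu>))"
    using assms(2,3) unfolding sum_list_take_hook by (cases k) auto
qed (use assms(2) in \<open>simp add: sum_list_replicate\<close>)

lemma hook_J_by_columns:
  assumes "b \<ge> 1"
  shows "hook_J a b = sf_scale (hook_factor a b) (\<Sum>s<b. sf_scale (q ^ s)
    ((sf_scale (t ^ (a + b - s)) (signed_e (a + b - s)) - (\<Sum>r=Suc a..a + b - s. signed_e r * t_h (a + b - s - r))) * qt_g s))"
proof -
  have "(\<Sum>r\<le>a. signed_e r * t_h (n - r)) =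
      sf_scale (t ^ n) (signed_e n) - (\<Sum>r=Suc a..n. signed_e r * t_h (n - r))" if "a \<le> n" for n
  proof -
    have "{..n} = {..a} \<union> {Suc a..n}"
      using that by auto
    then have "(\<Sum>r\<le>n. signed_e r * t_h (n - r)) =
        (\<Sum>r\<le>a. signed_e r * t_h (n - r)) + (\<Sum>r=Suc a..n. signed_e r * t_h (n - r))"
      by (simp add: sum.union_disjoint)
    then show ?thesis
      by (simp add: signed_e_mult_t_h algebra_simps)
  qed
  note columns = this
  have "(\<Sum>r\<le>a. sf_scale (q ^ s) (signed_e r * (qt_g s * t_h (a + b - r - s)))) =
      sf_scale (q ^ s) ((sf_scale (t ^ (a + b - s)) (signed_e (a + b - s)) -
        (\<Sum>r=Suc a..a + b - s. signed_e r * t_h (a + b - s - r))) * qt_g s)" if "s < b" for s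
  proof -
    have "a \<le> a + b - s"
      using that by simp
    then show ?thesis
      unfolding columns[symmetric, OF \<open>a \<le> a + b - s\<close>]
      by (simp only: sum_distrib_right sf.scale_sum_right diff_commute[of _ _ s] mult.commute[of "qt_g s"] mult.assoc)
  qed
  then show ?thesis
    unfolding hook_J_def by (subst sum.swap) simp
qed

lemma homogeneous_hook_J: "homogeneous (a + b) (hook_J a b)"
  unfolding hook_J_def
proof (intro homogeneous_scale homogeneous_sum)
  fix r s assume "r \<in> {..a}" "s \<in> {..<b}"
  then have "r + (s + (a + b - r - s)) = a + b"
    by simp
  then show "homogeneous (a + b) (signed_e r * (qt_g s * t_h (a + b - r - s)))"
    by (metis homogeneous_mult homogeneous_pexp)
qed

lemma coeff_hook_J_zero:
  assumes "b \<ge> 1" "card (set_mset m) \<le> a"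
  shows "coeff_sf (hook_J a b) m = 0"
proof -
  have "coeff_sf ((sf_scale (t ^ (a + b - s)) (signed_e (a + b - s)) -
      (\<Sum>r=Suc a..a + b - s. signed_e r * t_h (a + b - s - r))) * qt_g s) m = 0" if "s < b" for s
  proof -
    have "coeff_sf (signed_e r * f) m = 0" if "a < r" for r f
      using that assms(2) by (intro coeff_signed_e_mult) simp
    moreover have "a < a + b - s"
      using that by simp
    ultimately show ?thesis
      by (simp add: left_diff_distrib sum_distrib_right mult.assoc mult_sf_scale_left coeff_sf_simps coeff_sf_sum)
  qed
  then show ?thesis
    unfolding hook_J_by_columns[OF assms(1)] by (simp add: coeff_sf_simps coeff_sf_sum)
qed

text \<open>In a + 1 variables only r = a + 1 survives. By \<open>g_mult_t_h\<close> the sum over s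
  then collapses and leaves q^{b-1} t^{a+1} - 1 times
  \<open>signed_e (Suc a) * qt_g (b - 1)\<close>.\<close>

lemma coeff_hook_J_hook:
  assumes b: "b \<ge> 1"
  shows "coeff_sf (hook_J a b) (monomial_of (hook a b)) =
    hook_factor a b * (1 - q ^ (b - 1) * t ^ (a + 1)) * (- 1) ^ a * pexp_coeff qt_weight (b - 1)"
proof -
  let ?m = "monomial_of (hook a b)"
  have "set_mset ?m = {..<Suc a}"
  proof (rule Set.set_eqI)
    fix i
    show "i \<in># ?m \<longleftrightarrow> i \<in> {..<Suc a}"
      using b nth_hook[of i a b]
      by (cases "i \<le> a") (auto simp: set_monomial_of simp del: monomial_of.simps)
  qed
  then have vanish: "coeff_sf (signed_e r * f) ?m = 0" if "Suc a < r" for r f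
    using that by (intro coeff_signed_e_mult) simp
  have "coeff_sf ((sf_scale (t ^ (a + b - s)) (signed_e (a + b - s)) -
      (\<Sum>r=Suc a..a + b - s. signed_e r * t_h (a + b - s - r))) * qt_g s) ?m =
      coeff_sf (signed_e (Suc a) * (sf_scale (if s = b - 1 then t ^ Suc a else 0) (qt_g s) - qt_g s * t_h (b - 1 - s))) ?m"
    if "s < b" for s
  proof -
    have set: "{Suc a..a + b - s} = insert (Suc a) {Suc (Suc a)..a + b - s}"
      using that by auto
    have "(\<Sum>r=Suc a..a + b - s. coeff_sf (signed_e r * (t_h (a + b - s - r) * qt_g s)) ?m) =
        coeff_sf (signed_e (Suc a) * (qt_g s * t_h (b - 1 - s))) ?m"
      unfolding set using that by (simp add: vanish mult.commute[of "qt_g s"] del: monomial_of.simps)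
    moreover have "coeff_sf (sf_scale (t ^ (a + b - s)) (signed_e (a + b - s) * qt_g s)) ?m =
        coeff_sf (signed_e (Suc a) * sf_scale (if s = b - 1 then t ^ Suc a else 0) (qt_g s)) ?m"
    proof (cases "s = b - 1")
      case True
      then have "a + b - s = Suc a"
        using b by simp
      then show ?thesis
        using True by (simp add: mult_sf_scale_right del: monomial_of.simps)
    next
      case False
      then have "Suc a < a + b - s"
        using that by simp
      then show ?thesis
        using False by (simp add: coeff_sf_simps vanish mult_sf_scale_right del: monomial_of.simps)
    qed
    ultimately show ?thesis
      by (simp add: left_diff_distrib right_diff_distrib sum_distrib_right mult.assoc mult_sf_scale_left
          coeff_sf_simps(4) coeff_sf_sum del: monomial_of.simps)
  qed
  then have "coeff_sf (hook_J a b) ?m = hook_factor a b * coeff_sf (signed_e (Suc a) *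
      (\<Sum>s<b. sf_scale (q ^ s) (sf_scale (if s = b - 1 then t ^ Suc a else 0) (qt_g s) - qt_g s * t_h (b - 1 - s)))) ?m"
    unfolding hook_J_by_columns[OF b] sum_distrib_left mult_sf_scale_right
    by (simp add: coeff_sf_sum sf_scale.rep_eq del: monomial_of.simps)
  also have "(\<Sum>s<b. sf_scale (q ^ s) (sf_scale (if s = b - 1 then t ^ Suc a else 0) (qt_g s) - qt_g s * t_h (b - 1 - s))) =
      sf_scale (q ^ (b - 1) * t ^ Suc a - 1) (qt_g (b - 1))"
  proof -
    have "(\<Sum>s<b. sf_scale (q ^ s) (sf_scale (if s = b - 1 then t ^ Suc a else 0) (qt_g s))) =
        (\<Sum>s<b. if s = b - 1 then sf_scale (q ^ (b - 1) * t ^ Suc a) (qt_g (b - 1)) else 0)"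
      by (rule sum.cong) auto
    moreover have "{..<b} = {..b - 1}"
      using b by auto
    ultimately show ?thesis
      using b g_mult_t_h[of "b - 1"]
      by (simp add: sf.scale_right_diff_distrib sum_subtractf sf.scale_left_diff_distrib)
  qed
  also have "coeff_sf (signed_e (Suc a) * sf_scale (q ^ (b - 1) * t ^ Suc a - 1) (qt_g (b - 1))) ?m =
      (q ^ (b - 1) * t ^ Suc a - 1) * coeff_sf (signed_e (Suc a) * qt_g (b - 1)) ?m"
    by (simp add: mult_sf_scale_right coeff_sf_simps del: monomial_of.simps)
  also have "coeff_sf (signed_e (Suc a) * qt_g (b - 1)) ?m = - ((- 1) ^ a * pexp_coeff qt_weight (b - 1))"
  proof -
    \<comment> \<open>Of the b copies of x_0, e_{a+1} takes at most one and g_{b-1} at most b - 1,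
      so only i = 1 contributes.\<close>
    have "h_adj b (signed_e (Suc a) * qt_g (b - 1)) =
        (\<Sum>i\<le>b. if i = 1 then sf_scale (- pexp_coeff qt_weight (b - 1)) (signed_e a) else 0)"
      unfolding h_adj_mult using b
      by (intro sum.cong refl)
        (auto simp: h_adj_pexp pexp_coeff_minus_one mult_sf_scale_left mult_sf_scale_right mult.commute)
    then have "h_adj b (signed_e (Suc a) * qt_g (b - 1)) = sf_scale (- pexp_coeff qt_weight (b - 1)) (signed_e a)"
      using b by simp
    then show ?thesis
      by (simp add: coeff_monomial_Cons coeff_sf_simps coeff_pexp sum_list_replicate pexp_coeff_minus_one
          del: monomial_of.simps)
  qed
  finally show ?thesis
    by (simp add: algebra_simps)
qed

text \<open>An exponent s in a monomial of P_\<mu> would give a partition dominated by \<mu> whose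
  first part is at least s, hence larger than \<mu>_1.\<close>

lemma h_adj_macdonald_P:
  assumes "is_partition \<mu>" "\<And>k. k \<in> set \<mu> \<Longrightarrow> k < s" "s > 0"
  shows "h_adj s (macdonald_P \<mu>) = 0"
proof (rule symfun_eq_partitionI)
  fix \<kappa> assume \<kappa>: "is_partition \<kappa>"
  obtain \<nu> where \<nu>: "is_partition \<nu>" "exponents (monomial_of (s # \<kappa>)) = mset \<nu>"
    "coeff_sf (macdonald_P \<mu>) (monomial_of (s # \<kappa>)) = coeff_sf (macdonald_P \<mu>) (monomial_of \<nu>)"
    using coeff_sf_monomial_of_cases[of "monomial_of (s # \<kappa>)"] by metis
  have "mset \<nu> = mset (s # \<kappa>)"
    using \<nu>(2) exponents_monomial_of[of "s # \<kappa>"] is_partitionD[OF \<kappa>] assms(3) by simp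
  then have "s \<in> set \<nu>"
    by (metis list.set_intros(1) mset_eq_setD)
  then obtain k \<nu>' where \<nu>': "\<nu> = k # \<nu>'" "s \<le> k"
    using \<nu>(1) by (cases \<nu>) (auto simp: is_partition_def partitions_def)
  have "\<not> dominated \<nu> \<mu>"
  proof
    assume "dominated \<nu> \<mu>"
    then have "k \<le> sum_list (take 1 \<mu>)"
      using \<nu>'(1) by (auto simp: dominated_def dest: spec[of _ 1])
    then show False
      using assms(2) \<nu>'(2) assms(3) by (cases \<mu>) force+
  qed
  then show "coeff_sf (h_adj s (macdonald_P \<mu>)) (monomial_of \<kappa>) = coeff_sf 0 (monomial_of \<kappa>)"
    using coeff_qt_P(1)[OF assms(1) \<nu>(1)] \<nu>(3)
    by (simp add: macdonald_P_eq coeff_sf_simps flip: coeff_monomial_Cons)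
qed

lemma hook_J_by_rows:
  assumes "b \<ge> 1"
  shows "hook_J a b = sf_scale (hook_factor a b) (\<Sum>r\<le>a. signed_e r *
    (qt_g (a + b - r) - (\<Sum>s=b..a + b - r. sf_scale (q ^ s) (qt_g s * t_h (a + b - r - s)))))"
proof -
  have "(\<Sum>s<b. sf_scale (q ^ s) (qt_g s * t_h (n - s))) =
      qt_g n - (\<Sum>s=b..n. sf_scale (q ^ s) (qt_g s * t_h (n - s)))" if "b \<le> n" for n
  proof -
    have "{..n} = {..<b} \<union> {b..n}"
      using that by auto
    then have "(\<Sum>s\<le>n. sf_scale (q ^ s) (qt_g s * t_h (n - s))) =
        (\<Sum>s<b. sf_scale (q ^ s) (qt_g s * t_h (n - s))) + (\<Sum>s=b..n. sf_scale (q ^ s) (qt_g s * t_h (n - s)))"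
      by (simp add: sum.union_disjoint ivl_disj_int)
    then show ?thesis
      by (simp add: g_mult_t_h algebra_simps)
  qed
  note rows = this
  have "(\<Sum>s<b. sf_scale (q ^ s) (signed_e r * (qt_g s * t_h (a + b - r - s)))) = signed_e r *
      (qt_g (a + b - r) - (\<Sum>s=b..a + b - r. sf_scale (q ^ s) (qt_g s * t_h (a + b - r - s))))" if "r \<le> a" for r
  proof -
    have "b \<le> a + b - r"
      using that by simp
    then show ?thesis
      unfolding rows[symmetric, OF \<open>b \<le> a + b - r\<close>] by (simp only: sum_distrib_left mult_sf_scale_right)
  qed
  then show ?thesis
    unfolding hook_J_def by simp
qed

lemma hook_J_orthogonal:
  assumes "b \<ge> 1" "is_partition \<mu>" "\<And>k. k \<in> set \<mu> \<Longrightarrow> k < b"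
  shows "weighted_form qt_weight (hook_J a b) (macdonald_P \<mu>) = 0"
proof -
  have g: "weighted_form qt_weight (qt_g s * f) (macdonald_P \<mu>) = 0" if "s \<ge> b" for s f
  proof -
    have "h_adj s (macdonald_P \<mu>) = 0"
      using assms that by (intro h_adj_macdonald_P) (auto intro: less_le_trans)
    then show ?thesis
      using qt_form_adjoint(2)[of s "macdonald_P \<mu>" f] by (simp add: weighted_form_linear weighted_form_commute)
  qed
  show ?thesis
    unfolding hook_J_by_rows[OF assms(1)]
    by (simp add: weighted_form_linear right_diff_distrib sum_distrib_left mult_sf_scale_right
        mult.left_commute[of "signed_e _"] mult.commute[of "signed_e _"] g mult.assoc)
qed

text \<open>Otherwise \<mu>_1 >= b, so \<mu> would also dominate the hook and be equal to
  it.\<close>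

lemma below_hook:
  assumes "b \<ge> 1" "\<mu> \<in> below (hook a b)" "k \<in> set \<mu>"
  shows "k < b"
proof (rule ccontr)
  assume "\<not> k < b"
  have \<mu>: "is_partition \<mu>" "dominated \<mu> (hook a b)" "\<mu> \<noteq> hook a b"
    using assms(2) by (auto simp: below_def)
  then obtain m \<mu>' where m: "\<mu> = m # \<mu>'" "b \<le> m"
    using assms(3) \<open>\<not> k < b\<close> by (cases \<mu>) (force simp: is_partition_def partitions_def)+
  then have "dominated (hook a b) \<mu>"
    using hook_dominated[of m \<mu>' a b] \<mu> sum_list_hook by (simp add: dominated_def)
  then show False
    using dominated_antisym[OF \<mu>(1) is_partition_hook[OF assms(1)] \<mu>(2)] \<mu>(3) by simp
qed

lemma macdonald_c_hook:
  assumes "b \<ge> 1"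
  shows "(\<Prod>i<length (hook a b). \<Prod>j<hook a b ! i. 1 - q ^ arm (hook a b) i j * t ^ (leg (hook a b) i j + 1)) =
    hook_factor a b * (1 - q ^ (b - 1) * t ^ (a + 1)) * (- 1) ^ a * pexp_coeff qt_weight (b - 1)"
proof -
  let ?\<nu> = "hook a b"
  let ?c = "\<lambda>i j. 1 - q ^ arm ?\<nu> i j * t ^ (leg ?\<nu> i j + 1)"
  have leg0: "leg ?\<nu> 0 j = (if j = 0 then a else 0)" for j
  proof -
    have "{k. 0 < k \<and> k < length ?\<nu> \<and> j < ?\<nu> ! k} = (if j = 0 then {1..a} else {})"
      by (auto simp: nth_hook)
    then show ?thesis
      by (simp add: leg_def)
  qed
  have leg1: "leg ?\<nu> (Suc i) 0 = a - Suc i" if "i < a" for i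
  proof -
    have "{k. Suc i < k \<and> k < length ?\<nu> \<and> 0 < ?\<nu> ! k} = {Suc (Suc i)..a}"
      by (auto simp: nth_hook)
    then show ?thesis
      by (simp add: leg_def)
  qed
  have row: "(\<Prod>j<b. ?c 0 j) = (1 - q ^ (b - 1) * t ^ (a + 1)) * (\<Prod>j<b - 1. 1 - q ^ j * t)"
  proof -
    obtain b' where b: "b = Suc b'"
      using assms by (cases b) auto
    \<comment> \<open>The corner has leg a, the other cells of the first row have leg 0.\<close>
    have "(\<Prod>j<b. ?c 0 j) = ?c 0 0 * (\<Prod>j<b'. ?c 0 (Suc j))"
      unfolding b by (rule prod.lessThan_Suc_shift)
    also have "(\<Prod>j<b'. ?c 0 (Suc j)) = (\<Prod>j<b'. 1 - q ^ (b' - Suc j) * t)"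
      by (simp add: leg0 arm_def) (simp add: b)
    also have "\<dots> = (\<Prod>j<b'. 1 - q ^ j * t)"
      by (rule prod.nat_diff_reindex)
    finally show ?thesis
      by (simp add: leg0 arm_def) (simp add: b)
  qed
  have "(\<Prod>i<a. \<Prod>j<?\<nu> ! Suc i. ?c (Suc i) j) = (\<Prod>i<a. 1 - t ^ Suc (a - Suc i))"
    by (intro prod.cong refl) (simp add: leg1 arm_def)
  also have "\<dots> = (\<Prod>i<a. 1 - t ^ Suc i)"
    by (rule prod.nat_diff_reindex)
  also have "\<dots> = (- 1) ^ a * (\<Prod>i<a. t ^ Suc i - 1)"
    by (induction a) (simp_all add: algebra_simps)
  also have "(\<Prod>i<a. t ^ Suc i - 1) = (\<Prod>i=1..a. t ^ i - 1)"
    by (simp add: prod.atLeast1_atMost_eq)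
  finally have col: "(\<Prod>i<a. \<Prod>j<?\<nu> ! Suc i. ?c (Suc i) j) = (- 1) ^ a * (\<Prod>i=1..a. t ^ i - 1)" .
  have "(\<Prod>i<length ?\<nu>. \<Prod>j<?\<nu> ! i. ?c i j) = (\<Prod>j<b. ?c 0 j) * (\<Prod>i<a. \<Prod>j<?\<nu> ! Suc i. ?c (Suc i) j)"
    using prod.lessThan_Suc_shift[of "\<lambda>i. \<Prod>j<?\<nu> ! i. ?c i j" a] by simp
  moreover have "{1..b - 1} = {1..<b}"
    using assms by auto
  ultimately show ?thesis
    unfolding row col hook_factor_def pexp_coeff_qt_weight[symmetric] by simp
qed

lemma macdonald_J_hook:
  assumes "b \<ge> 1"
  shows "macdonald_J (hook a b) = hook_J a b"
proof -
  have "hook_J a b = sf_scale (coeff_sf (hook_J a b) (monomial_of (hook a b))) (macdonald_P (hook a b))"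
  proof (rule macdonald_P_eqI)
    fix \<mu> assume \<mu>: "is_partition \<mu>" "\<not> dominated \<mu> (hook a b)"
    show "coeff_sf (hook_J a b) (monomial_of \<mu>) = 0"
    proof (cases "sum_list \<mu> = a + b")
      case True
      then have "length \<mu> \<le> a"
        using dominated_hook[OF \<mu>(1) True assms] \<mu>(2) by linarith
      moreover have "card (set_mset (monomial_of \<mu>)) \<le> card {..<length \<mu>}"
        by (intro card_mono) (auto simp: set_monomial_of)
      ultimately show ?thesis
        using coeff_hook_J_zero[OF assms] by simp
    next
      case False
      then show ?thesis
        using homogeneous_hook_J[of a b] by (simp add: homogeneous_def)
    qed
  next
    fix \<mu> assume "\<mu> \<in> below (hook a b)"
    then show "weighted_form qt_weight (hook_J a b) (macdonald_P \<mu>) = 0"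
      using assms below_hook[OF assms] by (intro hook_J_orthogonal) (auto simp: below_def)
  qed (rule is_partition_hook[OF assms])
  then show ?thesis
    unfolding macdonald_J_def macdonald_c_hook[OF assms] coeff_hook_J_hook[OF assms] by simp
qed

section \<open>Schur functions and the Hall scalar product\<close>

abbreviation hall :: "qt symfun \<Rightarrow> qt symfun \<Rightarrow> qt" where
  "hall \<equiv> weighted_form (\<lambda>k. 1)"

lemma hall_h_adj: "hall (h_adj n f) g = hall f (sf_h n * g)"
  using weighted_form_h_adj[of "\<lambda>k. 1" n f g] by (simp add: sf_h_eq_pexp)

definition jacobi_trudi :: "nat list \<Rightarrow> 'a::comm_ring_1 symfun mat" where
  "jacobi_trudi \<nu> = mat (length \<nu>) (length \<nu>)
     (\<lambda>(i, j). if i \<le> \<nu> ! i + j then sf_h (\<nu> ! i + j - i) else 0)"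

lemma schur_eq_det: "schur \<nu> = det (jacobi_trudi \<nu>)"
  by (simp add: schur_def jacobi_trudi_def)

lemma jacobi_trudi_carrier: "jacobi_trudi \<nu> \<in> carrier_mat (length \<nu>) (length \<nu>)"
  by (simp add: jacobi_trudi_def)

lemma schur_Nil: "schur [] = 1"
  by (simp add: schur_def)

lemma mat_delete_jacobi_trudi: "mat_delete (jacobi_trudi (k # \<nu>)) 0 0 = jacobi_trudi \<nu>"
  by (rule eq_matI) (auto simp: jacobi_trudi_def mat_delete_def)

text \<open>Expansion along the first row gives h_{k+j} times a minor, and the adjoint
  \<open>h_adj (k + j)\<close> kills f unless j = 0.\<close>

lemma hall_schur_Cons:
  assumes "\<And>m. m > k \<Longrightarrow> h_adj m f = 0"
  shows "hall (schur (k # \<nu>)) f = hall (schur \<nu>) (h_adj k f)"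
proof -
  let ?M = "jacobi_trudi (k # \<nu>) :: qt symfun mat"
  have "schur (k # \<nu>) = (\<Sum>j<Suc (length \<nu>). ?M $$ (0, j) * cofactor ?M 0 j)"
    unfolding schur_eq_det using jacobi_trudi_carrier[of "k # \<nu>"]
    by (intro laplace_expansion_row) simp_all
  also have "\<dots> = (\<Sum>j<Suc (length \<nu>). sf_h (k + j) * cofactor ?M 0 j)"
    by (intro sum.cong refl) (simp add: jacobi_trudi_def)
  finally have "hall (schur (k # \<nu>)) f = (\<Sum>j<Suc (length \<nu>). hall f (sf_h (k + j) * cofactor ?M 0 j))"
    by (simp add: weighted_form_commute[of _ _ f] weighted_form_linear)
  also have "\<dots> = (\<Sum>j<Suc (length \<nu>). hall (h_adj (k + j) f) (cofactor ?M 0 j))"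
    by (simp only: hall_h_adj)
  also have "\<dots> = (\<Sum>j<Suc (length \<nu>). if j = 0 then hall (h_adj k f) (cofactor ?M 0 0) else 0)"
    by (intro sum.cong refl) (auto simp: assms weighted_form_linear)
  also have "\<dots> = hall (h_adj k f) (schur \<nu>)"
    by (simp add: cofactor_def mat_delete_jacobi_trudi schur_eq_det)
  finally show ?thesis
    by (simp only: weighted_form_commute)
qed

text \<open>This is f(y, x_0, x_1, ...) as a series in y, hence a ring homomorphism, which can be
  applied entrywise inside the Jacobi--Trudi determinant.\<close>

definition h_adj_series :: "'a::comm_ring_1 symfun \<Rightarrow> 'a symfun fps" where
  "h_adj_series f = Abs_fps (\<lambda>k. h_adj k f)"

interpretation h_adj_series: comm_ring_hom h_adj_series
  by unfold_locales
    (auto simp: h_adj_series_def fps_eq_iff fps_mult_nth h_adj_add h_adj_mult h_adj_one atLeast0AtMost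
      intro!: symfun_eqI simp: coeff_h_adj coeff_sf_simps)

interpretation fps_const: comm_ring_hom fps_const
  by unfold_locales simp_all

lemma h_adj_series_sf_h_Suc:
  "h_adj_series (sf_h (Suc n)) - fps_X * h_adj_series (sf_h n) = fps_const (sf_h (Suc n))"
proof (rule fps_ext)
  fix k
  show "fps_nth (h_adj_series (sf_h (Suc n)) - fps_X * h_adj_series (sf_h n)) k = fps_nth (fps_const (sf_h (Suc n))) k"
    by (cases k) (auto simp: h_adj_series_def h_adj_sf_h)
qed

text \<open>Since \<open>h_adj_series h\<^sub>n - z h_adj_series h\<^sub>n\<^sub>-\<^sub>1 = h\<^sub>n\<close>, column operations remove \<open>z\<close> from all
  columns of the Jacobi--Trudi determinant of \<open>h_adj_series (schur \<nu>)\<close> but the first.\<close>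

lemma h_adj_series_schur:
  fixes \<nu> :: "nat list"
  obtains c :: "nat \<Rightarrow> 'a::comm_ring_1 symfun" where "h_adj_series (schur \<nu>) =
      (\<Sum>i<length \<nu>. h_adj_series (if i \<le> \<nu> ! i then sf_h (\<nu> ! i - i) else 0) * fps_const (c i))"
    "\<nu> \<noteq> [] \<Longrightarrow> c 0 = schur (tl \<nu>)" | "\<nu> = []"
proof (cases "\<nu> = []")
  case False
  define l where "l = length \<nu>"
  let ?M = "jacobi_trudi \<nu> :: 'a symfun mat"
  \<comment> \<open>Right multiplication by \<open>U\<close> subtracts z times the preceding column
    from every column but the first.\<close>
  define U where "U = mat l l (\<lambda>(k, j). if k = j then 1 else if Suc k = j then - fps_X else 0 :: 'a symfun fps)"
  define N where "N = map_mat h_adj_series ?M * U"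
  define D where "D i = mat_delete ?M i 0" for i
  have "l > 0"
    using False by (simp add: l_def)
  have "?M \<in> carrier_mat l l" "U \<in> carrier_mat l l"
    using jacobi_trudi_carrier[of \<nu>] by (simp_all add: l_def U_def)
  moreover from this have "N \<in> carrier_mat l l"
    unfolding N_def by (intro mult_carrier_mat[of _ l l]) simp_all
  ultimately have carrier: "?M \<in> carrier_mat l l" "U \<in> carrier_mat l l" "N \<in> carrier_mat l l" .
  have "det U = prod_list (diag_mat U)"
    by (rule det_upper_triangular[OF _ carrier(2)]) (auto simp: U_def upper_triangular_def)
  also have "diag_mat U = replicate l 1"
    by (rule nth_equalityI) (auto simp: diag_mat_def U_def)
  also have "prod_list (replicate l 1) = (1 :: 'a symfun fps)"
    by simp
  finally have "det N = h_adj_series (schur \<nu>)"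
    unfolding N_def using carrier by (subst det_mult[of _ l]) (auto simp: schur_eq_det)
  moreover have N: "N $$ (i, j) = (if j = 0 then h_adj_series (?M $$ (i, 0)) else fps_const (?M $$ (i, j)))"
    if "i < l" "j < l" for i j
  proof -
    let ?m = "\<lambda>k. h_adj_series (?M $$ (i, k))"
    have "N $$ (i, j) = (\<Sum>k = 0..<l. ?m k * (if k = j then 1 else if Suc k = j then - fps_X else 0))"
    proof -
      have "dim_row ?M = l" "dim_col ?M = l" "dim_row U = l" "dim_col U = l"
        using carrier by auto
      then have "N $$ (i, j) = (\<Sum>k = 0..<l. ?m k * U $$ (k, j))"
        using that unfolding N_def by (subst index_mult_mat(1)) (simp_all add: scalar_prod_def)
      also have "\<dots> = (\<Sum>k = 0..<l. ?m k * (if k = j then 1 else if Suc k = j then - fps_X else 0))"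
        by (intro sum.cong refl) (use that in \<open>simp add: U_def\<close>)
      finally show ?thesis .
    qed
    also have "\<dots> = (\<Sum>k = 0..<l. (if k = j then ?m j else 0) + (if Suc k = j then - (fps_X * ?m (j - 1)) else 0))"
      by (intro sum.cong refl) auto
    also have "\<dots> = ?m j + (\<Sum>k = 0..<l. if Suc k = j then - (fps_X * ?m (j - 1)) else 0)"
      using that by (simp add: sum.distrib)
    also have "(\<Sum>k = 0..<l. if Suc k = j then - (fps_X * ?m (j - 1)) else 0) = (if j = 0 then 0 else - (fps_X * ?m (j - 1)))"
      using that by (cases j) auto
    finally have eq: "N $$ (i, j) = ?m j + (if j = 0 then 0 else - (fps_X * ?m (j - 1)))" .
    show ?thesis
    proof (cases j)
      case (Suc j')
      have "?m (Suc j') - fps_X * ?m j' = fps_const (?M $$ (i, Suc j'))"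
      proof (cases "i \<le> \<nu> ! i + j'")
        case True
        then show ?thesis
          using that Suc h_adj_series_sf_h_Suc[of "\<nu> ! i + j' - i", where 'a='a]
          by (simp add: jacobi_trudi_def l_def Suc_diff_le)
      next
        \<comment> \<open>At the boundary i = \<nu>_i + j' + 1 the entry is h_0 = 1 and its left
          neighbour is 0, so the difference is still constant; beyond it both are 0.\<close>
        case False
        then show ?thesis
          using that Suc by (auto simp: jacobi_trudi_def l_def sf_h_zero)
      qed
      then show ?thesis
        using eq Suc by simp
    qed (use eq in simp)
  qed
  have "cofactor N i 0 = fps_const ((- 1) ^ i * det (D i))" if "i < l" for i
  proof -
    have "mat_delete N i 0 = map_mat fps_const (D i)"
      using carrier that by (intro eq_matI) (auto simp: mat_delete_def D_def N)
    moreover have "(- 1) ^ i = (fps_const ((- 1) ^ i) :: 'a symfun fps)"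
      by (induction i) simp_all
    ultimately show ?thesis
      by (simp add: cofactor_def)
  qed
  moreover have "det N = (\<Sum>i<l. N $$ (i, 0) * cofactor N i 0)"
    by (rule laplace_expansion_column[OF carrier(3) \<open>l > 0\<close>])
  ultimately have "h_adj_series (schur \<nu>) = (\<Sum>i<l. h_adj_series (?M $$ (i, 0)) * fps_const ((- 1) ^ i * det (D i)))"
    using N \<open>l > 0\<close> by simp
  moreover have "?M $$ (i, 0) = (if i \<le> \<nu> ! i then sf_h (\<nu> ! i - i) else 0)" if "i < l" for i
    using that \<open>l > 0\<close> by (simp add: jacobi_trudi_def l_def)
  moreover have "D 0 = jacobi_trudi (tl \<nu>)"
    using False mat_delete_jacobi_trudi[of "hd \<nu>" "tl \<nu>", where 'a='a] by (simp add: D_def)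
  ultimately show ?thesis
    using that(1)[of "\<lambda>i. (- 1) ^ i * det (D i)"] by (simp add: l_def schur_eq_det)
qed simp

lemma is_partition_Cons: "is_partition (k # \<nu>) \<longleftrightarrow> k > 0 \<and> (\<forall>x\<in>set \<nu>. x \<le> k) \<and> is_partition \<nu>"
  by (auto simp: is_partition_def partitions_def)

text \<open>Only the first column depends on y, and its entries h_{\<nu>_i - i} have degree at most
  k, with equality only for i = 0.\<close>

lemma h_adj_schur:
  assumes "is_partition (k # \<nu>)"
  shows "m > k \<Longrightarrow> h_adj m (schur (k # \<nu>)) = (0 :: 'a::comm_ring_1 symfun)"
    and "h_adj k (schur (k # \<nu>)) = (schur \<nu> :: 'a symfun)"
proof -
  obtain c where c: "h_adj_series (schur (k # \<nu>)) = (\<Sum>i<length (k # \<nu>).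
      h_adj_series (if i \<le> (k # \<nu>) ! i then sf_h ((k # \<nu>) ! i - i) else 0) * fps_const (c i))"
    and c0: "c 0 = (schur \<nu> :: 'a symfun)"
    by (rule h_adj_series_schur[of "k # \<nu>", where 'a='a]) auto
  have h: "h_adj m (schur (k # \<nu>)) = (\<Sum>i<Suc (length \<nu>). h_adj m (if i \<le> (k # \<nu>) ! i then sf_h ((k # \<nu>) ! i - i) else 0) * c i)" for m
    using arg_cong[OF c, of "\<lambda>F. fps_nth F m"] by (simp add: h_adj_series_def fps_sum_nth)
  have part: "(k # \<nu>) ! i \<le> k" if "i < Suc (length \<nu>)" for i
    using assms that by (cases i) (auto simp: is_partition_Cons)
  have zero: "h_adj m (if i \<le> (k # \<nu>) ! i then sf_h ((k # \<nu>) ! i - i) else 0 :: 'a symfun) = 0"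
    if "i < Suc (length \<nu>)" "m > k \<or> m = k \<and> i > 0" for i m
  proof (cases "i \<le> (k # \<nu>) ! i")
    case True
    then have "(k # \<nu>) ! i - i < m"
      using part[OF that(1)] that(2) by auto
    then show ?thesis
      using True by (simp add: h_adj_sf_h)
  next
    case False
    then show ?thesis
      by (simp only: if_False h_adj_of_0)
  qed
  show "m > k \<Longrightarrow> h_adj m (schur (k # \<nu>)) = (0 :: 'a symfun)"
    unfolding h by (rule sum.neutral) (simp add: zero)
  have "h_adj k (schur (k # \<nu>)) = (\<Sum>i<Suc (length \<nu>). if i = 0 then c 0 else 0)"
    unfolding h
  proof (intro sum.cong refl)
    fix i assume i: "i \<in> {..<Suc (length \<nu>)}"
    show "h_adj k (if i \<le> (k # \<nu>) ! i then sf_h ((k # \<nu>) ! i - i) else 0) * c i = (if i = 0 then c 0 else 0)"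
    proof (cases "i = 0")
      case False
      then have "h_adj k (if i \<le> (k # \<nu>) ! i then sf_h ((k # \<nu>) ! i - i) else 0 :: 'a symfun) = 0"
        using i by (intro zero) auto
      then show ?thesis
        using False by (simp only: mult_zero_left if_False)
    qed (simp add: h_adj_sf_h sf_h_zero)
  qed
  then show "h_adj k (schur (k # \<nu>)) = (schur \<nu> :: 'a symfun)"
    by (simp add: c0)
qed

text \<open>The larger first part is stripped by \<open>hall_schur_Cons\<close>; if the first parts
  differ, \<open>h_adj\<close> of the larger one kills the other function.\<close>

lemma hall_schur:
  assumes "is_partition \<mu>" "is_partition \<nu>"
  shows "hall (schur \<mu>) (schur \<nu>) = (if \<mu> = \<nu> then 1 else 0)"
  using assms
proof (induction \<mu> arbitrary: \<nu>)
  case Nil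
  show ?case
  proof (cases \<nu>)
    case (Cons k \<nu>')
    have "hall (schur (k # \<nu>')) 1 = hall (schur \<nu>') (h_adj k 1)"
      by (rule hall_schur_Cons) (simp add: h_adj_one)
    then show ?thesis
      using Cons Nil.prems by (simp add: schur_Nil h_adj_one is_partition_Cons weighted_form_linear weighted_form_commute[of _ 1])
  qed (simp add: schur_Nil weighted_form_one coeff_sf_simps)
next
  case (Cons j \<mu>)
  show ?case
  proof (cases \<nu>)
    case Nil
    have "hall (schur (j # \<mu>)) 1 = hall (schur \<mu>) (h_adj j 1)"
      by (rule hall_schur_Cons) (simp add: h_adj_one)
    then show ?thesis
      using Nil Cons.prems by (simp add: schur_Nil h_adj_one is_partition_Cons weighted_form_linear)
  next
    case (Cons k \<nu>')
    note \<nu> = Cons.prems(2)[unfolded Cons]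
    show ?thesis
    proof (cases "k \<le> j")
      case True
      then have "hall (schur (j # \<mu>)) (schur \<nu>) = hall (schur \<mu>) (h_adj j (schur \<nu>))"
        unfolding Cons by (intro hall_schur_Cons h_adj_schur(1)[OF \<nu>]) simp
      then show ?thesis
        using True Cons Cons.IH[of \<nu>'] Cons.prems(1) \<nu> h_adj_schur[OF \<nu>, where 'a=qt]
        by (cases "k = j") (auto simp: is_partition_Cons weighted_form_linear)
    next
      case False
      then have "hall (schur \<nu>) (schur (j # \<mu>)) = hall (schur \<nu>') (h_adj k (schur (j # \<mu>)))"
        unfolding Cons by (intro hall_schur_Cons h_adj_schur(1)[OF Cons.prems(1)]) simp
      then show ?thesis
        using False Cons h_adj_schur(1)[OF Cons.prems(1), of k, where 'a=qt]
        by (simp add: weighted_form_linear weighted_form_commute[of _ "schur (j # \<mu>)"])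
    qed
  qed
qed

text \<open>Take the largest i with \<open>h_adj i f\<close> nonzero and continue with that
  function: the indices found form a partition with nonzero pairing. The bound j in the induction
  keeps them weakly decreasing.\<close>

lemma hall_schur_separating:
  assumes "\<And>\<kappa>. is_partition \<kappa> \<Longrightarrow> hall f (schur \<kappa>) = 0"
  shows "f = 0"
proof (rule ccontr)
  assume "f \<noteq> 0"
  have "\<exists>\<kappa>. is_partition \<kappa> \<and> (\<forall>x\<in>set \<kappa>. x \<le> j) \<and> hall (schur \<kappa>) f \<noteq> 0"
    if "degree_le d f" "f \<noteq> 0" "\<And>m. m > j \<Longrightarrow> h_adj m f = 0" for d j f
    using that
  proof (induction d arbitrary: f j rule: less_induct)
    case (less d)
    let ?K = "{k. k > 0 \<and> h_adj k f \<noteq> 0}"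
    have fin: "finite ?K"
      by (rule finite_subset[of _ "{..d}"]) (use degree_le_h_adj_zero[OF less.prems(1)] in \<open>auto simp: not_less[symmetric]\<close>)
    show ?case
    proof (cases "?K = {}")
      case True
      have "h_adj k f = h_adj k 0" if "k > 0" for k
      proof -
        have "k \<notin> ?K"
          using True by blast
        then show ?thesis
          using that by simp
      qed
      then have "coeff_sf f {#} \<noteq> 0"
        using less.prems(2) eq_if_h_adj_eq[of f 0] by (metis coeff_sf_simps(1))
      then show ?thesis
        by (intro exI[of _ "[]"]) (simp add: schur_Nil weighted_form_commute[of _ 1] weighted_form_one is_partition_def partitions_def)
    next
      case False
      define i where "i = Max ?K"
      have i: "i > 0" "h_adj i f \<noteq> 0"
        using Max_in[OF fin False] by (auto simp: i_def)
      have above: "h_adj m f = 0" if "m > i" for m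
        using Max_ge[OF fin, of m] that i(1) by (force simp: i_def)
      have "i \<le> j" "i \<le> d"
        using i(2) less.prems(3) degree_le_h_adj_zero[OF less.prems(1)] by (meson not_le)+
      have "h_adj m (h_adj i f) = 0" if "m > i" for m
        using above[OF that] by (subst h_adj_commute) (simp add: sf_linearD[OF linear_h_adj])
      then obtain \<kappa> where \<kappa>: "is_partition \<kappa>" "\<forall>x\<in>set \<kappa>. x \<le> i" "hall (schur \<kappa>) (h_adj i f) \<noteq> 0"
        using less.IH[of "d - i" "h_adj i f" i] i \<open>i \<le> d\<close> degree_le_h_adj[OF less.prems(1)] by auto
      moreover have "hall (schur (i # \<kappa>)) f = hall (schur \<kappa>) (h_adj i f)"
        by (rule hall_schur_Cons[OF above])
      ultimately show ?thesis
        using i(1) \<open>i \<le> j\<close> by (intro exI[of _ "i # \<kappa>"]) (auto simp: is_partition_Cons)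
    qed
  qed
  moreover obtain d where "degree_le d f"
    using degree_le_exists by blast
  ultimately obtain \<kappa> where "is_partition \<kappa>" "hall (schur \<kappa>) f \<noteq> 0"
    using \<open>f \<noteq> 0\<close> degree_le_h_adj_zero by metis
  then show False
    using assms by (simp add: weighted_form_commute[of _ f])
qed

lemma homogeneous_prod:
  assumes "\<And>x. x \<in> S \<Longrightarrow> homogeneous (d x) (f x)"
  shows "homogeneous (sum d S) (prod f S)"
  using assms
proof (induction S rule: infinite_finite_induct)
  case (insert x S)
  then show ?case
    by (simp add: homogeneous_mult)
qed (simp_all add: homogeneous_one)

text \<open>In each nonzero term of the determinant the degrees \<nu>_i + p i - i add up to the size
  of \<nu>, as p is a permutation.\<close>

lemma homogeneous_schur: "homogeneous (sum_list \<nu>) (schur \<nu>)"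
proof -
  let ?l = "length \<nu>"
  let ?M = "jacobi_trudi \<nu> :: 'a symfun mat"
  have hom: "homogeneous (sum_list \<nu>) (\<Prod>i = 0..<?l. ?M $$ (i, p i))" if p: "p permutes {0..<?l}" for p
  proof (cases "\<forall>i<?l. i \<le> \<nu> ! i + p i")
    case True
    have "homogeneous (\<nu> ! i + p i - i) (?M $$ (i, p i))" if "i \<in> {0..<?l}" for i
      using that True permutes_in_image[OF p, of i]
      by (auto simp: jacobi_trudi_def homogeneous_def sf_h.rep_eq)
    then have "homogeneous (\<Sum>i = 0..<?l. \<nu> ! i + p i - i) (\<Prod>i = 0..<?l. ?M $$ (i, p i))"
      by (rule homogeneous_prod)
    moreover have "(\<Sum>i = 0..<?l. \<nu> ! i + p i - i) + (\<Sum>i = 0..<?l. i) = (\<Sum>i = 0..<?l. \<nu> ! i + p i)"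
      unfolding sum.distrib[symmetric] by (intro sum.cong refl) (use True in auto)
    moreover have "(\<Sum>i = 0..<?l. p i) = (\<Sum>i = 0..<?l. i)"
      using sum.permute[OF p, of "\<lambda>i. i"] by (simp add: comp_def)
    ultimately show ?thesis
      by (simp add: sum.distrib sum_list_sum_nth)
  next
    case False
    then obtain i where i: "i < ?l" "\<not> i \<le> \<nu> ! i + p i" by auto
    then have "?M $$ (i, p i) = 0"
      using permutes_in_image[OF p, of i] by (simp add: jacobi_trudi_def)
    then have "(\<Prod>i = 0..<?l. ?M $$ (i, p i)) = 0"
      using i(1) by (intro prod_zero) auto
    then show ?thesis
      by (simp add: homogeneous_zero)
  qed
  have "homogeneous (sum_list \<nu>) (signof p * (\<Prod>i = 0..<?l. ?M $$ (i, p i)))" if "p permutes {0..<?l}" for p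
    using hom[OF that] by (cases "evenperm p") (simp_all add: sign_def homogeneous_def coeff_sf_simps)
  then show ?thesis
    unfolding schur_eq_det det_def'[OF jacobi_trudi_carrier] by (intro homogeneous_sum) simp
qed

lemma finite_partitions: "finite (partitions n)"
  by (rule finite_subset[OF _ finite_partitions_le[of n]]) (auto simp: partitions_def is_partition_def)

lemma partitions_iff: "\<nu> \<in> partitions n \<longleftrightarrow> is_partition \<nu> \<and> sum_list \<nu> = n"
  by (auto simp: partitions_def is_partition_def)

lemma schur_expansion:
  assumes "homogeneous n f"
  shows "f = (\<Sum>\<kappa>\<in>partitions n. sf_scale (hall f (schur \<kappa>)) (schur \<kappa>))"
proof -
  have "f - (\<Sum>\<kappa>\<in>partitions n. sf_scale (hall f (schur \<kappa>)) (schur \<kappa>)) = 0"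
  proof (rule hall_schur_separating)
    fix \<mu> assume \<mu>: "is_partition \<mu>"
    have "(\<Sum>\<kappa>\<in>partitions n. hall f (schur \<kappa>) * hall (schur \<kappa>) (schur \<mu>)) =
        (\<Sum>\<kappa>\<in>partitions n. if \<kappa> = \<mu> then hall f (schur \<mu>) else 0)"
      by (intro sum.cong refl) (use \<mu> in \<open>auto simp: hall_schur partitions_iff\<close>)
    also have "\<dots> = hall f (schur \<mu>)"
      using weighted_form_homogeneous[OF assms homogeneous_schur[of \<mu>], of "\<lambda>k. 1"] \<mu> finite_partitions
      by (auto simp: partitions_iff)
    finally show "hall (f - (\<Sum>\<kappa>\<in>partitions n. sf_scale (hall f (schur \<kappa>)) (schur \<kappa>))) (schur \<mu>) = 0"
      by (simp add: weighted_form_linear)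
  qed
  then show ?thesis by simp
qed


section \<open>The functions dual to the Schur functions\<close>

text \<open>With the product of the 1 - t^k as \<theta> this is the substitution of X(1 - t) for
  X.\<close>

definition p_scale :: "(nat list \<Rightarrow> qt) \<Rightarrow> qt symfun \<Rightarrow> qt symfun" where
  "p_scale \<theta> f = (\<Sum>\<nu> | p_coeff \<nu> f \<noteq> 0. sf_scale (\<theta> \<nu> * p_coeff \<nu> f) (sf_p_part \<nu>))"

lemma p_coeff_p_scale: "p_coeff \<nu> (p_scale \<theta> f) = \<theta> \<nu> * p_coeff \<nu> f"
proof -
  have "p_coeff \<nu> (p_scale \<theta> f) = (\<Sum>\<mu> | p_coeff \<mu> f \<noteq> 0. if \<mu> = \<nu> then \<theta> \<nu> * p_coeff \<nu> f else 0)"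
    unfolding p_scale_def p_coeff_linear
    by (intro sum.cong refl) (auto simp: p_coeff_sf_p_part[OF is_partition_if_p_coeff])
  then show ?thesis
    using finite_p_coeff[of f] by auto
qed

definition t_weight :: "nat \<Rightarrow> qt" where
  "t_weight k = 1 - t ^ k"

lemma t_weight_nonzero: "k > 0 \<Longrightarrow> t_weight k \<noteq> 0"
  using t_power_neq_one by (simp add: t_weight_def)

lemma t_form_eq: "t_form = weighted_form t_weight"
  by (simp add: t_form_def weighted_form_def t_weight_def)

lemma t_form_diff: "t_form (f - g) h = t_form f h - t_form g h"
  by (simp add: t_form_eq weighted_form_linear)

lemma t_form_p_scale: "t_form (p_scale (\<lambda>\<nu>. prod_list (map t_weight \<nu>)) f) g = hall f g"
proof -
  let ?f = "p_scale (\<lambda>\<nu>. prod_list (map t_weight \<nu>)) f"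
  have inv: "prod_list (map t_weight \<nu>) * prod_list (map (\<lambda>k. inverse (t_weight k)) \<nu>) = 1" if "0 \<notin> set \<nu>" for \<nu>
    using that by (induction \<nu>) (auto simp: t_weight_nonzero mult_ac)
  have one: "prod_list (map (\<lambda>k. 1) \<nu>) = (1 :: qt)" for \<nu> :: "nat list"
    by (induction \<nu>) simp_all
  let ?S = "{\<nu>. p_coeff \<nu> f \<noteq> 0}"
  have "t_form ?f g = (\<Sum>\<nu>\<in>?S. p_coeff \<nu> ?f * p_coeff \<nu> g *
      (of_nat (zee \<nu>) * prod_list (map (\<lambda>k. inverse (t_weight k)) \<nu>)))"
    unfolding t_form_eq weighted_form_def by (rule p_form_eq_sum) (auto simp: finite_p_coeff p_coeff_p_scale)
  also have "\<dots> = (\<Sum>\<nu>\<in>?S. p_coeff \<nu> f * p_coeff \<nu> g * of_nat (zee \<nu>) *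
      (prod_list (map t_weight \<nu>) * prod_list (map (\<lambda>k. inverse (t_weight k)) \<nu>)))"
    by (simp add: p_coeff_p_scale mult_ac)
  also have "\<dots> = (\<Sum>\<nu>\<in>?S. p_coeff \<nu> f * p_coeff \<nu> g * of_nat (zee \<nu>))"
    by (intro sum.cong refl) (auto simp: inv is_partitionD[OF is_partition_if_p_coeff])
  also have "\<dots> = hall f g"
    unfolding weighted_form_def by (subst p_form_eq_sum[of ?S]) (auto simp: finite_p_coeff one)
  finally show ?thesis .
qed

lemma t_form_schur_separating:
  assumes "\<And>\<kappa>. is_partition \<kappa> \<Longrightarrow> t_form f (schur \<kappa>) = 0"
  shows "f = 0"
proof -
  define g where "g = p_scale (\<lambda>\<nu>. inverse (prod_list (map t_weight \<nu>))) f"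
  have f: "f = p_scale (\<lambda>\<nu>. prod_list (map t_weight \<nu>)) g"
  proof (rule symfun_eq_p_coeffI)
    fix \<nu> :: "nat list" assume "is_partition \<nu>"
    then have "prod_list (map t_weight \<nu>) \<noteq> 0"
      using t_weight_nonzero is_partitionD[of \<nu>] by (auto simp: prod_list_zero_iff) (metis gr0I)
    then show "p_coeff \<nu> f = p_coeff \<nu> (p_scale (\<lambda>\<nu>. prod_list (map t_weight \<nu>)) g)"
      by (simp add: p_coeff_p_scale g_def)
  qed
  have "g = 0"
    using assms unfolding f t_form_p_scale by (intro hall_schur_separating) simp
  then show ?thesis
    unfolding f by (simp add: p_scale_def p_coeff_linear)
qed

text \<open>Existence: s_\<mu>[X(1 - t)] works, since \<open>t_form_p_scale\<close> turns the form
  into the Hall form. Uniqueness is \<open>t_form_schur_separating\<close>.\<close>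

lemma t_form_big_schur:
  assumes "is_partition \<mu>" "is_partition \<nu>"
  shows "t_form (big_schur \<mu>) (schur \<nu>) = (if \<nu> = \<mu> then 1 else 0)"
proof -
  have "\<exists>!f. \<forall>\<nu>. is_partition \<nu> \<longrightarrow> t_form f (schur \<nu>) = (if \<nu> = \<mu> then 1 else 0)"
  proof (rule ex_ex1I)
    show "\<exists>f. \<forall>\<nu>. is_partition \<nu> \<longrightarrow> t_form f (schur \<nu>) = (if \<nu> = \<mu> then 1 else 0)"
      using assms(1) hall_schur
      by (intro exI[of _ "p_scale (\<lambda>\<nu>. prod_list (map t_weight \<nu>)) (schur \<mu>)"]) (auto simp: t_form_p_scale)
    fix f g
    assume "\<forall>\<nu>. is_partition \<nu> \<longrightarrow> t_form f (schur \<nu>) = (if \<nu> = \<mu> then 1 else 0)"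
      "\<forall>\<nu>. is_partition \<nu> \<longrightarrow> t_form g (schur \<nu>) = (if \<nu> = \<mu> then 1 else 0)"
    then have "f - g = 0"
      by (intro t_form_schur_separating) (simp add: t_form_eq weighted_form_linear)
    then show "f = g" by simp
  qed
  from theI'[OF this] show ?thesis
    using assms(2) by (simp add: big_schur_def)
qed

lemma t_form_sum_big_schur:
  assumes "is_partition \<nu>"
  shows "t_form (\<Sum>\<kappa>\<in>partitions n. sf_scale (K \<kappa>) (big_schur \<kappa>)) (schur \<nu>) = (if \<nu> \<in> partitions n then K \<nu> else 0)"
proof -
  have "t_form (\<Sum>\<kappa>\<in>partitions n. sf_scale (K \<kappa>) (big_schur \<kappa>)) (schur \<nu>) =
      (\<Sum>\<kappa>\<in>partitions n. if \<kappa> = \<nu> then K \<nu> else 0)"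
    unfolding t_form_eq weighted_form_linear
    by (intro sum.cong refl) (use assms in \<open>auto simp: t_form_big_schur partitions_iff simp flip: t_form_eq\<close>)
  then show ?thesis
    using finite_partitions by simp
qed

lemma kostka_eq:
  assumes "homogeneous (sum_list \<nu>) (macdonald_J \<nu>)" "\<mu> \<in> partitions (sum_list \<nu>)"
  shows "kostka \<mu> \<nu> = t_form (macdonald_J \<nu>) (schur \<mu>)"
proof -
  let ?n = "sum_list \<nu>"
  let ?K = "\<lambda>\<kappa>. if \<kappa> \<in> partitions ?n then t_form (macdonald_J \<nu>) (schur \<kappa>) else 0"
  have "(THE K. (\<forall>\<kappa>. \<kappa> \<notin> partitions ?n \<longrightarrow> K \<kappa> = 0) \<and>
      macdonald_J \<nu> = (\<Sum>\<kappa>\<in>partitions ?n. sf_scale (K \<kappa>) (big_schur \<kappa>))) = ?K"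
  proof (rule the_equality)
    have "macdonald_J \<nu> - (\<Sum>\<kappa>\<in>partitions ?n. sf_scale (?K \<kappa>) (big_schur \<kappa>)) = 0"
    proof (rule t_form_schur_separating)
      fix \<kappa> assume \<kappa>: "is_partition \<kappa>"
      have "t_form (macdonald_J \<nu>) (schur \<kappa>) = ?K \<kappa>"
        using weighted_form_homogeneous[OF assms(1) homogeneous_schur[of \<kappa>]] \<kappa>
        by (auto simp: t_form_eq partitions_iff)
      then show "t_form (macdonald_J \<nu> - (\<Sum>\<kappa>\<in>partitions ?n. sf_scale (?K \<kappa>) (big_schur \<kappa>))) (schur \<kappa>) = 0"
        using t_form_sum_big_schur[OF \<kappa>, of ?K ?n] by (simp only: t_form_diff diff_self split: if_splits)
    qed
    then show "(\<forall>\<kappa>. \<kappa> \<notin> partitions ?n \<longrightarrow> ?K \<kappa> = 0) \<and>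
        macdonald_J \<nu> = (\<Sum>\<kappa>\<in>partitions ?n. sf_scale (?K \<kappa>) (big_schur \<kappa>))"
      by simp
  next
    fix K
    assume K: "(\<forall>\<kappa>. \<kappa> \<notin> partitions ?n \<longrightarrow> K \<kappa> = 0) \<and>
      macdonald_J \<nu> = (\<Sum>\<kappa>\<in>partitions ?n. sf_scale (K \<kappa>) (big_schur \<kappa>))"
    then show "K = ?K"
      using t_form_sum_big_schur[of _ K ?n] by (auto simp: fun_eq_iff partitions_iff)
  qed
  then show ?thesis
    using assms(2) by (simp add: kostka_def)
qed

text \<open>By duality K_{\<mu>\<nu>} is the pairing of J_\<nu> with s_\<mu>, and f has the same
  pairings for the Hall form, in which the s_\<mu> are orthonormal. The last hypothesis thus
  expresses that f is J_\<nu> with X replaced by X/(1 - t).\<close>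

lemma macdonald_H_eqI:
  assumes "homogeneous (sum_list \<nu>) (macdonald_J \<nu>)" "homogeneous (sum_list \<nu>) f"
    "\<And>g. t_form (macdonald_J \<nu>) g = hall f g"
  shows "macdonald_H \<nu> = f"
proof -
  have "macdonald_H \<nu> = (\<Sum>\<mu>\<in>partitions (sum_list \<nu>). sf_scale (hall f (schur \<mu>)) (schur \<mu>))"
    unfolding macdonald_H_def by (intro sum.cong refl) (simp add: kostka_eq[OF assms(1)] assms(3))
  also have "\<dots> = f"
    by (rule schur_expansion[OF assms(2), symmetric])
  finally show ?thesis .
qed

section \<open>Compositions and descent sets\<close>

lemma descents_simps [simp]:
  "descents [] = {}"
  "descents (k # \<alpha>) = (if \<alpha> = [] then {} else insert k ((+) k ` descents \<alpha>))"
proof -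
  show "descents (k # \<alpha>) = (if \<alpha> = [] then {} else insert k ((+) k ` descents \<alpha>))"
  proof (cases "\<alpha> = []")
    case False
    have "descents (k # \<alpha>) = (\<lambda>i. sum_list (take i (k # \<alpha>))) ` {1..<Suc (length \<alpha>)}"
      by (auto simp: descents_def)
    also have "{1..<Suc (length \<alpha>)} = Suc ` {..<length \<alpha>}"
      by (simp add: image_Suc_lessThan atLeastLessThanSuc_atLeastAtMost)
    also have "(\<lambda>i. sum_list (take i (k # \<alpha>))) ` Suc ` {..<length \<alpha>} =
        (\<lambda>i. k + sum_list (take i \<alpha>)) ` {..<length \<alpha>}"
      by (simp add: image_image)
    also have "{..<length \<alpha>} = insert 0 {1..<length \<alpha>}"
      using False by auto
    also have "(\<lambda>i. k + sum_list (take i \<alpha>)) ` insert 0 {1..<length \<alpha>} = insert k ((+) k ` descents \<alpha>)"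
      by (auto simp: descents_def image_iff)
    finally show ?thesis
      using False by simp
  qed (auto simp: descents_def)
qed (simp add: descents_def)

lemma Cons_in_compositions: "k # \<alpha> \<in> compositions n \<longleftrightarrow> 0 < k \<and> k \<le> n \<and> \<alpha> \<in> compositions (n - k)"
  by (auto simp: compositions_def)

lemma compositions_eq_Nil_iff: "\<alpha> \<in> compositions n \<Longrightarrow> \<alpha> = [] \<longleftrightarrow> n = 0"
  by (cases \<alpha>) (auto simp: compositions_def)

lemma compositions_0: "compositions 0 = {[]}"
  using compositions_eq_Nil_iff[of _ 0] by (auto simp: compositions_def)

lemma finite_compositions: "finite (compositions n)"
proof (rule finite_subset)
  show "compositions n \<subseteq> {\<alpha>. set \<alpha> \<subseteq> {..n} \<and> length \<alpha> \<le> n}"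
    unfolding compositions_def using length_le_sum_list member_le_sum_list by blast
qed (rule finite_lists_length_le, simp)

lemma descents_subset: "\<alpha> \<in> compositions n \<Longrightarrow> descents \<alpha> \<subseteq> {1..<n}"
proof (induction \<alpha> arbitrary: n)
  case (Cons k \<alpha>)
  then have "descents \<alpha> \<subseteq> {1..<n - k}" "0 < k" "k \<le> n"
    by (auto simp: Cons_in_compositions)
  moreover have "\<alpha> = [] \<longleftrightarrow> n - k = 0"
    using Cons.prems by (intro compositions_eq_Nil_iff) (simp add: Cons_in_compositions)
  ultimately show ?case
    by force
qed simp

lemma card_descents: "\<alpha> \<in> compositions n \<Longrightarrow> n > 0 \<Longrightarrow> Suc (card (descents \<alpha>)) = length \<alpha>"
proof (induction \<alpha> arbitrary: n)
  case (Cons k \<alpha>)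
  show ?case
  proof (cases "\<alpha> = []")
    case False
    then have \<alpha>: "\<alpha> \<in> compositions (n - k)" "n - k > 0"
      using Cons.prems by (auto simp: Cons_in_compositions compositions_eq_Nil_iff)
    then have "finite (descents \<alpha>)" "k \<notin> (+) k ` descents \<alpha>"
      using descents_subset[OF \<alpha>(1)] finite_subset by fastforce+
    then show ?thesis
      using Cons.IH[OF \<alpha>] False by (simp add: card_image)
  qed simp
qed (simp add: compositions_def)

lemma descents_inject:
  "\<alpha> \<in> compositions n \<Longrightarrow> \<beta> \<in> compositions n \<Longrightarrow> descents \<alpha> = descents \<beta> \<Longrightarrow> \<alpha> = \<beta>"
proof (induction \<alpha> arbitrary: \<beta> n)
  case Nil
  then show ?case
    using compositions_eq_Nil_iff by blast
next
  case (Cons k \<alpha>)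
  obtain l \<beta>' where \<beta>: "\<beta> = l # \<beta>'"
    using Cons.prems compositions_eq_Nil_iff by (cases \<beta>) blast+
  show ?case
  proof (cases "\<alpha> = [] \<or> \<beta>' = []")
    case True
    then have "\<alpha> = []" "\<beta>' = []"
      using Cons.prems(3) \<beta> by (auto split: if_splits)
    then show ?thesis
      using Cons.prems(1,2) \<beta> by (simp add: compositions_def)
  next
    case False
    then have D: "insert k ((+) k ` descents \<alpha>) = insert l ((+) l ` descents \<beta>')"
      using Cons.prems(3) \<beta> by simp
    have "k \<in> insert l ((+) l ` descents \<beta>')" "l \<in> insert k ((+) k ` descents \<alpha>)"
      unfolding D[symmetric] using D by auto
    then have "k = l"
      by auto
    have "k \<notin> (+) k ` descents \<alpha>" "k \<notin> (+) k ` descents \<beta>'"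
      using Cons.prems(1,2) descents_subset \<beta> by (fastforce simp: Cons_in_compositions)+
    then have "(+) k ` descents \<alpha> = (+) k ` descents \<beta>'"
      using D \<open>k = l\<close> by (metis insert_ident)
    then have "descents \<alpha> = descents \<beta>'"
      by (simp add: inj_image_eq_iff)
    then show ?thesis
      using Cons \<open>k = l\<close> \<beta> by (auto simp: Cons_in_compositions)
  qed
qed

lemma descents_surj: "D \<subseteq> {1..<n} \<Longrightarrow> \<exists>\<alpha>\<in>compositions n. descents \<alpha> = D"
proof (induction n arbitrary: D rule: less_induct)
  case (less n)
  show ?case
  proof (cases "D = {}")
    case True
    then show ?thesis
      by (intro bexI[of _ "if n = 0 then [] else [n]"]) (auto simp: compositions_def)
  next
    case False
    have fin: "finite D"
      using less.prems by (rule finite_subset) simp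
    define k where "k = Min D"
    have k: "k \<in> D" "\<And>i. i \<in> D \<Longrightarrow> k \<le> i"
      using fin False by (auto simp: k_def)
    then have "0 < k" "k < n"
      using less.prems by auto
    moreover have "(\<lambda>i. i - k) ` (D - {k}) \<subseteq> {1..<n - k}"
      using k less.prems by (force simp: le_neq_implies_less)
    ultimately obtain \<alpha> where \<alpha>: "\<alpha> \<in> compositions (n - k)" "descents \<alpha> = (\<lambda>i. i - k) ` (D - {k})"
      using less.IH[of "n - k" "(\<lambda>i. i - k) ` (D - {k})"] by auto
    have "(+) k ` descents \<alpha> = D - {k}"
      unfolding \<alpha>(2) image_image using k by (force simp: image_iff)
    moreover have "\<alpha> \<noteq> []"
      using compositions_eq_Nil_iff[OF \<alpha>(1)] \<open>k < n\<close> by simp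
    ultimately have "descents (k # \<alpha>) = D"
      using k(1) by auto
    then show ?thesis
      using \<alpha>(1) \<open>0 < k\<close> \<open>k < n\<close> by (intro bexI[of _ "k # \<alpha>"]) (auto simp: Cons_in_compositions)
  qed
qed

lemma complement:
  assumes "\<beta> \<in> compositions n"
  shows "complement \<beta> \<in> compositions n" "descents (complement \<beta>) = {1..<n} - descents \<beta>"
proof -
  have n: "sum_list \<beta> = n"
    using assms by (simp add: compositions_def)
  obtain \<gamma> where "\<gamma> \<in> compositions n" "descents \<gamma> = {1..<n} - descents \<beta>"
    using descents_surj[of "{1..<n} - descents \<beta>" n] by blast
  then have "\<exists>!\<gamma>. \<gamma> \<in> compositions n \<and> descents \<gamma> = {1..<n} - descents \<beta>"
    using descents_inject by (metis (no_types, lifting))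
  from theI'[OF this] show "complement \<beta> \<in> compositions n" "descents (complement \<beta>) = {1..<n} - descents \<beta>"
    by (simp_all add: complement_def n)
qed

lemma descents_rev:
  assumes "\<beta> \<in> compositions n"
  shows "descents (rev \<beta>) = (\<lambda>i. n - i) ` descents \<beta>"
proof -
  let ?l = "length \<beta>"
  have take: "sum_list (take k (rev \<beta>)) = n - sum_list (take (?l - k) \<beta>)" for k
    using sum_list_take_drop[of "?l - k" \<beta>] assms by (simp add: take_rev compositions_def sum_list_rev)
  have "descents (rev \<beta>) = (\<lambda>k. n - sum_list (take (?l - k) \<beta>)) ` {1..<?l}"
    by (auto simp: descents_def take)
  also have "\<dots> = (\<lambda>k. n - sum_list (take k \<beta>)) ` ((\<lambda>k. ?l - k) ` {1..<?l})"
    by (simp add: image_image)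
  also have "(\<lambda>k. ?l - k) ` {1..<?l} = {1..<?l}"
  proof (intro equalityI subsetI)
    fix k assume "k \<in> {1..<?l}"
    then show "k \<in> (\<lambda>k. ?l - k) ` {1..<?l}"
      by (intro image_eqI[of _ _ "?l - k"]) auto
  qed auto
  also have "(\<lambda>k. n - sum_list (take k \<beta>)) ` {1..<?l} = (\<lambda>i. n - i) ` descents \<beta>"
  proof -
    have "descents \<beta> = (\<lambda>k. sum_list (take k \<beta>)) ` {1..<?l}"
      by (auto simp: descents_def)
    then show ?thesis
      by (simp add: image_image)
  qed
  finally show ?thesis .
qed

lemma descents_hook_composition: "descents (replicate a 1 @ [b]) = {1..a}"
proof (induction a)
  case (Suc a)
  have "insert (1 :: nat) ((+) 1 ` {1..a}) = {1..Suc a}"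
    by (auto simp: image_iff)
  then show ?case
    using Suc by simp
qed simp


section \<open>Commutative images of noncommutative symmetric functions\<close>

lemma chi_0: "chi 0 = 0"
  by (simp add: chi_def)

lemma chi_sum: "chi (sum f S) = (\<Sum>x\<in>S. chi (f x))"
  by (induction S rule: infinite_finite_induct) (simp_all add: chi_0 chi_add)

lemma chi_minus_one_power: "chi ((- 1) ^ n) = (- 1) ^ n"
proof -
  have "chi (- 1) + chi 1 = 0"
    by (simp add: chi_0 flip: chi_add)
  then have "chi (- 1) = - 1"
    by (simp add: chi_one eq_neg_iff_add_eq_0)
  then show ?thesis
    by (induction n) (simp_all only: power_0 power_Suc chi_mult chi_one)
qed

abbreviation sf_h_comp :: "nat list \<Rightarrow> qt symfun" where
  "sf_h_comp \<equiv> pexp_list (\<lambda>k. 1)"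

lemma chi_nc_h_comp: "chi (nc_h_comp \<alpha>) = sf_h_comp \<alpha>"
  by (induction \<alpha>) (simp_all add: nc_h_comp_def chi_one chi_mult chi_nc_h sf_h_eq_pexp)

lemma chi_ribbon:
  assumes "\<beta> \<in> compositions n" "n > 0"
  shows "chi (ribbon \<beta>) = (\<Sum>\<gamma> | \<gamma> \<in> compositions n \<and> descents \<gamma> \<subseteq> descents \<beta>.
    sf_scale ((- 1) ^ card (descents \<beta> - descents \<gamma>)) (sf_h_comp \<gamma>))"
proof -
  have sign: "(- 1) ^ n * f = sf_scale ((- 1) ^ n) f" for n and f :: "qt symfun"
    by (induction n) (simp_all add: mult_sf_scale_left sf.scale_minus_left)
  have "length \<beta> - length \<gamma> = card (descents \<beta> - descents \<gamma>)"
    if "\<gamma> \<in> compositions n" "descents \<gamma> \<subseteq> descents \<beta>" for \<gamma>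
  proof -
    have "finite (descents \<gamma>)"
      using descents_subset[OF that(1)] finite_subset by blast
    then show ?thesis
      using card_descents[OF assms] card_descents[OF that(1) assms(2)] that(2) by (simp add: card_Diff_subset)
  qed
  moreover have "coarsenings \<beta> = {\<gamma>. \<gamma> \<in> compositions n \<and> descents \<gamma> \<subseteq> descents \<beta>}"
    using assms(1) by (auto simp: coarsenings_def compositions_def)
  ultimately show ?thesis
    by (simp add: ribbon_def chi_sum chi_mult chi_minus_one_power chi_nc_h_comp sign)
qed

text \<open>The coefficient of h_\<gamma> is a signed sum over all E containing D =
  \<open>descents \<gamma>\<close>. It factors over the points: outside D a point gives x i if left
  out of E and - y i if included.\<close>

lemma sum_ribbons:
  fixes x y :: "nat \<Rightarrow> qt"
  assumes "n > 0"
  shows "(\<Sum>\<beta>\<in>compositions n. sf_scale (\<Prod>i\<in>{1..<n}. if i \<in> descents \<beta> then y i else x i) (chi (ribbon \<beta>))) =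
    (\<Sum>\<gamma>\<in>compositions n. sf_scale (\<Prod>i\<in>{1..<n}. if i \<in> descents \<gamma> then y i else x i - y i) (sf_h_comp \<gamma>))"
proof -
  let ?I = "{1..<n}"
  let ?w = "\<lambda>D. \<Prod>i\<in>?I. if i \<in> D then y i else x i"
  have inner: "(\<Sum>\<beta> | \<beta> \<in> compositions n \<and> D \<subseteq> descents \<beta>. ?w (descents \<beta>) * (- 1) ^ card (descents \<beta> - D)) =
      (\<Prod>i\<in>?I. if i \<in> D then y i else x i - y i)" if D: "D \<subseteq> ?I" for D
  proof -
    have "bij_betw descents {\<beta>. \<beta> \<in> compositions n \<and> D \<subseteq> descents \<beta>} {E. E \<subseteq> ?I \<and> D \<subseteq> E}"
    proof (rule bij_betw_imageI)
      show "inj_on descents {\<beta>. \<beta> \<in> compositions n \<and> D \<subseteq> descents \<beta>}"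
        by (rule inj_onI) (auto dest: descents_inject)
      show "descents ` {\<beta>. \<beta> \<in> compositions n \<and> D \<subseteq> descents \<beta>} = {E. E \<subseteq> ?I \<and> D \<subseteq> E}"
        using descents_subset descents_surj[of _ n] by (intro equalityI subsetI; blast)
    qed
    then have "(\<Sum>\<beta> | \<beta> \<in> compositions n \<and> D \<subseteq> descents \<beta>. ?w (descents \<beta>) * (- 1) ^ card (descents \<beta> - D)) =
        (\<Sum>E | E \<subseteq> ?I \<and> D \<subseteq> E. ?w E * (- 1) ^ card (E - D))"
      by (rule sum.reindex_bij_betw)
    also have "\<dots> = (\<Sum>X\<in>Pow (?I - D). (\<Prod>i\<in>D. y i) * ((\<Prod>i\<in>X. - y i) * (\<Prod>i\<in>(?I - D) - X. x i)))"
    proof (rule sum.reindex_bij_witness[of _ "\<lambda>X. D \<union> X" "\<lambda>E. E - D"])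
      fix E assume E: "E \<in> {E. E \<subseteq> ?I \<and> D \<subseteq> E}"
      then have fin: "finite E" "finite D"
        using D finite_subset[of _ ?I] by auto
      have "?w E = (\<Prod>i\<in>E. y i) * (\<Prod>i\<in>?I - E. x i)"
        using E by (subst prod.If_cases) (auto simp: Int_absorb1 Diff_eq intro!: arg_cong2[where f = "(*)"] prod.cong)
      also have "(\<Prod>i\<in>E. y i) = (\<Prod>i\<in>D. y i) * (\<Prod>i\<in>E - D. y i)"
        using E fin by (subst prod.subset_diff[of D E]) (auto simp: mult.commute)
      finally show "(\<Prod>i\<in>D. y i) * ((\<Prod>i\<in>E - D. - y i) * (\<Prod>i\<in>(?I - D) - (E - D). x i)) =
          ?w E * (- 1) ^ card (E - D)"
      proof -
        have "(?I - D) - (E - D) = ?I - E"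
          using E by blast
        then show ?thesis
          using \<open>?w E = _\<close> \<open>(\<Prod>i\<in>E. y i) = _\<close> by (simp add: prod_uminus mult_ac)
      qed
    qed (use D in auto)
    also have "\<dots> = (\<Prod>i\<in>D. y i) * (\<Prod>i\<in>?I - D. - y i + x i)"
      by (subst prod_add) (simp_all add: sum_distrib_left)
    also have "\<dots> = (\<Prod>i\<in>?I. if i \<in> D then y i else x i - y i)"
      using D by (subst prod.If_cases) (auto simp: Int_absorb1 Diff_eq intro!: arg_cong2[where f = "(*)"] prod.cong)
    finally show ?thesis .
  qed
  let ?C = "compositions n"
  let ?F = "\<lambda>\<beta> \<gamma>. sf_scale (?w (descents \<beta>) * (- 1) ^ card (descents \<beta> - descents \<gamma>)) (sf_h_comp \<gamma>)"
  have "(\<Sum>\<beta>\<in>?C. sf_scale (?w (descents \<beta>)) (chi (ribbon \<beta>))) =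
      (\<Sum>\<beta>\<in>?C. \<Sum>\<gamma>\<in>?C. if descents \<gamma> \<subseteq> descents \<beta> then ?F \<beta> \<gamma> else 0)"
    using assms finite_compositions[of n]
    by (intro sum.cong refl) (auto simp: chi_ribbon sf.scale_sum_right sum.inter_filter intro!: sum.cong)
  also have "\<dots> = (\<Sum>\<gamma>\<in>?C. \<Sum>\<beta>\<in>?C. if descents \<gamma> \<subseteq> descents \<beta> then ?F \<beta> \<gamma> else 0)"
    by (rule sum.swap)
  also have "\<dots> = (\<Sum>\<gamma>\<in>?C. sf_scale (\<Prod>i\<in>?I. if i \<in> descents \<gamma> then y i else x i - y i) (sf_h_comp \<gamma>))"
  proof (intro sum.cong refl)
    fix \<gamma> assume "\<gamma> \<in> ?C"
    then show "(\<Sum>\<beta>\<in>?C. if descents \<gamma> \<subseteq> descents \<beta> then ?F \<beta> \<gamma> else 0) =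
        sf_scale (\<Prod>i\<in>?I. if i \<in> descents \<gamma> then y i else x i - y i) (sf_h_comp \<gamma>)"
      using finite_compositions[of n] inner[OF descents_subset, of \<gamma>]
      by (simp add: sum.inter_filter[symmetric] sf.scale_sum_left[symmetric])
  qed
  finally show ?thesis .
qed

text \<open>Compositions of \<open>m\<close> are read as paths from \<open>i\<close> to \<open>i + m\<close>.\<close>

definition path_sum :: "(nat \<Rightarrow> qt) \<Rightarrow> (nat \<Rightarrow> qt) \<Rightarrow> nat \<Rightarrow> nat \<Rightarrow> qt symfun" where
  "path_sum y v i m = (\<Sum>\<gamma>\<in>compositions m.
     sf_scale (\<Prod>j\<in>{1..<m}. if j \<in> descents \<gamma> then y (i + j) else v (i + j)) (sf_h_comp \<gamma>))"

definition step_weight :: "(nat \<Rightarrow> qt) \<Rightarrow> (nat \<Rightarrow> qt) \<Rightarrow> nat \<Rightarrow> nat \<Rightarrow> qt symfun" where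
  "step_weight y v i j = sf_scale ((\<Prod>k\<in>{i<..<j}. v k) * y j) (sf_h (j - i))"

lemma path_sum_0: "path_sum y v i 0 = 1"
  by (simp add: path_sum_def compositions_0)

text \<open>Splits off the first step. The endpoint is not a descent and has no weight in
  \<open>path_sum\<close>, but \<open>step_weight\<close> counts it; hence the condition y (i + m) =
  1.\<close>

lemma path_sum_rec:
  assumes "m > 0" "y (i + m) = 1"
  shows "path_sum y v i m = (\<Sum>j\<in>{i<..i + m}. step_weight y v i j * path_sum y v j (i + m - j))"
proof -
  let ?w = "\<lambda>i m \<gamma>. \<Prod>j\<in>{1..<m}. if j \<in> descents \<gamma> then y (i + j) else v (i + j)"
  have "compositions m = (\<Union>k\<in>{1..m}. (#) k ` compositions (m - k))"
  proof (rule Set.set_eqI)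
    fix \<gamma>
    show "\<gamma> \<in> compositions m \<longleftrightarrow> \<gamma> \<in> (\<Union>k\<in>{1..m}. (#) k ` compositions (m - k))"
      using assms(1) compositions_eq_Nil_iff[of "[]" m] by (cases \<gamma>) (auto simp: Cons_in_compositions)
  qed
  then have "path_sum y v i m = (\<Sum>k=1..m. \<Sum>\<gamma>\<in>(#) k ` compositions (m - k). sf_scale (?w i m \<gamma>) (sf_h_comp \<gamma>))"
    unfolding path_sum_def using finite_compositions by (simp only:) (subst sum.UNION_disjoint, auto)
  also have "\<dots> = (\<Sum>k=1..m. \<Sum>\<gamma>\<in>compositions (m - k). sf_scale (?w i m (k # \<gamma>)) (sf_h_comp (k # \<gamma>)))"
    by (simp add: sum.reindex del: pexp_list_simps descents_simps)
  also have "\<dots> = (\<Sum>k=1..m. step_weight y v i (i + k) * path_sum y v (i + k) (m - k))"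
  proof (intro sum.cong refl)
    fix k assume k: "k \<in> {1..m}"
    have "?w i m (k # \<gamma>) = (\<Prod>l\<in>{i<..<i + k}. v l) * y (i + k) * ?w (i + k) (m - k) \<gamma>"
      if \<gamma>: "\<gamma> \<in> compositions (m - k)" for \<gamma>
    proof -
      have v: "(\<Prod>j\<in>{1..<k}. v (i + j)) = (\<Prod>l\<in>{i<..<i + k}. v l)"
        by (rule prod.reindex_bij_witness[of _ "\<lambda>l. l - i" "\<lambda>j. i + j"]) auto
      show ?thesis
      proof (cases "k = m")
        case True
        then have "\<gamma> = []"
          using \<gamma> by (simp add: compositions_0)
        then show ?thesis
          using True assms(2) v by simp
      next
        case False
        then have "\<gamma> \<noteq> []"
          using k compositions_eq_Nil_iff[OF \<gamma>] by simp
        have I: "{1..<m} = {1..<k} \<union> ({k} \<union> (+) k ` {1..<m - k})"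
          using k False by (auto simp: image_add_atLeastLessThan)
        let ?f = "\<lambda>j. if j \<in> descents (k # \<gamma>) then y (i + j) else v (i + j)"
        have "?w i m (k # \<gamma>) = (\<Prod>j\<in>{1..<k}. ?f j) * (?f k * (\<Prod>j\<in>(+) k ` {1..<m - k}. ?f j))"
          unfolding I by (subst prod.union_disjoint, simp, simp, force, subst prod.union_disjoint) auto
        also have "(\<Prod>j\<in>{1..<k}. ?f j) = (\<Prod>j\<in>{1..<k}. v (i + j))"
          using \<open>\<gamma> \<noteq> []\<close> by (intro prod.cong refl) auto
        also have "?f k = y (i + k)"
          using \<open>\<gamma> \<noteq> []\<close> by simp
        also have "(\<Prod>j\<in>(+) k ` {1..<m - k}. ?f j) = ?w (i + k) (m - k) \<gamma>"
          using \<open>\<gamma> \<noteq> []\<close> by (subst prod.reindex) (auto simp: add.assoc intro!: prod.cong)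
        finally show ?thesis
          unfolding v by (simp only: mult.assoc)
      qed
    qed
    then show "(\<Sum>\<gamma>\<in>compositions (m - k). sf_scale (?w i m (k # \<gamma>)) (sf_h_comp (k # \<gamma>))) =
        step_weight y v i (i + k) * path_sum y v (i + k) (m - k)"
      by (simp add: step_weight_def path_sum_def sum_distrib_left mult_sf_scale_left mult_sf_scale_right
          sf_h_eq_pexp mult.commute del: descents_simps)
  qed
  also have "\<dots> = (\<Sum>j\<in>{i<..i + m}. step_weight y v i j * path_sum y v j (i + m - j))"
    by (rule sum.reindex_bij_witness[of _ "\<lambda>j. j - i" "\<lambda>k. i + k"]) auto
  finally show ?thesis .
qed

text \<open>Paths from 0 to j, built by their last step; unlike in \<open>path_sum\<close>, the
  weight of the endpoint is included.\<close>

fun prefix_sum :: "(nat \<Rightarrow> qt) \<Rightarrow> (nat \<Rightarrow> qt) \<Rightarrow> nat \<Rightarrow> qt symfun" where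
  "prefix_sum y v j = (if j = 0 then 1 else (\<Sum>i\<in>{..<j}. prefix_sum y v i * step_weight y v i j))"

declare prefix_sum.simps [simp del]

text \<open>Cuts every path at its step across \<open>a + 1/2\<close>.\<close>

lemma path_sum_cut:
  assumes "a < n" "y n = 1"
  shows "path_sum y v 0 n = (\<Sum>r\<le>a. \<Sum>j\<in>{a<..n}. prefix_sum y v r * step_weight y v r j * path_sum y v j (n - j))"
  using assms(1)
proof (induction a)
  case 0
  then show ?case
    using path_sum_rec[of n y 0 v] assms(2) by (simp add: prefix_sum.simps[of _ _ 0])
next
  case (Suc a)
  let ?f = "\<lambda>r j. prefix_sum y v r * step_weight y v r j * path_sum y v j (n - j)"
  \<comment> \<open>Moving the cut by one: paths that land on a + 1 now cross it with their next
    step.\<close>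
  have "{a<..n} = insert (Suc a) {Suc a<..n}"
    using Suc.prems by auto
  then have "path_sum y v 0 n = (\<Sum>r\<le>a. ?f r (Suc a)) + (\<Sum>r\<le>a. \<Sum>j\<in>{Suc a<..n}. ?f r j)"
    using Suc by (simp add: sum.distrib)
  also have "(\<Sum>r\<le>a. ?f r (Suc a)) = prefix_sum y v (Suc a) * path_sum y v (Suc a) (n - Suc a)"
    by (simp add: prefix_sum.simps[of _ _ "Suc a"] sum_distrib_right lessThan_Suc_atMost)
  also have "\<dots> = (\<Sum>j\<in>{Suc a<..n}. ?f (Suc a) j)"
    using path_sum_rec[of "n - Suc a" y "Suc a" v] assms(2) Suc.prems by (simp add: sum_distrib_left mult.assoc)
  finally show ?case
    by (simp add: add.commute)
qed

section \<open>The noncommutative function of a hook\<close>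

lemma pexp_cong:
  assumes "\<And>k. k > 0 \<Longrightarrow> \<sigma> k = \<tau> k"
  shows "pexp \<sigma> n = pexp \<tau> n"
proof (rule newton_unique[OF of_nat_mult_symfun_cancel _ pexp_newton])
  fix n
  show "of_nat n * pexp \<tau> n = (\<Sum>j=1..n. sf_scale (\<sigma> j) (sf_p j) * pexp \<tau> (n - j))"
    unfolding pexp_newton by (intro sum.cong refl) (simp add: assms)
qed simp_all

text \<open>\<open>pexp t_inv r\<close> is \<open>(-1)\<^sup>r e\<^sub>r[X/(1 - t)]\<close>, and \<open>pexp q_inv s\<close> is \<open>h\<^sub>s[X/(1 - q)]\<close>.\<close>

definition t_inv :: "nat \<Rightarrow> qt" where
  "t_inv k = inverse (t ^ k - 1)"

definition q_inv :: "nat \<Rightarrow> qt" where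
  "q_inv k = inverse (1 - q ^ k)"

text \<open>For k > 0, \<open>t_inv k + 1\<close> is t^k times \<open>t_inv k\<close>, so
  multiplication by the series of the h_n replaces z by t z.\<close>

lemma pexp_t_inv: "(\<Sum>i<r. pexp t_inv i * sf_h (r - i)) = sf_scale (t ^ r - 1) (pexp t_inv r)"
proof -
  have "t_inv k + 1 = t ^ k * t_inv k" if "k > 0" for k
    using t_power_neq_one[OF that] by (simp add: t_inv_def field_simps)
  then have "pexp (\<lambda>k. t_inv k + 1) r = sf_scale (t ^ r) (pexp t_inv r)"
    using pexp_cong[of "\<lambda>k. t_inv k + 1" "\<lambda>k. t ^ k * t_inv k" r] by (simp add: pexp_power)
  then have "sf_scale (t ^ r) (pexp t_inv r) = (\<Sum>i\<le>r. pexp t_inv i * sf_h (r - i))"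
    by (simp add: pexp_add sf_h_eq_pexp)
  also have "\<dots> = (\<Sum>i<r. pexp t_inv i * sf_h (r - i)) + pexp t_inv r"
    by (simp add: sf_h_zero flip: lessThan_Suc_atMost)
  finally show ?thesis
    by (simp add: sf.scale_left_diff_distrib)
qed

text \<open>Here multiplication by the series of the h_n leads from q z back to z.\<close>

lemma pexp_q_inv: "(\<Sum>i<s. sf_scale (q ^ i) (pexp q_inv i * sf_h (s - i))) = sf_scale (1 - q ^ s) (pexp q_inv s)"
proof -
  have "q ^ k * q_inv k + 1 = q_inv k" if "k > 0" for k
    using q_power_neq_one[OF that] by (simp add: q_inv_def field_simps)
  then have "pexp (\<lambda>k. q ^ k * q_inv k + 1) s = pexp q_inv s"
    by (rule pexp_cong)
  then have "pexp q_inv s = (\<Sum>i\<le>s. sf_scale (q ^ i) (pexp q_inv i * sf_h (s - i)))"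
    by (simp add: pexp_add pexp_power sf_h_eq_pexp mult_sf_scale_left)
  also have "\<dots> = (\<Sum>i<s. sf_scale (q ^ i) (pexp q_inv i * sf_h (s - i))) + sf_scale (q ^ s) (pexp q_inv s)"
    by (simp add: sf_h_zero flip: lessThan_Suc_atMost)
  finally show ?thesis
    by (simp add: sf.scale_left_diff_distrib algebra_simps)
qed

text \<open>By \<open>nc_H_hook_weight\<close> a point i <= a weighs 1 as a descent of \<beta> and
  t^i otherwise; a point i > a weighs q^{a+b-i} as a descent and 1 otherwise. \<open>hook_y\<close>
  is the weight of a descent, \<open>hook_v\<close> the other weight minus it.\<close>

definition hook_y :: "nat \<Rightarrow> nat \<Rightarrow> nat \<Rightarrow> qt" where
  "hook_y a b i = (if i \<le> a then 1 else q ^ (a + b - i))"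

definition hook_v :: "nat \<Rightarrow> nat \<Rightarrow> nat \<Rightarrow> qt" where
  "hook_v a b i = (if i \<le> a then t ^ i - 1 else 1 - q ^ (a + b - i))"

lemma prod_atLeast1_split:
  assumes "i < r"
  shows "(\<Prod>k=1..i. f k) * (\<Prod>k\<in>{i<..<r}. f k) = (\<Prod>k=1..<r. f (k::nat))"
proof -
  have "{1..<r} = {1..i} \<union> {i<..<r}"
    using assms by auto
  moreover have "{1..i} \<inter> {i<..<r} = {}"
    by auto
  ultimately show ?thesis
    by (simp add: prod.union_disjoint)
qed

lemma prod_atLeast1_Suc: "r > 0 \<Longrightarrow> (\<Prod>k=1..<r. f k) * f r = (\<Prod>k=1..r. f (k::nat))"
  by (cases r) (simp_all add: atLeastLessThanSuc_atLeastAtMost)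

text \<open>The factor t^r - 1 produced by \<open>pexp_t_inv\<close> is the weight that extends the
  product from r - 1 to r.\<close>

lemma prefix_sum_hook:
  "r \<le> a \<Longrightarrow> prefix_sum (hook_y a b) (hook_v a b) r = sf_scale (\<Prod>k=1..r. t ^ k - 1) (pexp t_inv r)"
proof (induction r rule: less_induct)
  case (less r)
  show ?case
  proof (cases "r = 0")
    case False
    let ?f = "\<lambda>k. t ^ k - 1 :: qt"
    have "prefix_sum (hook_y a b) (hook_v a b) i * step_weight (hook_y a b) (hook_v a b) i r =
        sf_scale (\<Prod>k=1..<r. ?f k) (pexp t_inv i * sf_h (r - i))" if "i < r" for i
    proof -
      have "(\<Prod>k\<in>{i<..<r}. hook_v a b k) = (\<Prod>k\<in>{i<..<r}. ?f k)"
        using less.prems by (intro prod.cong refl) (auto simp: hook_v_def)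
      moreover have "hook_y a b r = 1"
        using less.prems by (simp add: hook_y_def)
      ultimately show ?thesis
        using less that prod_atLeast1_split[OF that, of ?f]
        by (simp add: step_weight_def mult_sf_scale_left mult_sf_scale_right mult.commute)
    qed
    then have "prefix_sum (hook_y a b) (hook_v a b) r = (\<Sum>i<r. sf_scale (\<Prod>k=1..<r. ?f k) (pexp t_inv i * sf_h (r - i)))"
      using False by (simp add: prefix_sum.simps[of _ _ r])
    also have "\<dots> = sf_scale ((\<Prod>k=1..<r. ?f k) * ?f r) (pexp t_inv r)"
      by (simp add: pexp_t_inv flip: sf.scale_sum_right)
    also have "(\<Prod>k=1..<r. ?f k) * ?f r = (\<Prod>k=1..r. ?f k)"
      using False by (intro prod_atLeast1_Suc) simp
    finally show ?thesis .
  qed (simp add: prefix_sum.simps)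
qed

text \<open>The same from the far end, with points numbered by their distance from a + b and the
  first step split off.\<close>

lemma path_sum_hook:
  "s < b \<Longrightarrow> path_sum (hook_y a b) (hook_v a b) (a + b - s) s = sf_scale (\<Prod>k=1..s. 1 - q ^ k) (pexp q_inv s)"
proof (induction s rule: less_induct)
  case (less s)
  show ?case
  proof (cases "s = 0")
    case False
    let ?n = "a + b"
    let ?y = "hook_y a b" and ?v = "hook_v a b"
    let ?f = "\<lambda>k. 1 - q ^ k :: qt"
    have n: "?n - s + s = ?n"
      using less.prems by simp
    have "path_sum ?y ?v (?n - s) s =
        (\<Sum>j\<in>{?n - s<..?n}. step_weight ?y ?v (?n - s) j * path_sum ?y ?v j (?n - j))"
      using path_sum_rec[of s ?y "?n - s" ?v] False less.prems unfolding n by (simp add: hook_y_def)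
    also have "\<dots> = (\<Sum>i<s. step_weight ?y ?v (?n - s) (?n - i) * path_sum ?y ?v (?n - i) i)"
      by (rule sum.reindex_bij_witness[of _ "\<lambda>i. ?n - i" "\<lambda>j. ?n - j"]) (use less.prems in auto)
    also have "\<dots> = (\<Sum>i<s. sf_scale (\<Prod>k=1..<s. ?f k) (sf_scale (q ^ i) (pexp q_inv i * sf_h (s - i))))"
    proof (intro sum.cong refl)
      fix i assume "i \<in> {..<s}"
      then have i: "i < s" by simp
      have "(\<Prod>k\<in>{?n - s<..<?n - i}. ?v k) = (\<Prod>k\<in>{i<..<s}. ?f k)"
        by (rule prod.reindex_bij_witness[of _ "\<lambda>k. ?n - k" "\<lambda>k. ?n - k"])
          (use less.prems in \<open>auto simp: hook_v_def\<close>)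
      moreover have "?y (?n - i) = q ^ i" "?n - i - (?n - s) = s - i"
        using i less.prems by (auto simp: hook_y_def)
      ultimately show "step_weight ?y ?v (?n - s) (?n - i) * path_sum ?y ?v (?n - i) i =
          sf_scale (\<Prod>k=1..<s. ?f k) (sf_scale (q ^ i) (pexp q_inv i * sf_h (s - i)))"
        using less i prod_atLeast1_split[OF i, of ?f]
        by (simp add: step_weight_def mult_sf_scale_left mult_sf_scale_right mult_ac)
    qed
    also have "\<dots> = sf_scale ((\<Prod>k=1..<s. ?f k) * ?f s) (pexp q_inv s)"
      unfolding sf.scale_sum_right[symmetric] pexp_q_inv by (simp only: sf.scale_scale)
    also have "(\<Prod>k=1..<s. ?f k) * ?f s = (\<Prod>k=1..s. ?f k)"
      using False by (intro prod_atLeast1_Suc) simp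
    finally show ?thesis .
  qed (simp add: path_sum_0)
qed

text \<open>The scalars of the prefix up to r, of the points jumped over by the crossing step and of
  the rest from a + b - s on complement each other to \<open>hook_factor a b\<close> for all r and
  s.\<close>

lemma path_sum_hook_total:
  assumes "b \<ge> 1"
  shows "path_sum (hook_y a b) (hook_v a b) 0 (a + b) = sf_scale (hook_factor a b)
    (\<Sum>r\<le>a. \<Sum>s<b. sf_scale (q ^ s) (pexp t_inv r * (pexp q_inv s * sf_h (a + b - r - s))))"
proof -
  let ?n = "a + b"
  let ?y = "hook_y a b" and ?v = "hook_v a b"
  have summand: "prefix_sum ?y ?v r * step_weight ?y ?v r (?n - s) * path_sum ?y ?v (?n - s) s =
      sf_scale (hook_factor a b) (sf_scale (q ^ s) (pexp t_inv r * (pexp q_inv s * sf_h (a + b - r - s))))"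
    if r: "r \<le> a" and s: "s < b" for r s
  proof -
    let ?f = "\<lambda>k. t ^ k - 1 :: qt" and ?g = "\<lambda>k. 1 - q ^ k :: qt"
    have "{r<..<?n - s} = {r<..<Suc a} \<union> {a<..<?n - s}" "{r<..<Suc a} \<inter> {a<..<?n - s} = {}"
      using r s by auto
    then have "(\<Prod>k\<in>{r<..<?n - s}. ?v k) = (\<Prod>k\<in>{r<..<Suc a}. ?v k) * (\<Prod>k\<in>{a<..<?n - s}. ?v k)"
      by (simp add: prod.union_disjoint)
    also have "(\<Prod>k\<in>{r<..<Suc a}. ?v k) = (\<Prod>k\<in>{r<..<Suc a}. ?f k)"
      by (intro prod.cong refl) (auto simp: hook_v_def)
    also have "(\<Prod>k\<in>{a<..<?n - s}. ?v k) = (\<Prod>k\<in>{s<..<b}. ?g k)"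
      by (rule prod.reindex_bij_witness[of _ "\<lambda>k. ?n - k" "\<lambda>k. ?n - k"])
        (use s in \<open>auto simp: hook_v_def\<close>)
    finally have v: "(\<Prod>k\<in>{r<..<?n - s}. ?v k) = (\<Prod>k\<in>{r<..<Suc a}. ?f k) * (\<Prod>k\<in>{s<..<b}. ?g k)" .
    have y: "?y (?n - s) = q ^ s" "?n - s - r = ?n - r - s"
      using s by (auto simp: hook_y_def)
    have factor: "hook_factor a b = ((\<Prod>k=1..r. ?f k) * (\<Prod>k\<in>{r<..<Suc a}. ?f k)) *
        ((\<Prod>k=1..s. ?g k) * (\<Prod>k\<in>{s<..<b}. ?g k))"
      unfolding prod_atLeast1_split[OF le_imp_less_Suc[OF r]] prod_atLeast1_split[OF s] hook_factor_def
      by (simp add: atLeastLessThanSuc_atLeastAtMost)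
    show ?thesis
      unfolding factor step_weight_def v y prefix_sum_hook[OF r] path_sum_hook[OF s]
      by (simp add: mult_sf_scale_left mult_sf_scale_right mult_ac)
  qed
  have "path_sum ?y ?v 0 ?n = (\<Sum>r\<le>a. \<Sum>j\<in>{a<..?n}. prefix_sum ?y ?v r * step_weight ?y ?v r j * path_sum ?y ?v j (?n - j))"
    using assms by (intro path_sum_cut) (simp_all add: hook_y_def)
  also have "\<dots> = (\<Sum>r\<le>a. \<Sum>s<b. prefix_sum ?y ?v r * step_weight ?y ?v r (?n - s) * path_sum ?y ?v (?n - s) s)"
    by (intro sum.cong refl sum.reindex_bij_witness[of _ "\<lambda>s. ?n - s" "\<lambda>j. ?n - j"]) auto
  also have "\<dots> = (\<Sum>r\<le>a. \<Sum>s<b. sf_scale (hook_factor a b)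
      (sf_scale (q ^ s) (pexp t_inv r * (pexp q_inv s * sf_h (a + b - r - s)))))"
    by (intro sum.cong refl summand) auto
  finally show ?thesis
    by (simp only: sf.scale_sum_right)
qed

text \<open>Here D(\<alpha>) = {1..a}, which leaves t^i for the i <= a outside D(\<beta>). The
  conjugate has descents 1, ..., b - 1, and reversal i -> a + b - i matches them with the i > a in
  D(\<beta>).\<close>

lemma nc_H_hook_weight:
  assumes "b \<ge> 1" "\<beta> \<in> compositions (a + b)"
  shows "t ^ common_sum (replicate a 1 @ [b]) (complement \<beta>) *
      q ^ common_sum (conjugate (replicate a 1 @ [b])) (rev \<beta>) =
    (\<Prod>i\<in>{1..<a + b}. if i \<in> descents \<beta> then hook_y a b i else hook_y a b i + hook_v a b i)" (is "?l = ?r")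
proof -
  let ?n = "a + b"
  let ?\<alpha> = "replicate a 1 @ [b]"
  let ?D = "descents \<beta>"
  have \<alpha>: "?\<alpha> \<in> compositions ?n"
    using assms(1) by (auto simp: compositions_def sum_list_replicate)
  have D: "?D \<subseteq> {1..<?n}"
    by (rule descents_subset[OF assms(2)])
  have "descents (conjugate ?\<alpha>) = (\<lambda>i. ?n - i) ` ({1..<?n} - {1..a})"
    unfolding conjugate_def descents_rev[OF complement(1)[OF \<alpha>]] complement(2)[OF \<alpha>]
      descents_hook_composition ..
  also have "\<dots> = {1..<b}"
  proof (intro equalityI subsetI)
    fix i assume "i \<in> {1..<b}"
    then show "i \<in> (\<lambda>i. ?n - i) ` ({1..<?n} - {1..a})"
      by (intro image_eqI[of _ _ "?n - i"]) auto
  qed auto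
  finally have conj: "descents (conjugate ?\<alpha>) = {1..<b}" .
  have "common_sum ?\<alpha> (complement \<beta>) = (\<Sum>i\<in>{1..a} - ?D. i)"
    unfolding common_sum_def complement(2)[OF assms(2)] descents_hook_composition
    by (rule sum.cong) (use assms(1) in auto)
  then have t: "t ^ common_sum ?\<alpha> (complement \<beta>) = (\<Prod>i\<in>{1..a} - ?D. t ^ i)"
    by (simp add: power_sum)
  have "common_sum (conjugate ?\<alpha>) (rev \<beta>) = (\<Sum>i\<in>?D \<inter> {a<..<?n}. ?n - i)"
    unfolding common_sum_def conj descents_rev[OF assms(2)]
    by (rule sum.reindex_bij_witness[of _ "\<lambda>i. ?n - i" "\<lambda>i. ?n - i"]) (use D in auto)
  then have q: "q ^ common_sum (conjugate ?\<alpha>) (rev \<beta>) = (\<Prod>i\<in>?D \<inter> {a<..<?n}. q ^ (?n - i))"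
    by (simp add: power_sum)
  have "?r = (\<Prod>i\<in>{1..<?n}. (if i \<in> {1..a} - ?D then t ^ i else 1) * (if i \<in> ?D \<inter> {a<..<?n} then q ^ (?n - i) else 1))"
    by (intro prod.cong refl) (auto simp: hook_y_def hook_v_def)
  also have "\<dots> = (\<Prod>i\<in>{1..<?n} \<inter> ({1..a} - ?D). t ^ i) * (\<Prod>i\<in>{1..<?n} \<inter> (?D \<inter> {a<..<?n}). q ^ (?n - i))"
    by (simp only: prod.distrib prod.inter_restrict finite_atLeastLessThan)
  also have "{1..<?n} \<inter> ({1..a} - ?D) = {1..a} - ?D"
    using assms(1) by auto
  also have "{1..<?n} \<inter> (?D \<inter> {a<..<?n}) = ?D \<inter> {a<..<?n}"
    using D by auto
  finally show ?thesis
    unfolding t q by simp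
qed

lemma chi_nc_H_hook:
  assumes "b \<ge> 1"
  shows "chi (nc_H (replicate a 1 @ [b])) = sf_scale (hook_factor a b)
    (\<Sum>r\<le>a. \<Sum>s<b. sf_scale (q ^ s) (pexp t_inv r * (pexp q_inv s * sf_h (a + b - r - s))))"
proof -
  let ?n = "a + b"
  have n: "sum_list (replicate a 1 @ [b]) = ?n"
    by (simp add: sum_list_replicate)
  have "chi (nc_H (replicate a 1 @ [b])) = (\<Sum>\<beta>\<in>compositions ?n.
      sf_scale (\<Prod>i\<in>{1..<?n}. if i \<in> descents \<beta> then hook_y a b i else hook_y a b i + hook_v a b i) (chi (ribbon \<beta>)))"
    unfolding nc_H_def n chi_sum chi_nc_scale
    by (intro sum.cong refl arg_cong2[where f = sf_scale] nc_H_hook_weight[OF assms])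
  also have "\<dots> = path_sum (hook_y a b) (hook_v a b) 0 ?n"
    using assms by (subst sum_ribbons) (simp_all add: path_sum_def cong: if_cong)
  finally show ?thesis
    using path_sum_hook_total[OF assms] by simp
qed

lemma homogeneous_chi_nc_H_hook:
  assumes "b \<ge> 1"
  shows "homogeneous (a + b) (chi (nc_H (replicate a 1 @ [b])))"
  unfolding chi_nc_H_hook[OF assms]
proof (intro homogeneous_scale homogeneous_sum)
  fix r s assume "r \<in> {..a}" "s \<in> {..<b}"
  then have "r + (s + (a + b - r - s)) = a + b"
    by simp
  then show "homogeneous (a + b) (pexp t_inv r * (pexp q_inv s * sf_h (a + b - r - s)))"
    unfolding sf_h_eq_pexp by (metis homogeneous_mult homogeneous_pexp)
qed

text \<open>The operators \<open>pexp_adj\<close> with weights \<open>t_inv\<close>,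
  \<open>q_inv\<close> and 1 are adjoint for the Hall form to the factors of the noncommutative
  image, and for \<open>t_form\<close> to those of \<open>hook_J\<close>, because there the weights
  are multiplied by 1 - t^k.\<close>

lemma t_form_hook_J:
  assumes "b \<ge> 1"
  shows "t_form (hook_J a b) f = hall (chi (nc_H (replicate a 1 @ [b]))) f"
proof -
  have w: "(\<lambda>k. t_weight k * q_inv k) = qt_weight" "(\<lambda>k. t_weight k * 1) = (\<lambda>k. 1 - t ^ k)"
    by (simp_all add: fun_eq_iff t_weight_def q_inv_def qt_weight_def divide_inverse)
  have e: "pexp (\<lambda>k. t_weight k * t_inv k) n = signed_e n" for n
  proof (rule pexp_cong)
    fix k :: nat assume "k > 0"
    then show "t_weight k * t_inv k = - 1"
      using t_power_neq_one[of k] by (simp add: t_weight_def t_inv_def field_simps)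
  qed
  have "t_form (signed_e r * (qt_g s * t_h m)) f = hall (pexp t_inv r * (pexp q_inv s * sf_h m)) f" for r s m
  proof -
    let ?f = "pexp_adj (\<lambda>k. 1) m (pexp_adj q_inv s (pexp_adj t_inv r f))"
    have "weighted_form t_weight f (signed_e r * (qt_g s * (t_h m * 1))) = weighted_form t_weight ?f 1"
      by (simp only: weighted_form_pexp_adj[of t_weight, OF t_weight_nonzero] w e)
    moreover have "hall f (pexp t_inv r * (pexp q_inv s * (sf_h m * 1))) = hall ?f 1"
      by (simp add: weighted_form_pexp_adj sf_h_eq_pexp)
    ultimately show ?thesis
      by (simp add: weighted_form_one t_form_eq weighted_form_commute[of _ f])
  qed
  then show ?thesis
    unfolding chi_nc_H_hook[OF assms] hook_J_def t_form_eq by (simp add: weighted_form_linear)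
qed

theorem proposition20:
  fixes a b :: nat
  assumes "b \<ge> 1"
  shows "chi (nc_H (replicate a 1 @ [b])) = macdonald_H (b # replicate a 1)"
proof -
  have "macdonald_H (hook a b) = chi (nc_H (replicate a 1 @ [b]))"
  proof (rule macdonald_H_eqI)
    show "homogeneous (sum_list (hook a b)) (macdonald_J (hook a b))"
      unfolding sum_list_hook macdonald_J_hook[OF assms] by (rule homogeneous_hook_J)
    show "homogeneous (sum_list (hook a b)) (chi (nc_H (replicate a 1 @ [b])))"
      unfolding sum_list_hook by (rule homogeneous_chi_nc_H_hook[OF assms])
    show "t_form (macdonald_J (hook a b)) f = hall (chi (nc_H (replicate a 1 @ [b]))) f" for f
      unfolding macdonald_J_hook[OF assms] by (rule t_form_hook_J[OF assms])
  qed
  then show ?thesis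
    by simp
qed

end
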